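(* For any $v\in\mathbb{R}_{+}$, the submanifold $\mathcal{M}_v:=\{g\in\mathcal{M} : V_g=v\}$ is totally geodesic in $(\mathcal{M},g_N)$.
   Context: $M$ is an $n$-dimensional compact closed manifold and $\mathcal{M}$ is the space of all smooth Riemannian metrics on $M$, an open cone in the Fréchet space $\Gamma(S^2T^*M)$ of smooth symmetric $(0,2)$-tensor fields; so $T_g\mathcal{M}\cong\Gamma(S^2T^*M)$. The Ebin metric is $g_E(h,k)|_g=\int_M \mathrm{tr}(g^{-1}hg^{-1}k)\,dV_g$, $V_g=\int_M dV_g$ is the total volume, and $g_N(h,k)|_g=\frac{1}{V_g}g_E(h,k)|_g$, which has a Levi-Civita connection. A submanifold is totally geodesic if every geodesic of the ambient space starting at a point of the submanifold with initial velocity tangent to it stays in the submanifold. *)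

theory Defs
  imports "HOL-Analysis.Analysis"
begin

primrec partials :: "'n::finite list \<Rightarrow> (real^'n \<Rightarrow> 'b::real_normed_vector) \<Rightarrow> real^'n \<Rightarrow> 'b" where
  "partials [] f = f"
| "partials (i # is) f = (\<lambda>x. frechet_derivative (partials is f) (at x) (axis i 1))"

text \<open>Meant for open \<open>S\<close>.  Differentiability of every iterated partial derivative makes all of
  them continuous, so this is smoothness in the sense of \<open>C\<close>-infinity.\<close>

definition smooth_on :: "(real^'n::finite) set \<Rightarrow> (real^'n \<Rightarrow> 'b::real_normed_vector) \<Rightarrow> bool" where
  "smooth_on S f \<longleftrightarrow> (\<forall>is. \<forall>x\<in>S. partials is f differentiable (at x))"

text \<open>The manifold is the whole type \<open>'a\<close>; its dimension is \<open>CARD('n)\<close>.  In a chart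
  \<open>(U, \<phi>)\<close> the values of \<open>\<phi>\<close> outside \<open>U\<close> play no role.\<close>

type_synonym ('a, 'n) chart = "'a set \<times> ('a \<Rightarrow> real^'n)"

definition coords :: "('a, 'n::finite) chart \<Rightarrow> (real^'n) set" where
  "coords c = snd c ` fst c"

definition overlap :: "('a, 'n::finite) chart \<Rightarrow> ('a, 'n) chart \<Rightarrow> (real^'n) set" where
  "overlap c d = snd c ` (fst c \<inter> fst d)"

definition transition :: "('a, 'n::finite) chart \<Rightarrow> ('a, 'n) chart \<Rightarrow> real^'n \<Rightarrow> real^'n" where
  "transition c d = snd d \<circ> inv_into (fst c) (snd c)"

definition smooth_atlas :: "('a::topological_space, 'n::finite) chart set \<Rightarrow> bool" where
  "smooth_atlas A \<longleftrightarrow>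
     (\<forall>(U, \<phi>)\<in>A. open U \<and> open (\<phi> ` U) \<and> homeomorphism U (\<phi> ` U) \<phi> (inv_into U \<phi>)) \<and>
     (\<Union>(U, \<phi>)\<in>A. U) = UNIV \<and>
     (\<forall>c\<in>A. \<forall>d\<in>A. smooth_on (overlap c d) (transition c d))"

text \<open>Second countability follows from compactness.\<close>

definition closed_manifold :: "('a::t2_space, 'n::finite) chart set \<Rightarrow> bool" where
  "closed_manifold A \<longleftrightarrow> smooth_atlas A \<and> compact (UNIV :: 'a set)"

text \<open>A (0,2)-tensor field is given by its matrix of components \<open>h c x\<close> in every chart \<open>c\<close> of the
  atlas, as a function of the coordinates \<open>x\<close>; the components are related by pullback under the
  transition maps.  They are set to 0 where they have no meaning, so that equality of tensor fields
  is equality of functions.\<close>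

type_synonym ('a, 'n) tensor = "('a, 'n) chart \<Rightarrow> real^'n \<Rightarrow> real^'n^'n"

definition sym_tensors :: "('a, 'n::finite) chart set \<Rightarrow> ('a, 'n) tensor set" where
  "sym_tensors A = {h.
     (\<forall>c\<in>A. smooth_on (coords c) (h c)) \<and>
     (\<forall>c\<in>A. \<forall>x\<in>coords c. transpose (h c x) = h c x) \<and>
     (\<forall>c\<in>A. \<forall>d\<in>A. \<forall>x\<in>overlap c d.
        h c x = transpose (jacobian (transition c d) (at x)) ** h d (transition c d x)
                  ** jacobian (transition c d) (at x)) \<and>
     (\<forall>c x. c \<notin> A \<or> x \<notin> coords c \<longrightarrow> h c x = 0)}"

definition metrics :: "('a, 'n::finite) chart set \<Rightarrow> ('a, 'n) tensor set" where
  "metrics A = {g \<in> sym_tensors A. \<forall>c\<in>A. \<forall>x\<in>coords c. \<forall>v. v \<noteq> 0 \<longrightarrow> v \<bullet> (g c x *v v) > 0}"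

definition tensor_zero :: "('a, 'n::finite) tensor" where
  "tensor_zero = (\<lambda>c x. 0)"

definition tensor_add :: "('a, 'n::finite) tensor \<Rightarrow> ('a, 'n) tensor \<Rightarrow> ('a, 'n) tensor" where
  "tensor_add h k = (\<lambda>c x. h c x + k c x)"

definition tensor_scale :: "real \<Rightarrow> ('a, 'n::finite) tensor \<Rightarrow> ('a, 'n) tensor" where
  "tensor_scale r h = (\<lambda>c x. r *\<^sub>R h c x)"

text \<open>The Riemannian measure: the unique Borel measure whose density with respect to Lebesgue
  measure is \<open>sqrt (det g)\<close> in every chart.  No orientation is needed.\<close>

definition riemannian_measure ::
  "('a::t2_space, 'n::finite) chart set \<Rightarrow> ('a, 'n) tensor \<Rightarrow> 'a measure" where
  "riemannian_measure A g = (THE \<mu>. sets \<mu> = sets borel \<and>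
     (\<forall>c\<in>A. \<forall>B\<in>sets borel. B \<subseteq> fst c \<longrightarrow>
        emeasure \<mu> B = (\<integral>\<^sup>+x\<in>snd c ` B. ennreal (sqrt (det (g c x))) \<partial>lborel)))"

definition total_volume :: "('a::t2_space, 'n::finite) chart set \<Rightarrow> ('a, 'n) tensor \<Rightarrow> real" where
  "total_volume A g = measure (riemannian_measure A g) UNIV"

text \<open>The function \<open>tr (g\<^sup>-\<^sup>1 h g\<^sup>-\<^sup>1 k)\<close> on the manifold.  For tensor fields its value does not depend
  on the chart around \<open>p\<close> in which it is computed.\<close>

definition trace_pairing ::
  "('a, 'n::finite) chart set \<Rightarrow> ('a, 'n) tensor \<Rightarrow> ('a, 'n) tensor \<Rightarrow> ('a, 'n) tensor \<Rightarrow> 'a \<Rightarrow> real" where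
  "trace_pairing A g h k p =
     (let c = (SOME c. c \<in> A \<and> p \<in> fst c); x = snd c p
      in trace (matrix_inv (g c x) ** h c x ** matrix_inv (g c x) ** k c x))"

definition ebin_metric ::
  "('a::t2_space, 'n::finite) chart set \<Rightarrow> ('a, 'n) tensor \<Rightarrow> ('a, 'n) tensor \<Rightarrow> ('a, 'n) tensor \<Rightarrow> real" where
  "ebin_metric A g h k = (\<integral>p. trace_pairing A g h k p \<partial>riemannian_measure A g)"

definition normalized_ebin_metric ::
  "('a::t2_space, 'n::finite) chart set \<Rightarrow> ('a, 'n) tensor \<Rightarrow> ('a, 'n) tensor \<Rightarrow> ('a, 'n) tensor \<Rightarrow> real" where
  "normalized_ebin_metric A g h k = ebin_metric A g h k / total_volume A g"

definition fixed_volume_metrics ::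
  "('a::t2_space, 'n::finite) chart set \<Rightarrow> real \<Rightarrow> ('a, 'n) tensor set" where
  "fixed_volume_metrics A v = {g \<in> metrics A. total_volume A g = v}"

text \<open>Convergence in the Frechet topology of \<open>sym_tensors A\<close>: uniform convergence of all partial
  derivatives of the components on compact subsets of charts.\<close>

definition tensor_tendsto ::
  "('a, 'n::finite) chart set \<Rightarrow> ('i \<Rightarrow> ('a, 'n) tensor) \<Rightarrow> ('a, 'n) tensor \<Rightarrow> 'i filter \<Rightarrow> bool" where
  "tensor_tendsto A f l F \<longleftrightarrow>
     (\<forall>c\<in>A. \<forall>K. compact K \<and> K \<subseteq> coords c \<longrightarrow>
        (\<forall>is. uniform_limit K (\<lambda>s. partials is (f s c)) (partials is (l c)) F))"

definition has_curve_derivative ::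
  "('a, 'n::finite) chart set \<Rightarrow> real set \<Rightarrow> (real \<Rightarrow> ('a, 'n) tensor) \<Rightarrow> ('a, 'n) tensor \<Rightarrow> real \<Rightarrow> bool" where
  "has_curve_derivative A I \<gamma> h t \<longleftrightarrow>
     h \<in> sym_tensors A \<and>
     tensor_tendsto A
       (\<lambda>s. tensor_scale (1 / (s - t)) (tensor_add (\<gamma> s) (tensor_scale (- 1) (\<gamma> t)))) h (at t within I)"

definition curve_deriv ::
  "('a, 'n::finite) chart set \<Rightarrow> real set \<Rightarrow> (real \<Rightarrow> ('a, 'n) tensor) \<Rightarrow> real \<Rightarrow> ('a, 'n) tensor" where
  "curve_deriv A I \<gamma> t = (THE h. has_curve_derivative A I \<gamma> h t)"

definition smooth_metric_curve ::
  "('a, 'n::finite) chart set \<Rightarrow> real set \<Rightarrow> (real \<Rightarrow> ('a, 'n) tensor) \<Rightarrow> bool" where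
  "smooth_metric_curve A I \<gamma> \<longleftrightarrow>
     is_interval I \<and> interior I \<noteq> {} \<and> (\<forall>t\<in>I. \<gamma> t \<in> metrics A) \<and>
     (\<forall>m. \<forall>t\<in>I. \<exists>h. has_curve_derivative A I ((curve_deriv A I ^^ m) \<gamma>) h t)"

text \<open>On the open subset \<open>metrics A\<close> of the Frechet space \<open>sym_tensors A\<close> a connection is given by
  bilinear Christoffel maps \<open>\<Gamma> g\<close>: the covariant derivative of a vector field \<open>Y\<close> in direction \<open>h\<close> is
  the directional derivative of \<open>Y\<close> plus \<open>\<Gamma> g h Y\<close>.  It is torsion-free iff \<open>\<Gamma> g\<close> is symmetric, and
  it is compatible with \<open>G\<close> iff the product rule below holds for constant fields \<open>k\<close> and \<open>l\<close>.
  For a positive definite \<open>G\<close> the Koszul formula shows that at most one \<open>\<Gamma>\<close> (on \<open>metrics A\<close> and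
  \<open>sym_tensors A\<close>) has these properties, so smoothness of \<open>\<Gamma>\<close> in \<open>g\<close> need not be demanded.\<close>

definition levi_civita ::
  "('a, 'n::finite) chart set
    \<Rightarrow> (('a, 'n) tensor \<Rightarrow> ('a, 'n) tensor \<Rightarrow> ('a, 'n) tensor \<Rightarrow> real)
    \<Rightarrow> (('a, 'n) tensor \<Rightarrow> ('a, 'n) tensor \<Rightarrow> ('a, 'n) tensor \<Rightarrow> ('a, 'n) tensor) \<Rightarrow> bool" where
  "levi_civita A G \<Gamma> \<longleftrightarrow> (\<forall>g\<in>metrics A. \<forall>h\<in>sym_tensors A. \<forall>k\<in>sym_tensors A.
     \<Gamma> g h k \<in> sym_tensors A \<and>
     (\<forall>r. \<Gamma> g (tensor_scale r h) k = tensor_scale r (\<Gamma> g h k)) \<and>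
     (\<forall>h'\<in>sym_tensors A. \<Gamma> g (tensor_add h h') k = tensor_add (\<Gamma> g h k) (\<Gamma> g h' k)) \<and>
     \<Gamma> g h k = \<Gamma> g k h \<and>
     (\<forall>l\<in>sym_tensors A.
        ((\<lambda>s. G (tensor_add g (tensor_scale s h)) k l)
           has_real_derivative (G g (\<Gamma> g h k) l + G g k (\<Gamma> g h l))) (at 0)))"

definition geodesic ::
  "('a, 'n::finite) chart set
    \<Rightarrow> (('a, 'n) tensor \<Rightarrow> ('a, 'n) tensor \<Rightarrow> ('a, 'n) tensor \<Rightarrow> ('a, 'n) tensor)
    \<Rightarrow> real set \<Rightarrow> (real \<Rightarrow> ('a, 'n) tensor) \<Rightarrow> bool" where
  "geodesic A \<Gamma> I \<gamma> \<longleftrightarrow> smooth_metric_curve A I \<gamma> \<and>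
     (\<forall>t\<in>I. tensor_add (curve_deriv A I (curve_deriv A I \<gamma>) t)
               (\<Gamma> (\<gamma> t) (curve_deriv A I \<gamma> t) (curve_deriv A I \<gamma> t)) = tensor_zero)"

definition tangent_vectors ::
  "('a, 'n::finite) chart set \<Rightarrow> ('a, 'n) tensor set \<Rightarrow> ('a, 'n) tensor \<Rightarrow> ('a, 'n) tensor set" where
  "tangent_vectors A S g = {h. \<exists>e>0. \<exists>\<alpha>. smooth_metric_curve A {-e<..<e} \<alpha> \<and>
     (\<forall>t\<in>{-e<..<e}. \<alpha> t \<in> S) \<and> \<alpha> 0 = g \<and> curve_deriv A {-e<..<e} \<alpha> 0 = h}"

definition totally_geodesic ::
  "('a, 'n::finite) chart set
    \<Rightarrow> (('a, 'n) tensor \<Rightarrow> ('a, 'n) tensor \<Rightarrow> ('a, 'n) tensor \<Rightarrow> ('a, 'n) tensor)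
    \<Rightarrow> ('a, 'n) tensor set \<Rightarrow> bool" where
  "totally_geodesic A \<Gamma> S \<longleftrightarrow> (\<forall>I \<gamma>.
     geodesic A \<Gamma> I \<gamma> \<and> 0 \<in> I \<and> \<gamma> 0 \<in> S \<and> curve_deriv A I \<gamma> 0 \<in> tangent_vectors A S (\<gamma> 0)
     \<longrightarrow> (\<forall>t\<in>I. \<gamma> t \<in> S))"

end

theory Submission
  imports Defs
begin

text \<open>The volume satisfies \<open>d(log V) h = g_N(g, h) / 2\<close>, so half of the position field
  \<open>P g = g\<close> is the gradient of \<open>log V\<close>.  The homotheties \<open>g \<mapsto> r g\<close> are isometries of \<open>g_N\<close>, hence
  \<open>P\<close> is a Killing field; being a gradient as well, it is parallel.  Therefore
  \<open>g_N(\<gamma>, \<gamma>')\<close> is constant along a geodesic \<open>\<gamma>\<close>, and it vanishes initially if \<open>\<gamma>'(0)\<close> is tangent to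
  \<open>\<M>_v\<close>.  The second derivative of \<open>V\<close> along \<open>\<gamma>\<close> is not computed: \<open>\<gamma>\<close> is compared with the affine
  curve \<open>s \<mapsto> g + s h\<close>, along which the connection provides the derivative of the metric, and Lipschitz
  estimates for \<open>tr (g\<^sup>-\<^sup>1 h) sqrt (det g)\<close> control the difference.\<close>

section \<open>Matrix calculus\<close>

text \<open>\<open>levi_civita\<close> differentiates the metric only along straight lines, at
  parameter 0 and with constant arguments, so it gives no chain rule along a curve. Hence the
  comparison with the tangent line \<sigma> of \<gamma> at a time t: both curves have the same point
  and velocity there, so in the difference of their first variations of volume the change of base
  point cancels and only the acceleration survives. The geodesic equation then cancels the
  Christoffel term contributed by the line. The symmetry enters through the Killing equation on the
  diagonal, N(h + \<open>\<Gamma> g g h\<close>, h) = 0 with N the value of g_N at g. It rests on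
  the normalization: replacing g by r g multiplies \<open>ebin_metric\<close> on fixed h, k by
  r^(n/2 - 2) and the volume by r^(n/2), so the quotient scales by r^(-2), which the transported
  vectors r h, r k absorb. All integrals are rewritten against one finite measure independent of the
  metric, and compactness makes the matrix estimates uniform, so that differentiation under the
  integral is a uniform limit.\<close>

lemma matrix_add_rdistrib: "(A + B) ** C = A ** C + B ** (C :: 'a::semiring_1^'k^'n)"
  by (simp add: matrix_matrix_mult_def vec_eq_iff distrib_right sum.distrib)

lemma matrix_diff_ldistrib: "A ** (B - C) = A ** B - A ** (C :: 'a::ring_1^'k^'n)"
  by (simp add: matrix_matrix_mult_def vec_eq_iff right_diff_distrib sum_subtractf)

lemma matrix_diff_rdistrib: "(A - B) ** C = A ** C - B ** (C :: 'a::ring_1^'k^'n)"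
  by (simp add: matrix_matrix_mult_def vec_eq_iff left_diff_distrib sum_subtractf)

lemma matrix_mult_scaleR_right: "A ** (r *\<^sub>R B) = r *\<^sub>R (A ** (B :: real^'k^'n))"
  by (simp add: matrix_matrix_mult_def vec_eq_iff sum_distrib_left mult_ac)

lemma matrix_mult_scaleR_left: "(r *\<^sub>R A) ** B = r *\<^sub>R (A ** (B :: real^'k^'n))"
  by (simp add: matrix_matrix_mult_def vec_eq_iff sum_distrib_left mult_ac)

lemma det_scaleR: "det (r *\<^sub>R (A :: real^'n^'n)) = r ^ CARD('n) * det A"
proof -
  have "det (r *\<^sub>R A) = (\<Sum>p | p permutes (UNIV::'n set). r ^ CARD('n) * (of_int (sign p) * (\<Prod>i\<in>UNIV. A $ i $ p i)))"
    unfolding det_def by (intro sum.cong) (auto simp: prod.distrib)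
  then show ?thesis by (simp add: det_def sum_distrib_left)
qed

section \<open>Estimates in the Frobenius norm\<close>

text \<open>Cauchy-Schwarz in every row; the norm of the type \<open>real^'n^'m\<close> is the
  Frobenius norm, the Euclidean norm of the row norms.\<close>

lemma norm_matrix_vector_mult_le:
  fixes A :: "real^'n^'m"
  shows "norm (A *v x) \<le> norm A * norm x"
proof -
  have "norm (A *v x) = L2_set (\<lambda>i. norm (A $ i \<bullet> x)) UNIV"
    by (simp add: norm_vec_def matrix_mult_dot)
  also have "\<dots> \<le> L2_set (\<lambda>i. norm (A $ i) * norm x) UNIV"
    by (intro L2_set_mono) (auto simp: Cauchy_Schwarz_ineq2)
  also have "\<dots> = norm A * norm x"
    by (simp add: norm_vec_def [of A] L2_set_left_distrib)
  finally show ?thesis .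
qed

lemma norm_transpose:
  fixes A :: "real^'n^'m"
  shows "norm (transpose A) = norm A"
proof -
  have "norm (transpose A) = sqrt (\<Sum>i\<in>UNIV. \<Sum>j\<in>UNIV. (A $ j $ i)\<^sup>2)"
    by (simp add: norm_vec_def transpose_def L2_set_def sum_nonneg)
  also have "\<dots> = sqrt (\<Sum>j\<in>UNIV. \<Sum>i\<in>UNIV. (A $ j $ i)\<^sup>2)"
    by (subst sum.swap) simp
  also have "\<dots> = norm A"
    by (simp add: norm_vec_def L2_set_def sum_nonneg)
  finally show ?thesis .
qed

text \<open>Row i of \<open>A ** B\<close> is \<open>transpose B\<close> applied to row i of A, so
  the estimate for matrix times vector applies row by row.\<close>

lemma norm_matrix_mult_le:
  fixes A :: "real^'n^'m" and B :: "real^'k^'n"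
  shows "norm (A ** B) \<le> norm A * norm B"
proof -
  have row: "(A ** B) $ i = transpose B *v (A $ i)" for i
    by (simp add: vec_eq_iff matrix_matrix_mult_def matrix_vector_mult_def transpose_def mult.commute)
  have "norm (A ** B) = L2_set (\<lambda>i. norm (transpose B *v (A $ i))) UNIV"
    by (simp add: norm_vec_def [of "A ** B"] row del: transpose_matrix_vector)
  also have "\<dots> \<le> L2_set (\<lambda>i. norm (A $ i) * norm B) UNIV"
    by (intro L2_set_mono)
       (auto intro: order_trans [OF norm_matrix_vector_mult_le] simp: norm_transpose mult.commute simp del: transpose_matrix_vector)
  also have "\<dots> = norm A * norm B"
    by (simp add: norm_vec_def [of A] L2_set_left_distrib)
  finally show ?thesis .
qed

lemma abs_trace_le:
  fixes A :: "real^'n^'n"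
  shows "\<bar>trace A\<bar> \<le> real CARD('n) * norm A"
proof -
  have "\<bar>trace A\<bar> \<le> (\<Sum>i\<in>UNIV. \<bar>A $ i $ i\<bar>)"
    unfolding trace_def by (rule sum_abs)
  also have "\<dots> \<le> (\<Sum>i\<in>(UNIV::'n set). norm A)"
    by (intro sum_mono) (metis component_le_norm_cart Finite_Cartesian_Product.norm_nth_le order_trans)
  finally show ?thesis by simp
qed

lemma norm_matrix_le_entries:
  fixes A :: "real^'n^'m"
  assumes "\<And>i j. \<bar>A $ i $ j\<bar> \<le> c"
  shows "norm A \<le> real CARD('m) * real CARD('n) * c"
proof -
  have "norm A \<le> (\<Sum>i\<in>UNIV. norm (A $ i))"
    unfolding norm_vec_def by (rule L2_set_le_sum) auto
  also have "\<dots> \<le> (\<Sum>i\<in>(UNIV::'m set). \<Sum>j\<in>(UNIV::'n set). \<bar>A $ i $ j\<bar>)"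
    by (intro sum_mono norm_le_l1_cart)
  also have "\<dots> \<le> (\<Sum>i\<in>(UNIV::'m set). \<Sum>j\<in>(UNIV::'n set). c)"
    by (intro sum_mono assms)
  finally show ?thesis by simp
qed

lemma trace_scaleR: "trace (r *\<^sub>R (A::real^'n^'n)) = r * trace A"
  by (simp add: trace_def sum_distrib_left)

lemma matrix_inv_unique:
  fixes A B :: "real^'n^'n"
  assumes "A ** B = mat 1"
  shows "matrix_inv A = B"
proof -
  have "B ** A = mat 1" using assms matrix_left_right_inverse by blast
  then have "invertible A" using assms invertible_def by blast
  then have "matrix_inv A ** A = mat 1" "A ** matrix_inv A = mat 1"
    unfolding invertible_def matrix_inv_def by (metis (mono_tags, lifting) someI_ex)+
  then show ?thesis
    by (metis assms matrix_mul_assoc matrix_mul_lid matrix_mul_rid)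
qed

lemma
  fixes A :: "real^'n^'n"
  assumes "invertible A"
  shows matrix_inv_left: "matrix_inv A ** A = mat 1"
    and matrix_inv_right: "A ** matrix_inv A = mat 1"
  using assms unfolding invertible_def matrix_inv_def by (metis (mono_tags, lifting) someI_ex)+

lemma matrix_inv_mult:
  fixes A B :: "real^'n^'n"
  assumes "invertible A" "invertible B"
  shows "matrix_inv (A ** B) = matrix_inv B ** matrix_inv A"
proof (rule matrix_inv_unique)
  have "A ** B ** (matrix_inv B ** matrix_inv A) = A ** (B ** matrix_inv B) ** matrix_inv A"
    by (simp add: matrix_mul_assoc)
  then show "A ** B ** (matrix_inv B ** matrix_inv A) = mat 1"
    using assms by (simp add: matrix_inv_right)
qed

section \<open>Derivative of the determinant\<close>

lemma has_derivative_matrix_component: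
  "((\<lambda>X::real^'n^'m. X $ i $ j) has_derivative (\<lambda>H. H $ i $ j)) F"
  by (intro bounded_linear_imp_has_derivative bounded_linear_compose [OF bounded_linear_vec_nth]
      bounded_linear_vec_nth)

text \<open>The Leibniz formula is differentiated term by term. A permutation other than the
  identity moves at least two indices, so after one factor is removed an off-diagonal entry of the
  identity matrix remains and the term vanishes.\<close>

lemma has_derivative_det_mat_1:
  "(det has_derivative (trace :: real^'n^'n \<Rightarrow> real)) (at (mat 1))"
proof -
  let ?S = "{p. p permutes (UNIV :: 'n set)}"
  let ?I = "mat 1 :: real^'n^'n"
  have d: "((\<lambda>X::real^'n^'n. \<Sum>p\<in>?S. of_int (sign p) * (\<Prod>i\<in>UNIV. X $ i $ p i)) has_derivative
       (\<lambda>H. \<Sum>p\<in>?S. of_int (sign p) * (\<Sum>i\<in>UNIV. H $ i $ p i * (\<Prod>j\<in>UNIV - {i}. ?I $ j $ p j)))) (at ?I)"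
    by (intro has_derivative_sum has_derivative_mult_right has_derivative_prod has_derivative_matrix_component)
  have "(\<Sum>p\<in>?S. of_int (sign p) * (\<Sum>i\<in>UNIV. H $ i $ p i * (\<Prod>j\<in>UNIV - {i}. ?I $ j $ p j))) = trace H"
    for H :: "real^'n^'n"
  proof -
    have zero: "of_int (sign p) * (\<Sum>i\<in>UNIV. H $ i $ p i * (\<Prod>j\<in>UNIV - {i}. ?I $ j $ p j)) = 0"
      if p: "p \<in> ?S - {id}" for p
    proof -
      have "(\<Prod>j\<in>UNIV - {i}. ?I $ j $ p j) = 0" for i
      proof -
        obtain a where a: "p a \<noteq> a" using p by (auto simp: fun_eq_iff)
        have "inj p" using p by (auto intro: permutes_inj)
        \<comment> \<open>Both a and p a are moved by p, and at least one of them differs from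
          i.\<close>
        then have "p (p a) \<noteq> p a" using a by (auto dest: injD)
        then obtain j where "j \<noteq> i" "p j \<noteq> j" using a by metis
        then show ?thesis
          by (intro prod_zero) (auto simp: mat_def intro!: bexI [of _ j])
      qed
      then show ?thesis by (simp only: mult_zero_right sum.neutral_const)
    qed
    have "(\<Prod>j\<in>UNIV - {i}. ?I $ j $ j) = 1" for i :: 'n
      by (simp add: mat_def)
    then have idt: "of_int (sign id) * (\<Sum>i\<in>UNIV. H $ i $ id i * (\<Prod>j\<in>UNIV - {i}. ?I $ j $ id j)) = trace H"
      by (simp add: trace_def)
    have fin: "finite ?S" by (simp add: finite_permutations)
    have idin: "id \<in> ?S" by (simp add: permutes_id)
    show ?thesis
      by (subst sum.remove [OF fin idin]) (subst sum.neutral, use zero idt in auto)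
  qed
  with d show ?thesis unfolding det_def [abs_def] by simp
qed

text \<open>Jacobi's formula, moved from the identity matrix to G by the factorization det X = det G
  * det (G^-1 X).\<close>

lemma has_derivative_det:
  fixes G :: "real^'n^'n"
  assumes "invertible G"
  shows "(det has_derivative (\<lambda>H. det G * trace (matrix_inv G ** H))) (at G)"
proof -
  have "linear (\<lambda>X. matrix_inv G ** X)"
    by (rule linearI) (simp_all add: matrix_add_ldistrib matrix_mult_scaleR_right)
  then have lin: "((\<lambda>X. matrix_inv G ** X) has_derivative (\<lambda>H. matrix_inv G ** H)) (at G)"
    by (intro bounded_linear_imp_has_derivative) (simp add: linear_conv_bounded_linear)
  have "((\<lambda>X. det (matrix_inv G ** X)) has_derivative (\<lambda>H. trace (matrix_inv G ** H))) (at G)"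
    using has_derivative_compose [OF lin] has_derivative_det_mat_1 matrix_inv_left [OF assms] by metis
  then have "((\<lambda>X. det G * det (matrix_inv G ** X)) has_derivative (\<lambda>H. det G * trace (matrix_inv G ** H))) (at G)"
    by (rule has_derivative_mult_right)
  moreover have "det G * det (matrix_inv G ** X) = det X" for X
  proof -
    have "det G * det (matrix_inv G ** X) = det (G ** (matrix_inv G ** X))" by (simp add: det_mul)
    also have "\<dots> = det X" using matrix_inv_right [OF assms] by (simp add: matrix_mul_assoc)
    finally show ?thesis .
  qed
  ultimately show ?thesis by simp
qed

lemma continuous_on_det: "continuous_on S (det :: real^'n^'n \<Rightarrow> real)"
  unfolding det_def [abs_def] by (intro continuous_intros)

section \<open>Uniformly positive matrices\<close>

text \<open>For symmetric G this bounds the least eigenvalue below by m. The explicit constant makes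
  positivity stable under perturbation and bounds the inverse uniformly.\<close>

definition coercive :: "real \<Rightarrow> (real^'n^'n) set" where
  "coercive m = {G. \<forall>v. m * (v \<bullet> v) \<le> v \<bullet> (G *v v)}"

lemma convex_coercive: "convex (coercive m)"
proof (rule convexI)
  fix G H :: "real^'n^'n" and a b :: real
  assume *: "G \<in> coercive m" "H \<in> coercive m" "0 \<le> a" "0 \<le> b" "a + b = 1"
  have "m * (v \<bullet> v) \<le> v \<bullet> ((a *\<^sub>R G + b *\<^sub>R H) *v v)" for v
  proof -
    have "m * (v \<bullet> v) = a * (m * (v \<bullet> v)) + b * (m * (v \<bullet> v))"
      using * by (metis distrib_right mult_1)
    also have "\<dots> \<le> a * (v \<bullet> (G *v v)) + b * (v \<bullet> (H *v v))"
      using * by (intro add_mono mult_left_mono) (auto simp: coercive_def)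
    also have "\<dots> = v \<bullet> ((a *\<^sub>R G + b *\<^sub>R H) *v v)"
      by (simp add: matrix_vector_mult_add_rdistrib inner_add_right scaleR_matrix_vector_assoc [symmetric])
    finally show ?thesis .
  qed
  then show "a *\<^sub>R G + b *\<^sub>R H \<in> coercive m" by (simp add: coercive_def)
qed

lemma coercive_perturb:
  assumes "G \<in> coercive m" "norm (H - G) \<le> r"
  shows "H \<in> coercive (m - r)"
proof -
  have "(m - r) * (v \<bullet> v) \<le> v \<bullet> (H *v v)" for v
  proof -
    have "\<bar>v \<bullet> ((H - G) *v v)\<bar> \<le> norm v * norm ((H - G) *v v)" by (rule Cauchy_Schwarz_ineq2)
    also have "\<dots> \<le> norm v * (r * norm v)"
      using assms(2) by (intro mult_left_mono order_trans [OF norm_matrix_vector_mult_le] mult_right_mono) auto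
    finally have "\<bar>v \<bullet> ((H - G) *v v)\<bar> \<le> r * (v \<bullet> v)"
      by (simp add: dot_square_norm power2_eq_square algebra_simps)
    moreover have "m * (v \<bullet> v) \<le> v \<bullet> (G *v v)" using assms by (auto simp: coercive_def)
    ultimately show ?thesis
      by (simp add: matrix_vector_mult_diff_rdistrib inner_diff_right left_diff_distrib)
  qed
  then show ?thesis by (simp add: coercive_def)
qed

lemma coercive_invertible:
  assumes "G \<in> coercive m" "m > 0"
  shows "invertible G"
proof -
  have "v = 0" if "G *v v = 0" for v
  proof -
    have "m * (v \<bullet> v) \<le> v \<bullet> (G *v v)" using assms(1) by (simp add: coercive_def)
    then have "m * (v \<bullet> v) \<le> 0" using that by simp
    then show ?thesis using \<open>m > 0\<close> by (metis inner_gt_zero_iff mult_pos_pos not_less)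
  qed
  then show ?thesis
    using invertible_left_inverse matrix_left_invertible_ker by blast
qed

text \<open>The segment from m times the identity to G stays in the convex set
  \<open>coercive m\<close>, where no matrix is singular; by the intermediate value theorem the
  determinant keeps the positive sign it has at the start.\<close>

lemma coercive_det_pos:
  fixes G :: "real^'n^'n"
  assumes G: "G \<in> coercive m" and m: "m > 0"
  shows "det G > 0"
proof (rule ccontr)
  assume neg: "\<not> det G > 0"
  let ?c = "\<lambda>s::real. (1 - s) *\<^sub>R (m *\<^sub>R mat 1) + s *\<^sub>R G"
  have "(m *\<^sub>R mat 1 :: real^'n^'n) \<in> coercive m"
    by (simp add: coercive_def scaleR_matrix_vector_assoc [symmetric])
  then have c: "?c s \<in> coercive m" if "0 \<le> s" "s \<le> 1" for s
    using convexD [OF convex_coercive _ G, of "m *\<^sub>R mat 1" "1 - s" s] that by simp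
  have cont: "continuous_on {0..1} (\<lambda>s. det (?c s))"
    by (rule continuous_on_compose2 [OF continuous_on_det]) (auto intro!: continuous_intros)
  have one: "det (m *\<^sub>R mat 1 :: real^'n^'n) > 0"
    using m by (simp add: det_scaleR)
  obtain s where "0 \<le> s" "s \<le> 1" "det (?c s) = 0"
    using IVT2' [of "\<lambda>s. det (?c s)" 1 0 0] cont one neg by auto
  then show False
    using c coercive_invertible [OF _ m] invertible_det_nz by blast
qed

text \<open>With u = G^-1 w, coercivity gives m |u|^2 \<le> u . w \<le> |u| |w|, hence |u| \<le> |w|
  / m. Applied to unit vectors this bounds every entry by 1/m, and summing over the n^2 entries
  gives the crude constant n^2 / m.\<close>

lemma norm_matrix_inv_le:
  fixes G :: "real^'n^'n"
  assumes "G \<in> coercive m" "m > 0"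
  shows "norm (matrix_inv G) \<le> real CARD('n) * real CARD('n) / m"
proof -
  have bnd: "norm (matrix_inv G *v w) \<le> norm w / m" for w
  proof -
    let ?u = "matrix_inv G *v w"
    have "G *v ?u = w"
      using matrix_inv_right [OF coercive_invertible [OF assms]]
      by (simp add: matrix_vector_mul_assoc)
    then have "m * (?u \<bullet> ?u) \<le> ?u \<bullet> w" using assms(1) unfolding coercive_def by (metis (mono_tags, lifting) mem_Collect_eq)
    also have "\<dots> \<le> norm ?u * norm w" by (rule norm_cauchy_schwarz)
    finally have "norm ?u * (m * norm ?u) \<le> norm ?u * norm w"
      by (simp add: dot_square_norm power2_eq_square algebra_simps)
    \<comment> \<open>Cancel \<open>norm ?u\<close>; if it is 0, the claim is trivial.\<close>
    then have "m * norm ?u \<le> norm w"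
      by (metis mult_left_le_imp_le norm_ge_zero mult_zero_right order_le_less)
    then show ?thesis using \<open>m > 0\<close> by (simp add: field_simps)
  qed
  have "\<bar>matrix_inv G $ i $ j\<bar> \<le> 1 / m" for i j
  proof -
    have "\<bar>matrix_inv G $ i $ j\<bar> = \<bar>(matrix_inv G *v axis j 1) $ i\<bar>"
      by (simp add: matrix_vector_mul_component inner_axis)
    also have "\<dots> \<le> norm (matrix_inv G *v axis j 1)" by (rule component_le_norm_cart)
    also have "\<dots> \<le> 1 / m" using bnd [of "axis j 1"] by (simp add: norm_axis_1)
    finally show ?thesis .
  qed
  from norm_matrix_le_entries [OF this] show ?thesis by simp
qed

text \<open>The resolvent identity G^-1 - G'^-1 = G^-1 (G' - G) G'^-1, with both inverses bounded by
  coercivity.\<close>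

lemma matrix_inv_lipschitz:
  fixes G G' :: "real^'n^'n"
  assumes "G \<in> coercive m" "G' \<in> coercive m" "m > 0"
  shows "norm (matrix_inv G - matrix_inv G') \<le> (real CARD('n) * real CARD('n) / m)\<^sup>2 * norm (G - G')"
proof -
  let ?b = "real CARD('n) * real CARD('n) / m"
  have "matrix_inv G ** (G' - G) ** matrix_inv G' = matrix_inv G ** (G' ** matrix_inv G') - (matrix_inv G ** G) ** matrix_inv G'"
    by (simp add: matrix_diff_ldistrib matrix_diff_rdistrib matrix_mul_assoc)
  also have "\<dots> = matrix_inv G - matrix_inv G'"
    using coercive_invertible [OF assms(1,3)] coercive_invertible [OF assms(2,3)]
    by (simp add: matrix_inv_left matrix_inv_right)
  finally have "norm (matrix_inv G - matrix_inv G') = norm (matrix_inv G ** (G' - G) ** matrix_inv G')"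
    by simp
  also have "\<dots> \<le> norm (matrix_inv G) * norm (G' - G) * norm (matrix_inv G')"
    by (meson norm_matrix_mult_le mult_right_mono norm_ge_zero order_trans)
  also have "\<dots> \<le> ?b * norm (G' - G) * ?b"
    using assms by (intro mult_mono norm_matrix_inv_le) auto
  finally show ?thesis by (simp add: power2_eq_square algebra_simps norm_minus_commute)
qed

text \<open>Twice the derivative of \<open>G \<mapsto> sqrt (det G)\<close> in direction \<open>H\<close>.\<close>

definition dvol :: "real^'n^'n \<Rightarrow> real^'n^'n \<Rightarrow> real" where
  "dvol G H = trace (matrix_inv G ** H) * sqrt (det G)"

lemma dvol_diff_right: "dvol G (H - K) = dvol G H - dvol G K"
  by (simp add: dvol_def matrix_diff_ldistrib trace_sub left_diff_distrib)

lemma dvol_scaleR_right: "dvol G (r *\<^sub>R H) = r * dvol G H"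
  by (simp add: dvol_def matrix_mult_scaleR_right trace_scaleR)

lemma linear_dvol: "linear (dvol G)"
  by (rule linearI)
     (simp_all add: dvol_def matrix_add_ldistrib trace_add distrib_right matrix_mult_scaleR_right trace_scaleR)

lemma has_derivative_sqrt_det:
  assumes "G \<in> coercive m" "m > 0"
  shows "((\<lambda>X. sqrt (det X)) has_derivative (\<lambda>H. dvol G H / 2)) (at G)"
proof -
  have pos: "det G > 0" using assms by (rule coercive_det_pos)
  have "((\<lambda>X. sqrt (det X)) has_derivative (\<lambda>H. det G * trace (matrix_inv G ** H) * (inverse (sqrt (det G)) / 2))) (at G)"
    using has_derivative_real_sqrt [OF pos has_derivative_det [OF coercive_invertible [OF assms]]]
    by (simp add: mult.commute)
  moreover have "det G * trace (matrix_inv G ** H) * (inverse (sqrt (det G)) / 2) = dvol G H / 2" for H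
    using pos by (simp add: dvol_def field_simps)
  ultimately show ?thesis by simp
qed

section \<open>Uniform estimates for the volume density and its derivative\<close>

text \<open>Here all constants are uniform: coercivity controls the inverse, the ball controls the
  determinant, and convexity permits the mean value inequality.\<close>

definition matrix_region :: "real \<Rightarrow> real \<Rightarrow> (real^'n^'n) set" where
  "matrix_region m M = coercive m \<inter> cball 0 M"

lemma convex_matrix_region: "convex (matrix_region m M)"
  unfolding matrix_region_def by (intro convex_Int convex_coercive convex_cball)

text \<open>\<open>sqrt\<close> is an odd continuous function on the whole line, so compactness of
  the ball gives the bound; the absolute value covers negative determinants.\<close>

lemma sqrt_det_bounded:
  obtains B where "B > 0" "\<And>G::real^'n^'n. G \<in> cball 0 M \<Longrightarrow> \<bar>sqrt (det G)\<bar> \<le> B"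
proof -
  have "compact ((\<lambda>G::real^'n^'n. sqrt (det G)) ` cball 0 M)"
    by (intro compact_continuous_image compact_cball continuous_on_real_sqrt continuous_on_det)
  then have "bounded ((\<lambda>G::real^'n^'n. sqrt (det G)) ` cball 0 M)" by (rule compact_imp_bounded)
  then obtain B where "B > 0" "\<forall>x\<in>(\<lambda>G::real^'n^'n. sqrt (det G)) ` cball 0 M. norm x \<le> B"
    using bounded_pos by blast
  then show thesis by (intro that [of B]) auto
qed

lemma dvol_bounded:
  fixes m M :: real
  assumes "m > 0"
  obtains C where "C > 0" "\<And>G H::real^'n^'n. G \<in> matrix_region m M \<Longrightarrow> \<bar>dvol G H\<bar> \<le> C * norm H"
proof -
  obtain B where B: "B > 0" "\<And>G::real^'n^'n. G \<in> cball 0 M \<Longrightarrow> \<bar>sqrt (det G)\<bar> \<le> B"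
    using sqrt_det_bounded by blast
  let ?n = "real CARD('n)"
  let ?b = "?n * ?n / m"
  show thesis
  proof
    \<comment> \<open>The factors bound the trace by the norm, the inverse, and the density.\<close>
    show "?n * ?b * B > 0" using B assms by simp
    fix G H :: "real^'n^'n" assume G: "G \<in> matrix_region m M"
    have "\<bar>trace (matrix_inv G ** H)\<bar> \<le> ?n * (norm (matrix_inv G) * norm H)"
      by (intro order_trans [OF abs_trace_le] mult_left_mono norm_matrix_mult_le) auto
    also have "\<dots> \<le> ?n * (?b * norm H)"
      using G assms by (intro mult_left_mono mult_right_mono norm_matrix_inv_le) (auto simp: matrix_region_def)
    finally have "\<bar>dvol G H\<bar> \<le> ?n * (?b * norm H) * B"
      unfolding dvol_def abs_mult using G B(2) [of G] assms
      by (intro mult_mono) (auto simp: matrix_region_def)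
    then show "\<bar>dvol G H\<bar> \<le> ?n * ?b * B * norm H" by (simp add: algebra_simps)
  qed
qed

lemma sqrt_det_lipschitz:
  fixes m M :: real
  assumes m: "m > 0"
  obtains L where "L > 0" "\<And>G G'::real^'n^'n. G \<in> matrix_region m M \<Longrightarrow> G' \<in> matrix_region m M \<Longrightarrow>
     \<bar>sqrt (det G) - sqrt (det G')\<bar> \<le> L * norm (G - G')"
proof -
  obtain C where C: "C > 0" "\<And>G H::real^'n^'n. G \<in> matrix_region m M \<Longrightarrow> \<bar>dvol G H\<bar> \<le> C * norm H"
    using dvol_bounded [OF m] by blast
  show thesis
  proof
    show "C > 0" by fact
    fix G G' :: "real^'n^'n" assume G: "G \<in> matrix_region m M" "G' \<in> matrix_region m M"
    have "norm (sqrt (det G) - sqrt (det G')) \<le> C * norm (G - G')"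
    proof (rule differentiable_bound [OF convex_matrix_region _ _ G])
      fix X :: "real^'n^'n" assume X: "X \<in> matrix_region m M"
      then show "((\<lambda>X. sqrt (det X)) has_derivative (\<lambda>H. dvol X H / 2)) (at X within matrix_region m M)"
        using has_derivative_sqrt_det [OF _ m] by (auto simp: matrix_region_def intro: has_derivative_at_withinI)
      have "norm (dvol X H / 2) \<le> C * norm H" for H
        using C(2) [OF X, of H] by simp
      then show "onorm (\<lambda>H. dvol X H / 2) \<le> C" by (rule onorm_le)
    qed
    then show "\<bar>sqrt (det G) - sqrt (det G')\<bar> \<le> C * norm (G - G')" by simp
  qed
qed

lemma dvol_lipschitz:
  fixes m M :: real
  assumes m: "m > 0"
  obtains L where "L > 0" "\<And>G G' H::real^'n^'n. G \<in> matrix_region m M \<Longrightarrow> G' \<in> matrix_region m M \<Longrightarrow>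
     \<bar>dvol G H - dvol G' H\<bar> \<le> L * norm (G - G') * norm H"
proof -
  obtain B where B: "B > 0" "\<And>G::real^'n^'n. G \<in> cball 0 M \<Longrightarrow> \<bar>sqrt (det G)\<bar> \<le> B"
    using sqrt_det_bounded by blast
  obtain L where L: "L > 0" "\<And>G G'::real^'n^'n. G \<in> matrix_region m M \<Longrightarrow> G' \<in> matrix_region m M \<Longrightarrow>
     \<bar>sqrt (det G) - sqrt (det G')\<bar> \<le> L * norm (G - G')"
    using sqrt_det_lipschitz [OF m] by blast
  let ?n = "real CARD('n)"
  define b where "b = ?n * ?n / m"
  have b: "b > 0" using m by (simp add: b_def)
  show thesis
  proof
    show "?n * b * L + ?n * b\<^sup>2 * B > 0" using B L b by (intro add_pos_pos mult_pos_pos) auto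
    fix G G' H :: "real^'n^'n" assume G: "G \<in> matrix_region m M" "G' \<in> matrix_region m M"
    \<comment> \<open>Telescoping: first the density is changed from G to G', then the
      inverse.\<close>
    have "dvol G H - dvol G' H = trace (matrix_inv G ** H) * (sqrt (det G) - sqrt (det G'))
        + trace ((matrix_inv G - matrix_inv G') ** H) * sqrt (det G')"
      by (simp add: dvol_def matrix_diff_rdistrib trace_sub algebra_simps)
    moreover have "\<bar>trace (matrix_inv G ** H)\<bar> \<le> ?n * (b * norm H)"
    proof -
      have "\<bar>trace (matrix_inv G ** H)\<bar> \<le> ?n * (norm (matrix_inv G) * norm H)"
        by (intro order_trans [OF abs_trace_le] mult_left_mono norm_matrix_mult_le) auto
      also have "\<dots> \<le> ?n * (b * norm H)"
        using G m unfolding b_def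
        by (intro mult_left_mono mult_right_mono norm_matrix_inv_le) (auto simp: matrix_region_def)
      finally show ?thesis .
    qed
    moreover have "\<bar>trace ((matrix_inv G - matrix_inv G') ** H)\<bar> \<le> ?n * (b\<^sup>2 * norm (G - G') * norm H)"
    proof -
      have "\<bar>trace ((matrix_inv G - matrix_inv G') ** H)\<bar> \<le> ?n * (norm (matrix_inv G - matrix_inv G') * norm H)"
        by (intro order_trans [OF abs_trace_le] mult_left_mono norm_matrix_mult_le) auto
      also have "\<dots> \<le> ?n * (b\<^sup>2 * norm (G - G') * norm H)"
        using G m unfolding b_def
        by (intro mult_left_mono mult_right_mono matrix_inv_lipschitz) (auto simp: matrix_region_def)
      finally show ?thesis .
    qed
    moreover have "\<bar>sqrt (det G) - sqrt (det G')\<bar> \<le> L * norm (G - G')" by (rule L(2) [OF G])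
    moreover have "\<bar>sqrt (det G')\<bar> \<le> B" using G B(2) by (auto simp: matrix_region_def)
    ultimately have "\<bar>dvol G H - dvol G' H\<bar> \<le>
        ?n * (b * norm H) * (L * norm (G - G')) + ?n * (b\<^sup>2 * norm (G - G') * norm H) * B"
      using b by (auto intro!: order_trans [OF abs_triangle_ineq] add_mono mult_mono simp: abs_mult)
    then show "\<bar>dvol G H - dvol G' H\<bar> \<le> (?n * b * L + ?n * b\<^sup>2 * B) * norm (G - G') * norm H"
      by (simp add: algebra_simps)
  qed
qed

text \<open>The linearized mean value inequality is applied on the segment from G to G' only: there
  every X has norm (X - G) \<le> norm (G' - G), so the Lipschitz bound for the derivative turns into
  a quadratic remainder.\<close>

lemma sqrt_det_taylor:
  fixes m M :: real
  assumes m: "m > 0"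
  obtains L where "L > 0" "\<And>G G'::real^'n^'n. G \<in> matrix_region m M \<Longrightarrow> G' \<in> matrix_region m M \<Longrightarrow>
     \<bar>sqrt (det G') - sqrt (det G) - dvol G (G' - G) / 2\<bar> \<le> L * (norm (G' - G))\<^sup>2"
proof -
  obtain L where L: "L > 0" "\<And>G G' H::real^'n^'n. G \<in> matrix_region m M \<Longrightarrow> G' \<in> matrix_region m M \<Longrightarrow>
     \<bar>dvol G H - dvol G' H\<bar> \<le> L * norm (G - G') * norm H"
    using dvol_lipschitz [OF m] by blast
  show thesis
  proof
    show "L > 0" by fact
    fix G G' :: "real^'n^'n" assume G: "G \<in> matrix_region m M" "G' \<in> matrix_region m M"
    let ?S = "closed_segment G G'"
    have S: "?S \<subseteq> matrix_region m M"
      by (intro closed_segment_subset G convex_matrix_region)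
    have "norm (sqrt (det G') - sqrt (det G) - dvol G (G' - G) / 2) \<le> norm (G' - G) * (L * norm (G' - G))"
    proof (rule differentiable_bound_linearization [where S = ?S and f' = "\<lambda>X H. dvol X H / 2" and ?x0.0 = G])
      show "G + t *\<^sub>R (G' - G) \<in> ?S" if "t \<in> {0..1}" for t
      proof -
        have "G + t *\<^sub>R (G' - G) = (1 - t) *\<^sub>R G + t *\<^sub>R G'" by (simp add: algebra_simps)
        then show ?thesis using that unfolding in_segment by auto
      qed
      show "G \<in> ?S" by simp
      fix X assume "X \<in> ?S"
      then have X: "X \<in> matrix_region m M" and d: "norm (X - G) \<le> norm (G' - G)"
        using S segment_bound1 [of X G G'] by (auto simp: norm_minus_commute)
      then show "((\<lambda>X. sqrt (det X)) has_derivative (\<lambda>H. dvol X H / 2)) (at X within ?S)"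
        using has_derivative_sqrt_det [OF _ m] by (auto simp: matrix_region_def intro: has_derivative_at_withinI)
      have "norm (dvol X H / 2 - dvol G H / 2) \<le> L * norm (G' - G) * norm H" for H
      proof -
        have "\<bar>dvol X H - dvol G H\<bar> \<le> L * norm (X - G) * norm H" by (rule L(2) [OF X G(1)])
        also have "\<dots> \<le> L * norm (G' - G) * norm H"
          using d L(1) by (intro mult_right_mono mult_left_mono) auto
        finally show ?thesis by (simp add: diff_divide_distrib [symmetric])
      qed
      then show "onorm ((\<lambda>H. dvol X H / 2) - (\<lambda>H. dvol G H / 2)) \<le> L * norm (G' - G)"
        unfolding fun_diff_def by (rule onorm_le)
    qed
    then show "\<bar>sqrt (det G') - sqrt (det G) - dvol G (G' - G) / 2\<bar> \<le> L * (norm (G' - G))\<^sup>2"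
      by (simp add: power2_eq_square mult_ac)
  qed
qed

section \<open>Change of variables for arbitrary finite index types\<close>

text \<open>The library proves the change of variables formula only for well-ordered index types.  This type
  is a well-ordered copy of an arbitrary finite index type.\<close>

typedef (overloaded) 'n ordered_index = "{i::nat. i < CARD('n::finite)}"
  by (rule exI [of _ 0]) (simp add: zero_less_card_finite)

instance ordered_index :: (finite) finite
proof
  have "finite (range (Rep_ordered_index :: 'a ordered_index \<Rightarrow> nat))"
    by (rule finite_subset [of _ "{i. i < CARD('a)}"]) (use Rep_ordered_index in auto)
  then show "finite (UNIV :: 'a ordered_index set)"
    by (rule finite_imageD) (simp add: inj_on_def Rep_ordered_index_inject)
qed

instantiation ordered_index :: (finite) linorder
begin

definition "i \<le> j \<longleftrightarrow> Rep_ordered_index i \<le> Rep_ordered_index j"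
definition "i < j \<longleftrightarrow> Rep_ordered_index i < Rep_ordered_index j"

instance
  by standard (auto simp: less_eq_ordered_index_def less_ordered_index_def Rep_ordered_index_inject)

end

instance ordered_index :: (finite) wellorder
proof (rule wf_wellorderI)
  have "{(i, j). i < j} = inv_image less_than (Rep_ordered_index :: 'a ordered_index \<Rightarrow> nat)"
    by (auto simp: inv_image_def less_ordered_index_def)
  then show "wf {(i :: 'a ordered_index, j). i < j}" by simp
qed intro_classes

lemma ex_bij_ordered_index: "\<exists>b :: 'n::finite ordered_index \<Rightarrow> 'n. bij b"
proof -
  have "CARD('n ordered_index) = CARD('n)"
    by (simp add: type_definition.card [OF type_definition_ordered_index])
  then show ?thesis
    using finite_same_card_bij [of "UNIV :: 'n ordered_index set" "UNIV :: 'n set"] by auto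
qed

section \<open>Behaviour of Lebesgue measure and determinants under renaming of coordinates\<close>

definition reindex :: "('m::finite \<Rightarrow> 'n::finite) \<Rightarrow> real^'n \<Rightarrow> real^'m" where
  "reindex b x = (\<chi> i. x $ b i)"

lemma reindex_nth [simp]: "reindex b x $ i = x $ b i"
  by (simp add: reindex_def)

lemma linear_reindex: "linear (reindex b)"
  by (rule linearI) (simp_all add: vec_eq_iff)

lemma bounded_linear_reindex: "bounded_linear (reindex b)"
  using linear_reindex linear_conv_bounded_linear by blast

lemma continuous_on_reindex: "continuous_on A (reindex b)"
  using bounded_linear_reindex by (rule linear_continuous_on)

lemma measurable_reindex [measurable]: "reindex b \<in> borel_measurable borel"
  by (intro borel_measurable_continuous_onI continuous_on_reindex)

lemma reindex_reindex_inv: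
  assumes "bij b"
  shows "reindex b (reindex (inv b) x) = x" "reindex (inv b) (reindex b y) = y"
  using assms by (auto simp: vec_eq_iff bij_is_inj bij_is_surj surj_f_inv_f)

lemma reindex_image_eq_vimage:
  assumes "bij b"
  shows "reindex b ` S = reindex (inv b) -` S"
  by (auto simp: reindex_reindex_inv [OF assms]) (metis reindex_reindex_inv(1) [OF assms] imageI)

lemma prod_Basis_cart: "(\<Prod>c\<in>Basis. (x :: real^'n) \<bullet> c) = (\<Prod>i\<in>UNIV. x $ i)"
proof -
  have B: "(Basis :: (real^'n) set) = range (\<lambda>i::'n. axis i (1::real))"
    by (auto simp: Basis_vec_def)
  have inj: "inj (\<lambda>i::'n. axis i (1::real))"
    by (auto simp: inj_on_def axis_eq_axis)
  show ?thesis
    unfolding B prod.reindex [OF inj] o_def by (simp add: inner_axis)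
qed

text \<open>Lebesgue measure is determined by its values on boxes, and the preimage of a box is the
  box with the same side lengths in another order.\<close>

lemma distr_lborel_reindex:
  fixes b :: "'m::finite \<Rightarrow> 'n::finite"
  assumes "bij b"
  shows "distr lborel borel (reindex b) = (lborel :: (real^'m) measure)"
proof (rule lborel_eqI [symmetric])
  fix l u :: "real^'m" assume le: "\<And>c. c \<in> Basis \<Longrightarrow> l \<bullet> c \<le> u \<bullet> c"
  have le': "l $ i \<le> u $ i" for i
    using le [of "axis i 1"] by (simp add: inner_axis axis_in_Basis_iff)
  let ?l = "reindex (inv b) l" and ?u = "reindex (inv b) u"
  have pre: "reindex b -` box l u = box ?l ?u"
  proof -
    have "(\<forall>i. l $ i < x $ b i \<and> x $ b i < u $ i) \<longleftrightarrow> (\<forall>j. l $ inv b j < x $ j \<and> x $ j < u $ inv b j)" for x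
      by (metis assms bij_inv_eq_iff)
    then show ?thesis by (auto simp: mem_box_cart)
  qed
  have "emeasure (distr lborel borel (reindex b)) (box l u) = emeasure lborel (box ?l ?u)"
    by (subst emeasure_distr) (auto simp: pre)
  also have "\<dots> = (\<Prod>c\<in>Basis. (?u - ?l) \<bullet> c)"
    using le' by (intro emeasure_lborel_box) (auto simp: Basis_vec_def inner_axis)
  also have "(\<Prod>c\<in>Basis. (?u - ?l) \<bullet> c) = (\<Prod>j\<in>UNIV. (u - l) $ inv b j)"
    by (simp add: prod_Basis_cart)
  also have "\<dots> = (\<Prod>i\<in>UNIV. (u - l) $ i)"
    using assms by (intro prod.reindex_bij_betw) (simp add: bij_imp_bij_inv)
  also have "\<dots> = (\<Prod>c\<in>Basis. (u - l) \<bullet> c)"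
    by (simp add: prod_Basis_cart)
  finally show "emeasure (distr lborel borel (reindex b)) (box l u) = (\<Prod>c\<in>Basis. (u - l) \<bullet> c)" .
qed simp

text \<open>Conjugation with b matches the permutations of the two index types; it preserves signs
  and merely reorders the factors of each Leibniz term.\<close>

lemma det_reindex:
  fixes A :: "'a::comm_ring_1^'n^'n" and b :: "'m::finite \<Rightarrow> 'n"
  assumes "bij b"
  shows "det (\<chi> i j. A $ b i $ b j) = det A"
proof -
  let ?P = "\<lambda>p. map_permutation UNIV b p"
  have inj: "inj b" and bb: "bij_betw b UNIV UNIV" using assms by (auto simp: bij_is_inj)
  have app: "?P p (b i) = b (p i)" for p i
    by (rule map_permutation_apply) (use inj in auto)
  have binv: "bij_betw (inv b) UNIV UNIV" using assms by (simp add: bij_imp_bij_inv)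
  have bij: "bij_betw ?P {p. p permutes UNIV} {p. p permutes UNIV}"
  proof (rule bij_betw_byWitness [where f' = "map_permutation UNIV (inv b)"])
    show "\<forall>p\<in>{p. p permutes UNIV}. map_permutation UNIV (inv b) (?P p) = p"
      using assms map_permutation_compose_inv [OF bb, of _ "inv b"] by (auto simp: bij_is_inj)
    show "\<forall>p\<in>{p. p permutes UNIV}. ?P (map_permutation UNIV (inv b) p) = p"
      using assms map_permutation_compose_inv [OF binv, of _ b] by (auto simp: bij_is_surj surj_f_inv_f)
    show "?P ` {p. p permutes UNIV} \<subseteq> {p. p permutes UNIV}"
      using map_permutation_permutes [OF bb] by auto
    show "map_permutation UNIV (inv b) ` {p. p permutes UNIV} \<subseteq> {p. p permutes UNIV}"
      using map_permutation_permutes [OF binv] by auto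
  qed
  have "det A = (\<Sum>p | p permutes UNIV. of_int (sign (?P p)) * (\<Prod>i\<in>UNIV. A $ i $ ?P p i))"
    unfolding det_def by (rule sum.reindex_bij_betw [OF bij, symmetric])
  also have "\<dots> = (\<Sum>p | p permutes UNIV. of_int (sign p) * (\<Prod>i\<in>UNIV. A $ b i $ b (p i)))"
  proof (rule sum.cong [OF refl])
    fix p :: "'m \<Rightarrow> 'm" assume "p \<in> {p. p permutes UNIV}"
    then have "sign (?P p) = sign p" by (intro sign_map_permutation inj) auto
    moreover have "(\<Prod>i\<in>UNIV. A $ i $ ?P p i) = (\<Prod>i\<in>UNIV. A $ b i $ ?P p (b i))"
      by (rule prod.reindex_bij_betw [OF bb, symmetric])
    ultimately show "of_int (sign (?P p)) * (\<Prod>i\<in>UNIV. A $ i $ ?P p i)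
        = of_int (sign p) * (\<Prod>i\<in>UNIV. A $ b i $ b (p i))"
      by (simp add: app)
  qed
  finally show ?thesis by (simp add: det_def)
qed

section \<open>Change of variables for nonnegative functions\<close>

text \<open>The bridge between the gauge integral, for which change of variables is available, and
  the integral against \<open>lborel\<close> that defines the Riemannian measure.\<close>

lemma has_integral_iff_nn_integral:
  fixes f :: "real^'n \<Rightarrow> real"
  assumes "\<And>x. x \<in> S \<Longrightarrow> 0 \<le> f x" and [measurable]: "(\<lambda>x. f x * indicator S x) \<in> borel_measurable borel"
    and "0 \<le> r"
  shows "(f has_integral r) S \<longleftrightarrow> (\<integral>\<^sup>+x\<in>S. ennreal (f x) \<partial>lborel) = ennreal r"
proof -
  have "(f has_integral r) S \<longleftrightarrow> ((\<lambda>x. f x * indicator S x) has_integral r) UNIV"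
  proof -
    have "(\<lambda>x. f x * indicator S x) = (\<lambda>x. if x \<in> S then f x else 0)"
      by (auto simp: fun_eq_iff)
    then show ?thesis by (simp only: has_integral_restrict_UNIV)
  qed
  also have "\<dots> \<longleftrightarrow> (\<integral>\<^sup>+x. ennreal (f x * indicator S x) \<partial>lborel) = ennreal r"
    using assms by (subst has_integral_iff_nn_integral_lebesgue)
      (auto simp: indicator_def nn_integral_completion intro!: measurable_completion)
  also have "(\<integral>\<^sup>+x. ennreal (f x * indicator S x) \<partial>lborel) = (\<integral>\<^sup>+x\<in>S. ennreal (f x) \<partial>lborel)"
    by (intro nn_integral_cong) (auto simp: indicator_def)
  finally show ?thesis .
qed

text \<open>The known formula says that one side is absolutely integrable with value r iff the other
  side is. For nonnegative functions this identifies all finite values in both directions, which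
  leaves only the value infinity.\<close>

lemma nn_integral_change_of_variables_wellorder:
  fixes f :: "real^'m::{finite,wellorder} \<Rightarrow> real" and g :: "real^'m::_ \<Rightarrow> real^'m::_"
  assumes S: "S \<in> sets borel"
    and der: "\<And>x. x \<in> S \<Longrightarrow> (g has_derivative g' x) (at x within S)"
    and inj: "inj_on g S"
    and f0: "\<And>x. x \<in> g ` S \<Longrightarrow> 0 \<le> f x"
    and meas: "(\<lambda>x. f x * indicator (g ` S) x) \<in> borel_measurable borel"
    and measD: "(\<lambda>x. \<bar>det (matrix (g' x))\<bar> * f (g x) * indicator S x) \<in> borel_measurable borel"
  shows "(\<integral>\<^sup>+x\<in>g ` S. ennreal (f x) \<partial>lborel) = (\<integral>\<^sup>+x\<in>S. ennreal (\<bar>det (matrix (g' x))\<bar> * f (g x)) \<partial>lborel)"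
    (is "?L = ?R")
proof -
  let ?D = "\<lambda>x. \<bar>det (matrix (g' x))\<bar> * f (g x)"
  have S': "S \<in> sets lebesgue" using S by simp
  have D0: "0 \<le> ?D x" if "x \<in> S" for x using f0 that by simp
  have abs: "h absolutely_integrable_on T \<and> integral T h = r \<longleftrightarrow> (h has_integral r) T"
    if "\<And>x. x \<in> T \<Longrightarrow> 0 \<le> h x" for h :: "real^'m::{finite,wellorder} \<Rightarrow> real" and T and r :: real
    using that by (auto simp: has_integral_iff absolutely_integrable_on_iff_nonneg dest: nonnegative_absolutely_integrable_1
       set_lebesgue_integral_eq_integral(1))
  \<comment> \<open>Real functions are read as functions into \<open>real^1\<close>, because the
    formula is stated for vector values.\<close>
  have "(?D absolutely_integrable_on S \<and> integral S ?D = r) \<longleftrightarrow>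
        (f absolutely_integrable_on (g ` S) \<and> integral (g ` S) f = r)" for r
    using has_absolute_integral_change_of_variables [OF S' der inj, of "\<lambda>x. vec (f x) :: real^1" "vec r"]
    unfolding absolutely_integrable_on_1_iff integral_on_1_eq by (auto simp: o_def)
  then have iff: "(?D has_integral r) S \<longleftrightarrow> (f has_integral r) (g ` S)" for r
    using abs [of S ?D r] abs [of "g ` S" f r] D0 f0 by blast
  have iff2: "?L = ennreal r \<longleftrightarrow> ?R = ennreal r" if "0 \<le> r" for r
    using iff [of r] has_integral_iff_nn_integral [OF f0 meas that] has_integral_iff_nn_integral [OF D0 measD that]
    by simp
  show ?thesis
  proof (cases ?L)
    case (real r)
    then show ?thesis using iff2 [of r] by simp
  next
    \<comment> \<open>A finite right side would by \<open>iff2\<close> force the same finite value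
      on the left.\<close>
    case top
    then show ?thesis using iff2 by (cases ?R) auto
  qed
qed

text \<open>Conjugating g with a renaming of coordinates carries the claim to the well-ordered index
  type. The renaming preserves Lebesgue measure, and the matrix of the derivative is only reindexed,
  so its determinant stays the same.\<close>

lemma nn_integral_change_of_variables:
  fixes f :: "real^'n \<Rightarrow> real" and g :: "real^'n \<Rightarrow> real^'n"
  assumes S: "S \<in> sets borel"
    and der: "\<And>x. x \<in> S \<Longrightarrow> (g has_derivative g' x) (at x within S)"
    and inj: "inj_on g S"
    and f0: "\<And>x. x \<in> g ` S \<Longrightarrow> 0 \<le> f x"
    and meas: "(\<lambda>x. f x * indicator (g ` S) x) \<in> borel_measurable borel"
    and measD: "(\<lambda>x. \<bar>det (matrix (g' x))\<bar> * f (g x) * indicator S x) \<in> borel_measurable borel"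
  shows "(\<integral>\<^sup>+x\<in>g ` S. ennreal (f x) \<partial>lborel) = (\<integral>\<^sup>+x\<in>S. ennreal (\<bar>det (matrix (g' x))\<bar> * f (g x)) \<partial>lborel)"
proof -
  obtain b :: "'n ordered_index \<Rightarrow> 'n" where b: "bij b" using ex_bij_ordered_index by blast
  let ?P = "reindex b" and ?Q = "reindex (inv b)"
  have PQ: "?P (?Q y) = y" "?Q (?P x) = x" for x y
    using reindex_reindex_inv [OF b] by auto
  define h where "h = ?P \<circ> g \<circ> ?Q"
  define h' where "h' = (\<lambda>y. ?P \<circ> g' (?Q y) \<circ> ?Q)"
  define T where "T = ?Q -` S"
  have T: "T = ?P ` S" unfolding T_def by (rule reindex_image_eq_vimage [OF b, symmetric])
  have hT: "h ` T = ?Q -` (g ` S)"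
    unfolding reindex_image_eq_vimage [OF b, symmetric] T h_def by (auto simp: PQ image_comp)
  have ind: "indicator (?Q -` X) y = (indicator X (?Q y) :: 'z::zero_neq_one)" for X y
    by (simp add: indicator_def)
  have det: "det (matrix (h' y)) = det (matrix (g' (?Q y)))" for y
  proof -
    have axis: "?Q (axis j 1) = axis (b j) 1" for j
      using b by (auto simp: vec_eq_iff axis_def bij_is_surj surj_f_inv_f bij_is_inj)
    then have "matrix (h' y) = (\<chi> i j. matrix (g' (?Q y)) $ b i $ b j)"
      unfolding matrix_def h'_def o_def axis by (simp add: vec_eq_iff)
    then show ?thesis by (simp add: det_reindex [OF b])
  qed
  have trans: "(\<integral>\<^sup>+y\<in>?Q -` X. ennreal (F (?Q y)) \<partial>lborel) = (\<integral>\<^sup>+x\<in>X. ennreal (F x) \<partial>lborel)"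
    if F: "(\<lambda>x. F x * indicator X x) \<in> borel_measurable borel" for X and F :: "real^'n \<Rightarrow> real"
  proof -
    have eq: "ennreal (F x) * indicator X x = ennreal (F x * indicator X x)" for x
      by (simp add: indicator_def)
    have "(\<integral>\<^sup>+x\<in>X. ennreal (F x) \<partial>lborel) = (\<integral>\<^sup>+x. ennreal (F x) * indicator X x \<partial>distr lborel borel ?Q)"
      using distr_lborel_reindex [OF bij_imp_bij_inv [OF b]] by simp
    also have "\<dots> = (\<integral>\<^sup>+y. ennreal (F (?Q y)) * indicator X (?Q y) \<partial>lborel)"
      unfolding eq using F by (intro nn_integral_distr) auto
    finally show ?thesis by (simp add: ind)
  qed
  have "(\<integral>\<^sup>+y\<in>h ` T. ennreal (f (?Q y)) \<partial>lborel)
      = (\<integral>\<^sup>+y\<in>T. ennreal (\<bar>det (matrix (h' y))\<bar> * f (?Q (h y))) \<partial>lborel)"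
  proof (rule nn_integral_change_of_variables_wellorder)
    show "T \<in> sets borel" unfolding T_def using S by (metis measurable_reindex measurable_sets_borel)
    show "(h has_derivative h' y) (at y within T)" if "y \<in> T" for y
    proof -
      have QT: "?Q ` T \<subseteq> S" "?Q y \<in> S" using that by (auto simp: T_def)
      have "((\<lambda>y. g (?Q y)) has_derivative (\<lambda>z. g' (?Q y) (?Q z))) (at y within T)"
        by (rule has_derivative_in_compose2 [OF der QT(1) that])
           (auto intro!: bounded_linear_imp_has_derivative bounded_linear_reindex)
      from bounded_linear.has_derivative [OF bounded_linear_reindex [of b] this]
      show ?thesis by (simp add: h_def h'_def o_def)
    qed
    show "inj_on h T"
      using inj unfolding T_def h_def inj_on_def by (metis PQ comp_apply vimageE)
    show "0 \<le> f (?Q y)" if "y \<in> h ` T" for y using f0 that by (simp add: hT)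
    show "(\<lambda>y. f (?Q y) * indicator (h ` T) y) \<in> borel_measurable borel"
      unfolding hT ind by (rule measurable_compose [OF measurable_reindex meas])
    show "(\<lambda>y. \<bar>det (matrix (h' y))\<bar> * f (?Q (h y)) * indicator T y) \<in> borel_measurable borel"
      unfolding T_def ind det using measurable_compose [OF measurable_reindex measD]
      by (simp add: h_def PQ)
  qed
  moreover have "(\<integral>\<^sup>+y\<in>h ` T. ennreal (f (?Q y)) \<partial>lborel) = (\<integral>\<^sup>+x\<in>g ` S. ennreal (f x) \<partial>lborel)"
    unfolding hT by (rule trans [OF meas])
  moreover have "(\<integral>\<^sup>+y\<in>T. ennreal (\<bar>det (matrix (h' y))\<bar> * f (?Q (h y))) \<partial>lborel)
      = (\<integral>\<^sup>+x\<in>S. ennreal (\<bar>det (matrix (g' x))\<bar> * f (g x)) \<partial>lborel)"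
    unfolding T_def det using trans [OF measD] by (simp add: h_def PQ)
  ultimately show ?thesis by simp
qed

section \<open>Charts of closed manifolds\<close>

lemma borel_vimage_continuous_on:
  fixes f :: "'a::topological_space \<Rightarrow> 'b::topological_space"
  assumes "continuous_on S f" "S \<in> sets borel" "B \<in> sets borel"
  shows "S \<inter> f -` B \<in> sets borel"
  using measurable_sets [OF borel_measurable_continuous_on_restrict [OF assms(1)] assms(3)] assms(2)
  by (simp add: space_restrict_space sets_restrict_space_iff Int_commute)

lemma smooth_on_imp_differentiable: "smooth_on S f \<Longrightarrow> x \<in> S \<Longrightarrow> f differentiable (at x)"
  unfolding smooth_on_def by (metis partials.simps(1))

lemma smooth_on_imp_continuous_on: "smooth_on S f \<Longrightarrow> continuous_on S f"
  by (meson continuous_at_imp_continuous_on differentiable_imp_continuous_within smooth_on_imp_differentiable)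

lemma closed_manifold_chart:
  fixes A :: "('a::t2_space, 'n::finite) chart set"
  assumes "closed_manifold A" "c \<in> A"
  shows "open (fst c)" "open (coords c)" "inj_on (snd c) (fst c)" "continuous_on (fst c) (snd c)"
    "continuous_on (coords c) (inv_into (fst c) (snd c))"
    "homeomorphism (fst c) (coords c) (snd c) (inv_into (fst c) (snd c))"
proof -
  have *: "open (fst c) \<and> open (coords c) \<and> homeomorphism (fst c) (coords c) (snd c) (inv_into (fst c) (snd c))"
    using assms unfolding closed_manifold_def smooth_atlas_def coords_def by (cases c) auto
  then show "open (fst c)" "open (coords c)" "continuous_on (fst c) (snd c)"
    "continuous_on (coords c) (inv_into (fst c) (snd c))"
    "homeomorphism (fst c) (coords c) (snd c) (inv_into (fst c) (snd c))"
    by (auto simp: homeomorphism_def)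
  show "inj_on (snd c) (fst c)"
    using * by (metis homeomorphism_apply1 inj_on_inverseI)
qed

text \<open>The image is the preimage of B under the inverse chart, which is continuous on an open
  set.\<close>

lemma closed_manifold_borel_image:
  fixes A :: "('a::t2_space, 'n::finite) chart set"
  assumes "closed_manifold A" "c \<in> A" "B \<in> sets borel" "B \<subseteq> fst c"
  shows "snd c ` B \<in> sets borel"
proof -
  note c = closed_manifold_chart [OF assms(1,2)]
  have "snd c ` B = coords c \<inter> inv_into (fst c) (snd c) -` B"
    using c(3) assms(4) by (auto simp: coords_def inv_into_into f_inv_into_f inv_into_f_f subset_iff image_iff)
  then show ?thesis
    using borel_vimage_continuous_on [OF c(5) _ assms(3)] c(2) by simp
qed

lemma open_overlap:
  fixes A :: "('a::t2_space, 'n::finite) chart set"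
  assumes "closed_manifold A" "c \<in> A" "d \<in> A"
  shows "open (overlap c d)"
proof -
  note c = closed_manifold_chart [OF assms(1,2)]
  have "openin (top_of_set (fst c)) (fst c \<inter> fst d)"
    using closed_manifold_chart(1) [OF assms(1,3)] by (simp add: openin_open_Int)
  then have "openin (top_of_set (coords c)) (overlap c d)"
    unfolding overlap_def by (rule homeomorphism_imp_open_map [OF c(6)])
  then show ?thesis using c(2) openin_open_trans by blast
qed

lemma transition_apply:
  assumes "inj_on (snd c) (fst c)" "p \<in> fst c"
  shows "transition c d (snd c p) = snd d p"
  using assms by (simp add: transition_def)

lemma transition_has_derivative:
  fixes A :: "('a::t2_space, 'n::finite) chart set"
  assumes "closed_manifold A" "c \<in> A" "d \<in> A" "x \<in> overlap c d"
  shows "(transition c d has_derivative (\<lambda>v. jacobian (transition c d) (at x) *v v)) (at x)"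
proof -
  have "smooth_on (overlap c d) (transition c d)"
    using assms unfolding closed_manifold_def smooth_atlas_def by auto
  then show ?thesis
    using assms(4) smooth_on_imp_differentiable jacobian_works by blast
qed

text \<open>The chain rule for the two opposite transition maps, whose composition is the identity
  near x, gives a left inverse.\<close>

lemma invertible_jacobian_transition:
  fixes A :: "('a::t2_space, 'n::finite) chart set"
  assumes A: "closed_manifold A" and cd: "c \<in> A" "d \<in> A" and x: "x \<in> overlap c d"
  shows "invertible (jacobian (transition c d) (at x))"
proof -
  let ?T = "transition c d" and ?T' = "transition d c"
  let ?J = "jacobian ?T (at x)" and ?J' = "jacobian ?T' (at (?T x))"
  note c = closed_manifold_chart [OF A cd(1)] and d = closed_manifold_chart [OF A cd(2)]
  have inverse: "?T' (?T y) = y \<and> ?T y \<in> overlap d c" if "y \<in> overlap c d" for y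
    using that c(3) d(3) by (auto simp: overlap_def transition_apply)
  have "((\<lambda>y. ?T' (?T y)) has_derivative (\<lambda>v. ?J' *v (?J *v v))) (at x)"
    by (rule has_derivative_compose [OF transition_has_derivative [OF A cd x]
          transition_has_derivative [OF A cd(2,1) inverse [OF x, THEN conjunct2]]])
  then have "((\<lambda>y. y) has_derivative (\<lambda>v. ?J' *v (?J *v v))) (at x)"
    by (rule has_derivative_transform_within_open [OF _ open_overlap [OF A cd] x]) (rule inverse [THEN conjunct1])
  then have "(\<lambda>v. ?J' *v (?J *v v)) = (\<lambda>v. v)"
    using has_derivative_unique has_derivative_ident by blast
  then have "(?J' ** ?J) *v v = mat 1 *v v" for v
    by (metis matrix_vector_mul_assoc matrix_vector_mul_lid)
  then have "?J' ** ?J = mat 1" by (simp add: matrix_eq)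
  then show ?thesis by (meson invertible_left_inverse)
qed

text \<open>The inverse of J^T G J is J^-1 G^-1 J^-T: inner factors cancel pairwise, and the outer J
  and J^-1 cancel by cyclicity of the trace. This is the chart independence of the pairing.\<close>

lemma trace_congruence:
  fixes G H K J :: "real^'n^'n"
  assumes J: "invertible J" and G: "invertible G"
  shows "trace (matrix_inv (transpose J ** G ** J) ** (transpose J ** H ** J)
            ** matrix_inv (transpose J ** G ** J) ** (transpose J ** K ** J))
       = trace (matrix_inv G ** H ** matrix_inv G ** K)"
proof -
  let ?Ji = "matrix_inv J" and ?Gi = "matrix_inv G" and ?Jt = "transpose J"
  have Jt: "invertible ?Jt" using J by (metis det_transpose invertible_det_nz)
  let ?Jti = "matrix_inv ?Jt"
  have inv: "matrix_inv (?Jt ** G ** J) = ?Ji ** ?Gi ** ?Jti"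
    using J G Jt by (simp add: matrix_inv_mult invertible_mult matrix_mul_assoc)
  have c1: "X ** ?Jti ** ?Jt = X" and c2: "X ** J ** ?Ji = X" for X :: "real^'n^'n"
    using matrix_inv_left [OF Jt] matrix_inv_right [OF J] by (simp_all add: matrix_mul_assoc [symmetric])
  have "trace (matrix_inv (?Jt ** G ** J) ** (?Jt ** H ** J) ** matrix_inv (?Jt ** G ** J) ** (?Jt ** K ** J))
      = trace (?Ji ** ?Gi ** H ** ?Gi ** K ** J)"
    unfolding inv by (simp add: matrix_mul_assoc c1 c2)
  also have "\<dots> = trace (J ** (?Ji ** ?Gi ** H ** ?Gi ** K))" by (rule trace_mul_sym)
  also have "\<dots> = trace (?Gi ** H ** ?Gi ** K)"
    using matrix_inv_right [OF J] by (simp add: matrix_mul_assoc)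
  finally show ?thesis .
qed

text \<open>A measurable selection of charts with finitely many values; each piece of the induced
  partition has compact closure in its chart, which makes all components bounded.\<close>

locale chart_selection =
  fixes A :: "('a::t2_space, 'n::finite) chart set" and \<kappa> :: "'a \<Rightarrow> ('a, 'n) chart"
  assumes closed_manifold: "closed_manifold A"
    and finite_range: "finite (range \<kappa>)"
    and chart_in_atlas: "\<kappa> p \<in> A"
    and in_chart: "p \<in> fst (\<kappa> p)"
    and borel_piece: "\<kappa> -` {c} \<in> sets borel"
    and compact_piece: "\<exists>K. compact K \<and> K \<subseteq> coords c \<and> snd c ` (\<kappa> -` {c}) \<subseteq> K"

section \<open>Construction of a chart selection\<close>

lemma ex_chart_nbhd:
  fixes A :: "('a::t2_space, 'n::finite) chart set"
  assumes A: "closed_manifold A"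
  shows "\<exists>c W. c \<in> A \<and> open W \<and> p \<in> W \<and> W \<subseteq> fst c \<and> (\<exists>K. compact K \<and> K \<subseteq> coords c \<and> snd c ` W \<subseteq> K)"
proof -
  have "(\<Union>(U, \<phi>)\<in>A. U) = UNIV" using A by (auto simp: closed_manifold_def smooth_atlas_def)
  then have "p \<in> (\<Union>(U, \<phi>)\<in>A. U)" by simp
  then obtain c where c: "c \<in> A" "p \<in> fst c" by force
  note cc = closed_manifold_chart [OF A c(1)]
  have "snd c p \<in> coords c" using c by (simp add: coords_def)
  then obtain e where e: "e > 0" "cball (snd c p) e \<subseteq> coords c"
    using cc(2) open_contains_cball by blast
  let ?W = "fst c \<inter> snd c -` ball (snd c p) e"
  have "open ?W" by (rule continuous_open_preimage [OF cc(4,1) open_ball])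
  moreover have "snd c ` ?W \<subseteq> cball (snd c p) e" by auto
  ultimately show ?thesis
    using c e by (intro exI [of _ c] exI [of _ ?W]) (auto intro!: exI [of _ "cball (snd c p) e"])
qed

text \<open>A finite open cover is made disjoint by induction. D consists of pairs because one chart
  may occur with several neighbourhoods; its fibre then collects parts of all of them, and the
  compact sets are united. A chart that does not occur has an empty fibre.\<close>

lemma finite_cover_chart_selection:
  fixes D :: "(('a::t2_space, 'n::finite) chart \<times> 'a set) set"
  assumes "finite D"
    and "\<And>c W. (c, W) \<in> D \<Longrightarrow> open W \<and> W \<subseteq> fst c \<and> (\<exists>K. compact K \<and> K \<subseteq> coords c \<and> snd c ` W \<subseteq> K)"
  shows "\<exists>\<kappa>. (\<forall>p\<in>\<Union>(snd ` D). \<kappa> p \<in> fst ` D \<and> p \<in> fst (\<kappa> p)) \<and>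
    (\<forall>c. {p \<in> \<Union>(snd ` D). \<kappa> p = c} \<in> sets borel \<and>
       (\<exists>K. compact K \<and> K \<subseteq> coords c \<and> snd c ` {p \<in> \<Union>(snd ` D). \<kappa> p = c} \<subseteq> K))"
  using assms
proof (induction D rule: finite_induct)
  case empty
  then show ?case by (auto intro!: exI [of _ "{}"])
next
  case (insert x D)
  obtain c W where x: "x = (c, W)" by fastforce
  obtain K where W: "open W" "W \<subseteq> fst c" "compact K" "K \<subseteq> coords c" "snd c ` W \<subseteq> K"
    using insert.prems [of c W] by (auto simp: x)
  let ?U = "\<Union>(snd ` D)"
  have op: "open ?U" using insert.prems by (intro open_Union) (force simp: x)
  obtain \<kappa> where \<kappa>: "\<And>p. p \<in> ?U \<Longrightarrow> \<kappa> p \<in> fst ` D \<and> p \<in> fst (\<kappa> p)"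
    "\<And>d. {p \<in> ?U. \<kappa> p = d} \<in> sets borel"
    "\<And>d. \<exists>K. compact K \<and> K \<subseteq> coords d \<and> snd d ` {p \<in> ?U. \<kappa> p = d} \<subseteq> K"
  proof -
    from insert.prems have "\<And>c W. (c, W) \<in> D \<Longrightarrow> open W \<and> W \<subseteq> fst c \<and> (\<exists>K. compact K \<and> K \<subseteq> coords c \<and> snd c ` W \<subseteq> K)"
      by blast
    from insert.IH [OF this] obtain \<kappa> where *: "(\<forall>p\<in>?U. \<kappa> p \<in> fst ` D \<and> p \<in> fst (\<kappa> p)) \<and>
      (\<forall>c. {p \<in> ?U. \<kappa> p = c} \<in> sets borel \<and>
       (\<exists>K. compact K \<and> K \<subseteq> coords c \<and> snd c ` {p \<in> ?U. \<kappa> p = c} \<subseteq> K))" by (rule exE)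
    show thesis
    proof (rule that [of \<kappa>])
      show "\<kappa> p \<in> fst ` D \<and> p \<in> fst (\<kappa> p)" if "p \<in> ?U" for p
        using * that by (elim conjE) (rule bspec)
      show "{p \<in> ?U. \<kappa> p = d} \<in> sets borel" for d
        by (rule * [THEN conjunct2, THEN spec, THEN conjunct1])
      show "\<exists>K. compact K \<and> K \<subseteq> coords d \<and> snd d ` {p \<in> ?U. \<kappa> p = d} \<subseteq> K" for d
        by (rule * [THEN conjunct2, THEN spec, THEN conjunct2])
    qed
  qed
  \<comment> \<open>Points covered earlier keep their chart, so the new chart receives only
    \<open>W - ?U\<close>, a difference of open sets and hence Borel.\<close>
  define \<kappa>' where "\<kappa>' p = (if p \<in> ?U then \<kappa> p else c)" for p
  have fib: "{p \<in> \<Union>(snd ` insert x D). \<kappa>' p = d} = {p \<in> ?U. \<kappa> p = d} \<union> (if d = c then W - ?U else {})" for d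
    by (auto simp: \<kappa>'_def x split: if_splits)
  have k1: "\<kappa>' p \<in> fst ` insert x D \<and> p \<in> fst (\<kappa>' p)" if "p \<in> \<Union>(snd ` insert x D)" for p
    using that \<kappa>(1) [of p] W(2) by (auto simp: \<kappa>'_def x)
  have k2: "{p \<in> \<Union>(snd ` insert x D). \<kappa>' p = d} \<in> sets borel" for d
    unfolding fib using \<kappa>(2) [of d] W(1) op by (auto intro!: sets.Un sets.Diff)
  have k3: "\<exists>K. compact K \<and> K \<subseteq> coords d \<and> snd d ` {p \<in> \<Union>(snd ` insert x D). \<kappa>' p = d} \<subseteq> K" for d
  proof -
    obtain K' where K': "compact K'" "K' \<subseteq> coords d" "snd d ` {p \<in> ?U. \<kappa> p = d} \<subseteq> K'"
      using \<kappa>(3) [of d] by (elim exE conjE)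
    show ?thesis
    proof (cases "d = c")
      case True
      have "snd d ` (W - ?U) \<subseteq> K" using W(5) True by blast
      then have "snd d ` ({p \<in> ?U. \<kappa> p = d} \<union> (W - ?U)) \<subseteq> K' \<union> K"
        using K'(3) unfolding image_Un by (rule Un_mono [rotated])
      moreover have "compact (K' \<union> K) \<and> K' \<union> K \<subseteq> coords d"
        using K' W True by (simp add: compact_Un)
      ultimately show ?thesis unfolding fib if_P [OF True] by (intro exI [of _ "K' \<union> K"]) simp
    next
      case False
      show ?thesis unfolding fib if_not_P [OF False] Un_empty_right by (intro exI [of _ K'] conjI K')
    qed
  qed
  show ?case
    by (rule exI [of _ \<kappa>'], rule conjI, rule ballI, rule k1, assumption, rule allI, rule conjI, rule k2, rule k3)
qed

lemma ex_chart_selection: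
  fixes A :: "('a::t2_space, 'n::finite) chart set"
  assumes A: "closed_manifold A"
  shows "\<exists>\<kappa>. chart_selection A \<kappa>"
proof -
  let ?C = "{(c, W). c \<in> A \<and> open W \<and> W \<subseteq> fst c \<and> (\<exists>K. compact K \<and> K \<subseteq> coords c \<and> snd c ` W \<subseteq> K)}"
  have "compact (UNIV :: 'a set)" using A by (simp add: closed_manifold_def)
  moreover have "open (snd x)" if "x \<in> ?C" for x using that by auto
  moreover have "UNIV \<subseteq> (\<Union>x\<in>?C. snd x)"
  proof
    fix p :: 'a
    from ex_chart_nbhd [OF A, of p] obtain c W where "(c, W) \<in> ?C \<and> p \<in> W" by blast
    then show "p \<in> (\<Union>x\<in>?C. snd x)" by (intro UN_I [of "(c, W)"]) simp_all
  qed
  ultimately obtain D where D: "D \<subseteq> ?C" "finite D" "UNIV \<subseteq> (\<Union>x\<in>D. snd x)"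
    by (rule compactE_image)
  then have U: "\<Union>(snd ` D) = UNIV" by auto
  have "\<exists>\<kappa>. (\<forall>p\<in>\<Union>(snd ` D). \<kappa> p \<in> fst ` D \<and> p \<in> fst (\<kappa> p)) \<and>
    (\<forall>c. {p \<in> \<Union>(snd ` D). \<kappa> p = c} \<in> sets borel \<and>
       (\<exists>K. compact K \<and> K \<subseteq> coords c \<and> snd c ` {p \<in> \<Union>(snd ` D). \<kappa> p = c} \<subseteq> K))"
    by (rule finite_cover_chart_selection [OF D(2)]) (use D(1) in blast)
  then obtain \<kappa> where *: "(\<forall>p\<in>UNIV. \<kappa> p \<in> fst ` D \<and> p \<in> fst (\<kappa> p)) \<and>
    (\<forall>c. {p \<in> UNIV. \<kappa> p = c} \<in> sets borel \<and>
       (\<exists>K. compact K \<and> K \<subseteq> coords c \<and> snd c ` {p \<in> UNIV. \<kappa> p = c} \<subseteq> K))"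
    unfolding U by (rule exE)
  have fib: "{p \<in> UNIV. \<kappa> p = c} = \<kappa> -` {c}" for c by auto
  have \<kappa>: "\<kappa> p \<in> fst ` D" "p \<in> fst (\<kappa> p)" for p using * by auto
  have borel: "\<kappa> -` {c} \<in> sets borel" for c
    using * [THEN conjunct2, THEN spec, THEN conjunct1] unfolding fib .
  have compact: "\<exists>K. compact K \<and> K \<subseteq> coords c \<and> snd c ` (\<kappa> -` {c}) \<subseteq> K" for c
    using * [THEN conjunct2, THEN spec, THEN conjunct2] unfolding fib .
  have "finite (range \<kappa>)"
    by (rule finite_subset [of _ "fst ` D"]) (use \<kappa>(1) D(2) in auto)
  moreover have "\<kappa> p \<in> A" for p using \<kappa>(1) [of p] D(1) by auto
  ultimately have "chart_selection A \<kappa>"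
    using A \<kappa>(2) borel compact by unfold_locales
  then show ?thesis by (rule exI [of _ \<kappa>])
qed

section \<open>Tensor components and chart independence of the volume integral\<close>

lemma smooth_component:
  assumes "h \<in> sym_tensors A" "c \<in> A"
  shows "smooth_on (coords c) (h c)"
  using assms unfolding sym_tensors_def by blast

lemma component_transform:
  assumes "h \<in> sym_tensors A" "c \<in> A" "d \<in> A" "x \<in> overlap c d"
  shows "h c x = transpose (jacobian (transition c d) (at x)) ** h d (transition c d x)
                  ** jacobian (transition c d) (at x)"
  using assms unfolding sym_tensors_def by blast

lemma sqrt_det_congruence:
  fixes J G :: "real^'n^'n"
  shows "sqrt (det (transpose J ** G ** J)) = \<bar>det J\<bar> * sqrt (det G)"
proof -
  have "det (transpose J ** G ** J) = (det J)\<^sup>2 * det G"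
    by (simp add: det_mul power2_eq_square mult_ac)
  then show ?thesis by (simp add: real_sqrt_mult)
qed

text \<open>Under a transition map the density picks up the factor |det J|, which is the factor in
  the change of variables formula; this is why the volume is well defined without an
  orientation.\<close>

lemma closed_manifold_chart_integral:
  fixes A :: "('a::t2_space, 'n::finite) chart set"
  assumes A: "closed_manifold A" and cd: "c \<in> A" "d \<in> A" and h: "h \<in> sym_tensors A"
    and B: "B \<in> sets borel" "B \<subseteq> fst c" "B \<subseteq> fst d"
  shows "(\<integral>\<^sup>+x\<in>snd d ` B. ennreal (sqrt (det (h d x))) \<partial>lborel)
       = (\<integral>\<^sup>+x\<in>snd c ` B. ennreal (sqrt (det (h c x))) \<partial>lborel)"
proof -
  let ?T = "transition c d"
  let ?J = "\<lambda>x. jacobian ?T (at x)"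
  \<comment> \<open>For a general symmetric tensor the determinant, and with it \<open>sqrt\<close>,
    may be negative. \<open>ennreal\<close> cuts such values off at 0, so \<open>max 0\<close>
    leaves the integral unchanged and makes the integrand nonnegative.\<close>
  let ?f = "\<lambda>e x. max 0 (sqrt (det (h e x)))"
  note c = closed_manifold_chart [OF A cd(1)] and d = closed_manifold_chart [OF A cd(2)]
  have T: "?T (snd c p) = snd d p" if "p \<in> B" for p
    using that B c(3) by (intro transition_apply) auto
  have img: "?T ` (snd c ` B) = snd d ` B" by (simp add: image_image T)
  have ov: "x \<in> overlap c d" if "x \<in> snd c ` B" for x
    using that B by (auto simp: overlap_def)
  have mat: "matrix (\<lambda>v. ?J x *v v) = ?J x" for x by simp
  have meas: "(\<lambda>x. ?f e x * indicator (snd e ` B) x) \<in> borel_measurable borel" if e: "e \<in> A" "B \<subseteq> fst e" for e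
  proof -
    have "continuous_on (snd e ` B) (h e)"
      using e by (intro continuous_on_subset [OF smooth_on_imp_continuous_on [OF smooth_component [OF h]]])
        (auto simp: coords_def)
    then have "continuous_on (snd e ` B) (\<lambda>x. det (h e x))"
      by (rule continuous_on_compose2 [OF continuous_on_det]) auto
    then have "continuous_on (snd e ` B) (?f e)"
      by (intro continuous_intros)
    from borel_measurable_continuous_on_indicator [OF closed_manifold_borel_image [OF A e(1) B(1) e(2)] this]
    show ?thesis by (simp add: mult.commute)
  qed
  have jac: "\<bar>det (?J x)\<bar> * ?f d (?T x) = ?f c x" if x: "x \<in> snd c ` B" for x
  proof -
    have "sqrt (det (h c x)) = \<bar>det (?J x)\<bar> * sqrt (det (h d (?T x)))"
      unfolding component_transform [OF h cd ov [OF x]] by (rule sqrt_det_congruence)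
    then show ?thesis by (simp add: max_mult_distrib_left)
  qed
  have "(\<integral>\<^sup>+x\<in>?T ` (snd c ` B). ennreal (?f d x) \<partial>lborel)
      = (\<integral>\<^sup>+x\<in>snd c ` B. ennreal (\<bar>det (matrix (\<lambda>v. ?J x *v v))\<bar> * ?f d (?T x)) \<partial>lborel)"
  proof (rule nn_integral_change_of_variables)
    show "snd c ` B \<in> sets borel" by (rule closed_manifold_borel_image [OF A cd(1) B(1,2)])
    show "(?T has_derivative (\<lambda>v. ?J x *v v)) (at x within snd c ` B)" if "x \<in> snd c ` B" for x
      using transition_has_derivative [OF A cd ov [OF that]] by (rule has_derivative_at_withinI)
    show "inj_on ?T (snd c ` B)"
      using d(3) B(3) by (auto simp: inj_on_def T subset_iff)
    show "(\<lambda>x. ?f d x * indicator (?T ` snd c ` B) x) \<in> borel_measurable borel"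
      unfolding img by (rule meas [OF cd(2) B(3)])
    have "(\<lambda>x. \<bar>det (matrix (\<lambda>v. ?J x *v v))\<bar> * ?f d (?T x) * indicator (snd c ` B) x)
        = (\<lambda>x. ?f c x * indicator (snd c ` B) x)"
      unfolding mat by (rule ext) (use jac in \<open>auto simp: indicator_def\<close>)
    then show "(\<lambda>x. \<bar>det (matrix (\<lambda>v. ?J x *v v))\<bar> * ?f d (?T x) * indicator (snd c ` B) x) \<in> borel_measurable borel"
      using meas [OF cd(1) B(2)] by simp
  qed auto
  also have "\<dots> = (\<integral>\<^sup>+x\<in>snd c ` B. ennreal (?f c x) \<partial>lborel)"
    unfolding mat by (intro nn_integral_cong) (use jac in \<open>auto simp: indicator_def\<close>)
  finally show ?thesis by (simp add: img ennreal_max_0)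
qed

section \<open>Tensor fields as measurable bounded matrix functions on the manifold\<close>

context chart_selection
begin

abbreviation piece :: "('a, 'n) chart \<Rightarrow> 'a set" where
  "piece c \<equiv> \<kappa> -` {c}"

text \<open>The components in the selected chart. The selection \<kappa> has Borel fibres, so this
  depends measurably on p, which a chart chosen by \<open>SOME\<close> as in
  \<open>trace_pairing\<close> does not guarantee.\<close>

definition at_point :: "('a, 'n) tensor \<Rightarrow> 'a \<Rightarrow> real^'n^'n" where
  "at_point h p = h (\<kappa> p) (snd (\<kappa> p) p)"

lemma range_in_atlas: "c \<in> range \<kappa> \<Longrightarrow> c \<in> A"
  using chart_in_atlas by auto

lemma piece_subset: "piece c \<subseteq> fst c"
proof
  fix p assume "p \<in> piece c"
  then show "p \<in> fst c" using in_chart [of p] by simp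
qed

lemma disjoint_pieces: "disjoint_family_on piece (range \<kappa>)"
  by (auto simp: disjoint_family_on_def)

lemma sum_indicator_pieces: "(\<Sum>c\<in>range \<kappa>. indicator (piece c) p) = (1::'b::semiring_1)"
proof -
  have "(\<Sum>c\<in>range \<kappa>. indicator (piece c) p) = (\<Sum>c\<in>range \<kappa>. if \<kappa> p = c then 1 else (0::'b))"
    by (intro sum.cong) (auto simp: indicator_def)
  then show ?thesis using finite_range by simp
qed

lemma measurable_at_point:
  assumes h: "h \<in> sym_tensors A"
  shows "at_point h \<in> borel_measurable borel"
proof (rule measurable_piecewise_restrict [where C = "piece ` range \<kappa>"])
  show "countable (piece ` range \<kappa>)" using finite_range by (simp add: countable_finite)
  show "space borel \<subseteq> \<Union>(piece ` range \<kappa>)" by auto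
  fix \<Omega> assume "\<Omega> \<in> piece ` range \<kappa>"
  then obtain c where c: "c \<in> range \<kappa>" and \<Omega>: "\<Omega> = piece c" by (rule imageE)
  show "\<Omega> \<inter> space borel \<in> sets borel" using borel_piece by (simp add: \<Omega>)
  have "continuous_on (piece c) (\<lambda>p. h c (snd c p))"
  proof (rule continuous_on_compose2 [where g = "h c" and f = "snd c" and t = "coords c"])
    show "continuous_on (coords c) (h c)"
      by (rule smooth_on_imp_continuous_on [OF smooth_component [OF h range_in_atlas [OF c]]])
    show "continuous_on (piece c) (snd c)"
      by (rule continuous_on_subset [OF closed_manifold_chart(4) [OF closed_manifold range_in_atlas [OF c]] piece_subset])
    show "snd c ` piece c \<subseteq> coords c"
      unfolding coords_def by (intro image_mono piece_subset)
  qed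
  then have "(\<lambda>p. h c (snd c p)) \<in> borel_measurable (restrict_space borel (piece c))"
    by (rule borel_measurable_continuous_on_restrict)
  then show "at_point h \<in> borel_measurable (restrict_space borel \<Omega>)"
    unfolding \<Omega> by (subst measurable_cong [where g = "\<lambda>p. h c (snd c p)"])
      (auto simp: at_point_def space_restrict_space)
qed

lemma at_point_compact:
  obtains K where "\<And>c. compact (K c)" "\<And>c. K c \<subseteq> coords c" "\<And>p. snd (\<kappa> p) p \<in> K (\<kappa> p)"
proof -
  have "\<forall>c. \<exists>K. compact K \<and> K \<subseteq> coords c \<and> snd c ` piece c \<subseteq> K" using compact_piece by (rule allI)
  then obtain K where K: "\<forall>c. compact (K c) \<and> K c \<subseteq> coords c \<and> snd c ` piece c \<subseteq> K c" by (rule choice [THEN exE])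
  show thesis
  proof (rule that [of K])
    show "snd (\<kappa> p) p \<in> K (\<kappa> p)" for p
      using K [THEN spec, of "\<kappa> p"] by blast
    show "compact (K c)" "K c \<subseteq> coords c" for c
      using K [THEN spec, of c] by simp_all
  qed
qed

lemma bounded_at_point:
  assumes h: "h \<in> sym_tensors A"
  obtains M where "M > 0" "\<And>p. norm (at_point h p) \<le> M"
proof -
  obtain K where K: "\<And>c. compact (K c)" "\<And>c. K c \<subseteq> coords c" "\<And>p. snd (\<kappa> p) p \<in> K (\<kappa> p)"
    by (rule at_point_compact, rule that) assumption+
  have "bounded (\<Union>c\<in>range \<kappa>. h c ` K c)"
  proof (intro bounded_UN finite_range ballI)
    fix c assume "c \<in> range \<kappa>"
    then have "continuous_on (K c) (h c)"
      by (intro continuous_on_subset [OF smooth_on_imp_continuous_on [OF smooth_component [OF h range_in_atlas]] K(2)])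
    then show "bounded (h c ` K c)" using K(1) compact_continuous_image compact_imp_bounded by blast
  qed
  then obtain M where M: "M > 0" "\<forall>y\<in>(\<Union>c\<in>range \<kappa>. h c ` K c). norm y \<le> M"
    using bounded_pos by blast
  have in_image: "at_point h p \<in> (\<Union>c\<in>range \<kappa>. h c ` K c)" for p
    unfolding at_point_def using K(3) [of p] by blast
  show thesis
    by (rule that [OF M(1)], rule bspec [OF M(2) in_image])
qed

text \<open>Only order zero of the Frechet convergence is used, the index list \<open>[]\<close>.
  Finitely many compact sets contain all selected coordinates, so convergence is uniform on the
  whole manifold.\<close>

lemma uniform_limit_at_point:
  assumes "tensor_tendsto A f l F"
  shows "uniform_limit UNIV (\<lambda>s. at_point (f s)) (at_point l) F"
proof (rule uniform_limitI)
  fix e :: real assume e: "e > 0"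
  obtain K where K: "\<And>c. compact (K c)" "\<And>c. K c \<subseteq> coords c" "\<And>p. snd (\<kappa> p) p \<in> K (\<kappa> p)"
    by (rule at_point_compact, rule that) assumption+
  have "\<forall>\<^sub>F s in F. \<forall>x\<in>K c. dist (f s c x) (l c x) < e" if "c \<in> range \<kappa>" for c
  proof -
    have "uniform_limit (K c) (\<lambda>s. partials [] (f s c)) (partials [] (l c)) F"
      using assms K(1,2) [of c] range_in_atlas [OF that] unfolding tensor_tendsto_def by blast
    then show ?thesis using e by (auto dest: uniform_limitD)
  qed
  then have "\<forall>\<^sub>F s in F. \<forall>c\<in>range \<kappa>. \<forall>x\<in>K c. dist (f s c x) (l c x) < e"
    by (intro eventually_ball_finite [OF finite_range] ballI)
  then show "\<forall>\<^sub>F s in F. \<forall>p\<in>UNIV. dist (at_point (f s) p) (at_point l p) < e"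
  proof eventually_elim
    case (elim s)
    show ?case
      unfolding at_point_def using elim K(3) by blast
  qed
qed

text \<open>In each selected chart the quadratic form attains a positive minimum on the product of a
  compact set with the unit sphere; homogeneity extends the bound to all vectors, and the minimum
  over the finitely many charts serves every point.\<close>

lemma coercive_at_point:
  assumes g: "g \<in> metrics A"
  obtains m where "m > 0" "\<And>p. at_point g p \<in> coercive m"
proof -
  obtain K where K: "\<And>c. compact (K c)" "\<And>c. K c \<subseteq> coords c" "\<And>p. snd (\<kappa> p) p \<in> K (\<kappa> p)"
    by (rule at_point_compact, rule that) assumption+
  have gs: "g \<in> sym_tensors A" and pos: "\<And>c x v. c \<in> A \<Longrightarrow> x \<in> coords c \<Longrightarrow> v \<noteq> 0 \<Longrightarrow> v \<bullet> (g c x *v v) > 0"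
    using g unfolding metrics_def by auto
  have "\<exists>m>0. \<forall>x\<in>K c. g c x \<in> coercive m" if c: "c \<in> range \<kappa>" for c
  proof (cases "K c = {}")
    case True
    then show ?thesis by (intro exI [of _ 1]) simp
  next
    case False
    let ?S = "K c \<times> sphere (0 :: real^'n) 1"
    let ?q = "\<lambda>y. snd y \<bullet> (g c (fst y) *v snd y)"
    have cg: "continuous_on (K c) (g c)"
      by (intro continuous_on_subset [OF smooth_on_imp_continuous_on [OF smooth_component [OF gs range_in_atlas [OF c]]] K(2)])
    have "continuous_on ?S (\<lambda>y. g c (fst y))"
      by (rule continuous_on_compose2 [OF cg]) (auto intro!: continuous_intros)
    then have "continuous_on ?S (\<lambda>y. g c (fst y) *v snd y)"
      unfolding matrix_vector_mult_def by (intro continuous_intros)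
    then have "continuous_on ?S ?q" by (intro continuous_intros)
    moreover have "compact ?S" using K(1) by (intro compact_Times) auto
    moreover have "?S \<noteq> {}" using False by auto
    ultimately obtain y where y: "y \<in> ?S" "\<And>z. z \<in> ?S \<Longrightarrow> ?q y \<le> ?q z"
      using continuous_attains_inf [of ?S ?q] by blast
    have "snd y \<noteq> 0" "fst y \<in> coords c" using y(1) K(2) [of c] by (auto simp: mem_Times_iff)
    then have "?q y > 0" using pos range_in_atlas [OF c] by blast
    moreover have "g c x \<in> coercive (?q y)" if "x \<in> K c" for x
    proof -
      have "?q y * (v \<bullet> v) \<le> v \<bullet> (g c x *v v)" for v
      proof (cases "v = 0")
        case False
        let ?u = "(1 / norm v) *\<^sub>R v"
        have "(x, ?u) \<in> ?S" using \<open>x \<in> K c\<close> False by simp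
        from y(2) [OF this] have "?q y \<le> ?u \<bullet> (g c x *v ?u)" by simp
        also have "\<dots> = (v \<bullet> (g c x *v v)) / (v \<bullet> v)"
          by (simp add: matrix_vector_mult_scaleR dot_square_norm power2_eq_square)
        finally show ?thesis using False by (simp add: field_simps)
      qed simp
      then show ?thesis by (simp add: coercive_def)
    qed
    ultimately show ?thesis by blast
  qed
  then have "\<forall>c\<in>range \<kappa>. \<exists>m>0. \<forall>x\<in>K c. g c x \<in> coercive m" by (rule ballI)
  then obtain m where m: "\<forall>c\<in>range \<kappa>. m c > 0 \<and> (\<forall>x\<in>K c. g c x \<in> coercive (m c))"
    by (rule bchoice [THEN exE])
  let ?m = "Min (m ` range \<kappa>)"
  have fin: "finite (m ` range \<kappa>)" "m ` range \<kappa> \<noteq> {}" using finite_range by auto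
  show thesis
  proof (rule that [of ?m])
    show "?m > 0" using fin m by (simp add: Min_gr_iff)
    show "at_point g p \<in> coercive ?m" for p
    proof -
      have le: "?m \<le> m (\<kappa> p)" using fin by simp
      have "at_point g p \<in> coercive (m (\<kappa> p))" unfolding at_point_def using m K(3) by blast
      then have "m (\<kappa> p) * (v \<bullet> v) \<le> v \<bullet> (at_point g p *v v)" for v by (simp add: coercive_def)
      moreover have "?m * (v \<bullet> v) \<le> m (\<kappa> p) * (v \<bullet> v)" for v :: "real^'n"
        using le by (intro mult_right_mono) auto
      ultimately show ?thesis unfolding coercive_def using order_trans by blast
    qed
  qed
qed

end

section \<open>The Riemannian measure\<close>

context chart_selection
begin

text \<open>Lebesgue measure of the selected charts, glued along the pieces. It depends on \<kappa>
  but not on any metric; every Riemannian measure becomes a density with respect to it.\<close>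

definition reference_measure :: "'a measure" where
  "reference_measure = measure_of UNIV (sets borel) (\<lambda>B. \<Sum>c\<in>range \<kappa>. emeasure lborel (snd c ` (B \<inter> piece c)))"

lemma sets_reference_measure [measurable_cong, simp]: "sets reference_measure = sets borel"
  unfolding reference_measure_def
  using sets.sigma_sets_eq [of "borel :: 'a measure"] by (subst sets_measure_of) auto

lemma space_reference_measure [simp]: "space reference_measure = UNIV"
  using sets_eq_imp_space_eq [OF sets_reference_measure] by simp

lemma borel_Int_piece: "B \<in> sets borel \<Longrightarrow> B \<inter> piece c \<in> sets borel"
  by (rule sets.Int [OF _ borel_piece])

lemma Int_piece_subset: "B \<inter> piece c \<subseteq> fst c"
  by (rule subset_trans [OF Int_lower2 piece_subset])

lemma borel_image_piece:
  assumes "B \<in> sets borel" "c \<in> range \<kappa>"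
  shows "snd c ` (B \<inter> piece c) \<in> sets borel"
  by (rule closed_manifold_borel_image [OF closed_manifold range_in_atlas [OF assms(2)]
        borel_Int_piece [OF assms(1)] Int_piece_subset])

lemma emeasure_reference_measure:
  assumes "B \<in> sets borel"
  shows "emeasure reference_measure B = (\<Sum>c\<in>range \<kappa>. emeasure lborel (snd c ` (B \<inter> piece c)))"
proof (rule emeasure_measure_of [OF reference_measure_def])
  let ?\<mu> = "\<lambda>B. \<Sum>c\<in>range \<kappa>. emeasure lborel (snd c ` (B \<inter> piece c))"
  show "positive (sets reference_measure) ?\<mu>"
    by (simp add: positive_def)
  show "countably_additive (sets reference_measure) ?\<mu>"
  proof (rule countably_additiveI)
    fix X :: "nat \<Rightarrow> 'a set"
    assume X: "range X \<subseteq> sets reference_measure" "disjoint_family X" "(\<Union>i. X i) \<in> sets reference_measure"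
    have "(\<Sum>i. ?\<mu> (X i)) = (\<Sum>c\<in>range \<kappa>. \<Sum>i. emeasure lborel (snd c ` (X i \<inter> piece c)))"
      by (rule suminf_sum) simp
    also have "\<dots> = ?\<mu> (\<Union>i. X i)"
    proof (rule sum.cong [OF refl])
      fix c assume c: "c \<in> range \<kappa>"
      have inj: "inj_on (snd c) (piece c)"
        by (rule inj_on_subset [OF closed_manifold_chart(3) [OF closed_manifold range_in_atlas [OF c]] piece_subset])
      have "(\<Sum>i. emeasure lborel (snd c ` (X i \<inter> piece c))) = emeasure lborel (\<Union>i. snd c ` (X i \<inter> piece c))"
      proof (rule suminf_emeasure)
        show "range (\<lambda>i. snd c ` (X i \<inter> piece c)) \<subseteq> sets lborel"
          using X(1) borel_image_piece [OF _ c] by auto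
        have "snd c ` (X i \<inter> piece c) \<inter> snd c ` (X j \<inter> piece c) = {}" if "i \<noteq> j" for i j
        proof -
          have "X i \<inter> X j = {}" using X(2) that by (auto simp: disjoint_family_on_def)
          then have "(X i \<inter> piece c) \<inter> (X j \<inter> piece c) = {}" by (simp add: disjoint_iff)
          moreover have "snd c ` (X i \<inter> piece c) \<inter> snd c ` (X j \<inter> piece c) = snd c ` ((X i \<inter> piece c) \<inter> (X j \<inter> piece c))"
            by (rule inj_on_image_Int [OF inj, symmetric]) simp_all
          ultimately show ?thesis by (simp only: image_empty)
        qed
        then show "disjoint_family (\<lambda>i. snd c ` (X i \<inter> piece c))"
          by (simp add: disjoint_family_on_def)
      qed
      also have "(\<Union>i. snd c ` (X i \<inter> piece c)) = snd c ` ((\<Union>i. X i) \<inter> piece c)"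
        by (simp only: image_UN [symmetric] UN_simps)
      finally show "(\<Sum>i. emeasure lborel (snd c ` (X i \<inter> piece c))) = emeasure lborel (snd c ` ((\<Union>i. X i) \<inter> piece c))" .
    qed
    finally show "(\<Sum>i. ?\<mu> (X i)) = ?\<mu> (\<Union>i. X i)" .
  qed
  show "B \<in> sets reference_measure" using assms by simp
qed simp

lemma finite_measure_reference_measure: "finite_measure reference_measure"
proof (rule finite_measureI)
  have "emeasure lborel (snd c ` (UNIV \<inter> piece c)) \<noteq> \<infinity>" if "c \<in> range \<kappa>" for c
  proof -
    obtain K where K: "compact K \<and> K \<subseteq> coords c \<and> snd c ` piece c \<subseteq> K"
      using compact_piece by (rule exE)
    then have "emeasure lborel (snd c ` (UNIV \<inter> piece c)) \<le> emeasure lborel K"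
      by (intro emeasure_mono) (auto intro: borel_compact)
    also have "\<dots> < \<infinity>" using K by (intro emeasure_bounded_finite compact_imp_bounded) simp
    finally show ?thesis by simp
  qed
  then show "emeasure reference_measure (space reference_measure) \<noteq> \<infinity>"
    using finite_range by (simp add: emeasure_reference_measure)
qed

text \<open>On one piece only one summand of the measure is nonzero, so it is the image of
  restricted Lebesgue measure under the inverse chart.\<close>

lemma nn_integral_reference_measure_piece:
  assumes c: "c \<in> range \<kappa>" and f: "f \<in> borel_measurable borel"
  shows "(\<integral>\<^sup>+p\<in>piece c. f p \<partial>reference_measure)
       = (\<integral>\<^sup>+x\<in>snd c ` piece c. f (inv_into (fst c) (snd c) x) \<partial>lborel)"
proof -
  let ?\<psi> = "inv_into (fst c) (snd c)"
  let ?Q = "snd c ` piece c"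
  note chart = closed_manifold_chart [OF closed_manifold range_in_atlas [OF c]]
  have Q: "?Q \<in> sets borel" using borel_image_piece [OF _ c, of UNIV] by simp
  have inverse: "?\<psi> (snd c p) = p" if "p \<in> piece c" for p
    by (rule inv_into_f_f [OF chart(3) subsetD [OF piece_subset that]])
  have "continuous_on ?Q ?\<psi>"
    by (rule continuous_on_subset [OF chart(5)]) (unfold coords_def, intro image_mono piece_subset)
  then have m\<psi>: "?\<psi> \<in> borel_measurable (restrict_space borel ?Q)"
    by (rule borel_measurable_continuous_on_restrict)
  have range\<psi>: "?\<psi> \<in> space (restrict_space lborel ?Q) \<rightarrow> piece c"
    using inverse by (auto simp: space_restrict_space)
  have m: "?\<psi> \<in> measurable (restrict_space lborel ?Q) (restrict_space borel (piece c))"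
    using m\<psi> range\<psi> by (intro measurable_restrict_space2) (auto simp: measurable_def space_restrict_space sets_restrict_space)
  have eq: "restrict_space reference_measure (piece c)
      = distr (restrict_space lborel ?Q) (restrict_space borel (piece c)) ?\<psi>"
  proof (rule measure_eqI)
    show "sets (restrict_space reference_measure (piece c))
        = sets (distr (restrict_space lborel ?Q) (restrict_space borel (piece c)) ?\<psi>)"
      by (simp add: sets_restrict_space)
    fix B assume "B \<in> sets (restrict_space reference_measure (piece c))"
    then have B: "B \<subseteq> piece c" "B \<in> sets borel"
      using borel_piece by (auto simp: sets_restrict_space_iff)
    have "emeasure (restrict_space reference_measure (piece c)) B = emeasure reference_measure B"
      using B borel_piece by (intro emeasure_restrict_space) auto
    also have "\<dots> = (\<Sum>d\<in>range \<kappa>. if d = c then emeasure lborel (snd c ` B) else 0)"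
      unfolding emeasure_reference_measure [OF B(2)]
    proof (rule sum.cong [OF refl])
      fix d assume "d \<in> range \<kappa>"
      show "emeasure lborel (snd d ` (B \<inter> piece d)) = (if d = c then emeasure lborel (snd c ` B) else 0)"
      proof (cases "d = c")
        case True
        then show ?thesis using B(1) by (simp add: Int_absorb2)
      next
        case False
        then have "B \<inter> piece d = {}" using B(1) by auto
        then show ?thesis using False by simp
      qed
    qed
    also have "\<dots> = emeasure lborel (snd c ` B)" using c finite_range by simp
    also have "snd c ` B = ?\<psi> -` B \<inter> ?Q"
      using B(1) inverse by (auto simp: image_iff subset_iff)
    also have "emeasure lborel (?\<psi> -` B \<inter> ?Q)
        = emeasure (distr (restrict_space lborel ?Q) (restrict_space borel (piece c)) ?\<psi>) B"
      using B borel_piece Q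
      by (subst emeasure_distr [OF m])
         (auto simp: sets_restrict_space_iff space_restrict_space emeasure_restrict_space)
    finally show "emeasure (restrict_space reference_measure (piece c)) B
        = emeasure (distr (restrict_space lborel ?Q) (restrict_space borel (piece c)) ?\<psi>) B" .
  qed
  have "(\<integral>\<^sup>+p\<in>piece c. f p \<partial>reference_measure) = (\<integral>\<^sup>+p. f p \<partial>restrict_space reference_measure (piece c))"
    using borel_piece by (intro nn_integral_restrict_space [symmetric]) simp
  also have "\<dots> = (\<integral>\<^sup>+x. f (?\<psi> x) \<partial>restrict_space lborel ?Q)"
    unfolding eq using measurable_restrict_space1 [OF f] by (intro nn_integral_distr [OF m]) simp
  also have "\<dots> = (\<integral>\<^sup>+x\<in>?Q. f (?\<psi> x) \<partial>lborel)"
    using Q by (intro nn_integral_restrict_space) simp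
  finally show ?thesis .
qed

lemma measurable_density [measurable (raw)]:
  assumes "h \<in> sym_tensors A"
  shows "(\<lambda>p. sqrt (det (at_point h p))) \<in> borel_measurable borel"
  using measurable_compose [OF measurable_at_point [OF assms] borel_measurable_continuous_onI [OF continuous_on_det]]
  by simp

text \<open>B is cut along the pieces. Each part is computed in the chart of its piece and carried
  over to c by chart independence of the volume integral; in c the images of the parts are disjoint
  and add up to the image of B.\<close>

lemma density_reference_measure_chart:
  assumes h: "h \<in> sym_tensors A" and c: "c \<in> A" and B: "B \<in> sets borel" "B \<subseteq> fst c"
  shows "emeasure (density reference_measure (\<lambda>p. ennreal (sqrt (det (at_point h p))))) B
       = (\<integral>\<^sup>+x\<in>snd c ` B. ennreal (sqrt (det (h c x))) \<partial>lborel)"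
proof -
  let ?f = "\<lambda>p. ennreal (sqrt (det (at_point h p)))"
  have f: "?f \<in> borel_measurable borel" using measurable_density [OF h] by simp
  note chart = closed_manifold_chart [OF closed_manifold c]
  have piece: "(\<integral>\<^sup>+p\<in>piece d. ?f p * indicator B p \<partial>reference_measure)
      = (\<integral>\<^sup>+x\<in>snd c ` (B \<inter> piece d). ennreal (sqrt (det (h c x))) \<partial>lborel)" if d: "d \<in> range \<kappa>" for d
  proof -
    let ?\<psi> = "inv_into (fst d) (snd d)"
    note dchart = closed_manifold_chart [OF closed_manifold range_in_atlas [OF d]]
    have "(\<integral>\<^sup>+p\<in>piece d. ?f p * indicator B p \<partial>reference_measure)
        = (\<integral>\<^sup>+x\<in>snd d ` piece d. ?f (?\<psi> x) * indicator B (?\<psi> x) \<partial>lborel)"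
      by (rule nn_integral_reference_measure_piece [OF d]) (intro borel_measurable_times_ennreal f borel_measurable_indicator B)
    also have "\<dots> = (\<integral>\<^sup>+x\<in>snd d ` (B \<inter> piece d). ennreal (sqrt (det (h d x))) \<partial>lborel)"
    proof (rule nn_integral_cong)
      fix x
      show "?f (?\<psi> x) * indicator B (?\<psi> x) * indicator (snd d ` piece d) x
          = ennreal (sqrt (det (h d x))) * indicator (snd d ` (B \<inter> piece d)) x"
      proof (cases "x \<in> snd d ` piece d")
        case True
        then obtain p where p: "x = snd d p" "p \<in> piece d" by (rule imageE)
        have inj: "inj_on (snd d) (piece d)" by (rule inj_on_subset [OF dchart(3) piece_subset])
        have "?\<psi> x = p"
          unfolding p(1) by (rule inv_into_f_f [OF dchart(3) subsetD [OF piece_subset p(2)]])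
        moreover have "at_point h p = h d x" using p by (simp add: at_point_def)
        moreover have "x \<in> snd d ` (B \<inter> piece d) \<longleftrightarrow> p \<in> B"
          using p inj by (auto simp: inj_on_def)
        ultimately show ?thesis using True by (simp add: indicator_def)
      next
        case False
        then have "x \<notin> snd d ` (B \<inter> piece d)" by auto
        with False show ?thesis by simp
      qed
    qed
    also have "\<dots> = (\<integral>\<^sup>+x\<in>snd c ` (B \<inter> piece d). ennreal (sqrt (det (h c x))) \<partial>lborel)"
      by (rule closed_manifold_chart_integral [OF closed_manifold c range_in_atlas [OF d] h
            borel_Int_piece [OF B(1)] le_infI1 [OF B(2)] Int_piece_subset])
    finally show ?thesis .
  qed
  have split: "F p = (\<Sum>d\<in>range \<kappa>. F p * indicator (piece d) p)" for F :: "'a \<Rightarrow> ennreal" and p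
    by (simp add: sum_distrib_left [symmetric] sum_indicator_pieces)
  have "emeasure (density reference_measure ?f) B = (\<integral>\<^sup>+p. ?f p * indicator B p \<partial>reference_measure)"
    using f B by (intro emeasure_density) auto
  also have "\<dots> = (\<integral>\<^sup>+p. (\<Sum>d\<in>range \<kappa>. ?f p * indicator B p * indicator (piece d) p) \<partial>reference_measure)"
    by (subst split [of "\<lambda>p. ?f p * indicator B p"]) simp
  also have "\<dots> = (\<Sum>d\<in>range \<kappa>. \<integral>\<^sup>+p\<in>piece d. ?f p * indicator B p \<partial>reference_measure)"
    using f B borel_piece by (intro nn_integral_sum) auto
  also have "\<dots> = (\<Sum>d\<in>range \<kappa>. \<integral>\<^sup>+x\<in>snd c ` (B \<inter> piece d). ennreal (sqrt (det (h c x))) \<partial>lborel)"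
    by (rule sum.cong [OF refl piece])
  also have "\<dots> = (\<integral>\<^sup>+x. (\<Sum>d\<in>range \<kappa>. ennreal (sqrt (det (h c x))) * indicator (snd c ` (B \<inter> piece d)) x) \<partial>lborel)"
  proof (rule nn_integral_sum [symmetric])
    fix d
    have Q: "snd c ` (B \<inter> piece d) \<in> sets borel"
      by (rule closed_manifold_borel_image [OF closed_manifold c
          borel_Int_piece [OF B(1)] le_infI1 [OF B(2)]])
    have "continuous_on (snd c ` (B \<inter> piece d)) (h c)"
      using B by (intro continuous_on_subset [OF smooth_on_imp_continuous_on [OF smooth_component [OF h c]]])
        (auto simp: coords_def)
    then have "continuous_on (snd c ` (B \<inter> piece d)) (\<lambda>x. sqrt (det (h c x)))"
      by (intro continuous_on_real_sqrt continuous_on_compose2 [OF continuous_on_det]) auto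
    from borel_measurable_continuous_on_indicator [OF Q this]
    have "(\<lambda>x. ennreal (indicator (snd c ` (B \<inter> piece d)) x *\<^sub>R sqrt (det (h c x)))) \<in> borel_measurable lborel"
      by simp
    moreover have "(\<lambda>x. ennreal (indicator (snd c ` (B \<inter> piece d)) x *\<^sub>R sqrt (det (h c x))))
        = (\<lambda>x. ennreal (sqrt (det (h c x))) * indicator (snd c ` (B \<inter> piece d)) x)"
      by (rule ext) (simp add: indicator_def)
    ultimately show "(\<lambda>x. ennreal (sqrt (det (h c x))) * indicator (snd c ` (B \<inter> piece d)) x) \<in> borel_measurable lborel"
      by simp
  qed
  also have "\<dots> = (\<integral>\<^sup>+x\<in>snd c ` B. ennreal (sqrt (det (h c x))) \<partial>lborel)"
  proof (rule nn_integral_cong)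
    fix x
    have "(\<Sum>d\<in>range \<kappa>. indicator (snd c ` (B \<inter> piece d)) x) = (indicator (snd c ` B) x :: ennreal)"
    proof (cases "x \<in> snd c ` B")
      case True
      then obtain p where p: "x = snd c p" "p \<in> B" by (rule imageE)
      have "x \<in> snd c ` (B \<inter> piece d) \<longleftrightarrow> p \<in> piece d" for d
        using p B chart(3) by (auto simp: inj_on_def subset_iff)
      then have "indicator (snd c ` (B \<inter> piece d)) x = (indicator (piece d) p :: ennreal)" for d
        unfolding indicator_def by simp
      then show ?thesis using True by (simp only: sum_indicator_pieces) simp
    next
      case False
      then have "x \<notin> snd c ` (B \<inter> piece d)" for d by auto
      with False show ?thesis by simp
    qed
    then show "(\<Sum>d\<in>range \<kappa>. ennreal (sqrt (det (h c x))) * indicator (snd c ` (B \<inter> piece d)) x)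
        = ennreal (sqrt (det (h c x))) * indicator (snd c ` B) x"
      by (simp add: sum_distrib_left [symmetric])
  qed
  finally show ?thesis .
qed

text \<open>This resolves the definite description: the density has the required values in charts,
  and any other candidate agrees with it because every Borel set is a finite disjoint union of parts
  that each lie in one chart.\<close>

lemma riemannian_measure_eq_density:
  assumes h: "h \<in> sym_tensors A"
  shows "riemannian_measure A h = density reference_measure (\<lambda>p. ennreal (sqrt (det (at_point h p))))"
    (is "_ = ?\<mu>")
  unfolding riemannian_measure_def
proof (rule the_equality)
  show "sets ?\<mu> = sets borel \<and> (\<forall>c\<in>A. \<forall>B\<in>sets borel. B \<subseteq> fst c \<longrightarrow>
      emeasure ?\<mu> B = (\<integral>\<^sup>+x\<in>snd c ` B. ennreal (sqrt (det (h c x))) \<partial>lborel))"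
    using density_reference_measure_chart [OF h] by simp
  fix \<nu> :: "'a measure"
  assume \<nu>: "sets \<nu> = sets borel \<and> (\<forall>c\<in>A. \<forall>B\<in>sets borel. B \<subseteq> fst c \<longrightarrow>
      emeasure \<nu> B = (\<integral>\<^sup>+x\<in>snd c ` B. ennreal (sqrt (det (h c x))) \<partial>lborel))"
  show "\<nu> = ?\<mu>"
  proof (rule measure_eqI)
    show "sets \<nu> = sets ?\<mu>" using \<nu> by simp
    fix B assume "B \<in> sets \<nu>"
    then have B: "B \<in> sets borel" using \<nu> by simp
    have split: "emeasure \<mu> B = (\<Sum>c\<in>range \<kappa>. emeasure \<mu> (B \<inter> piece c))" if "sets \<mu> = sets borel" for \<mu> :: "'a measure"
      using that B borel_piece
      by (intro sum_emeasure_cover finite_range disjoint_pieces) (auto simp: image_subset_iff)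
    have "emeasure \<nu> (B \<inter> piece c) = emeasure ?\<mu> (B \<inter> piece c)" if c: "c \<in> range \<kappa>" for c
    proof -
      have *: "B \<inter> piece c \<in> sets borel" "B \<inter> piece c \<subseteq> fst c"
        by (rule borel_Int_piece [OF B], rule Int_piece_subset)
      show ?thesis
        using \<nu> * range_in_atlas [OF c] density_reference_measure_chart [OF h range_in_atlas [OF c] *] by simp
    qed
    then show "emeasure \<nu> B = emeasure ?\<mu> B"
      using split [of \<nu>] split [of ?\<mu>] \<nu> by simp
  qed
qed

end

section \<open>Integrals of uniformly differentiable families of matrices\<close>

lemma continuous_on_matrix_inv_coercive:
  assumes "m > 0"
  shows "continuous_on (coercive m) (matrix_inv :: real^'n^'n \<Rightarrow> real^'n^'n)"
proof -
  let ?b = "(real CARD('n) * real CARD('n) / m)\<^sup>2"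
  have "?b-lipschitz_on (coercive m) (matrix_inv :: real^'n^'n \<Rightarrow> real^'n^'n)"
    using matrix_inv_lipschitz [OF _ _ assms] by (intro lipschitz_onI) (auto simp: dist_norm)
  then show ?thesis by (rule lipschitz_on_continuous_on)
qed

text \<open>At singular matrices \<open>matrix_inv\<close> is an arbitrary choice, so measurability
  is obtained through the subspace \<open>coercive m\<close>, where it is Lipschitz.\<close>

lemma measurable_matrix_inv:
  assumes "u \<in> borel_measurable M" "m > 0" "\<And>p. u p \<in> coercive m"
  shows "(\<lambda>p. matrix_inv (u p)) \<in> borel_measurable M"
proof -
  have "u \<in> measurable M (restrict_space borel (coercive m))"
    using assms by (intro measurable_restrict_space2) auto
  then show ?thesis
    by (rule measurable_compose [OF _ borel_measurable_continuous_on_restrict [OF continuous_on_matrix_inv_coercive [OF \<open>m > 0\<close>]]])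
qed

lemma measurable_matrix_mult [measurable (raw)]:
  fixes u :: "'a \<Rightarrow> real^'n^'m" and w :: "'a \<Rightarrow> real^'k^'n"
  assumes "u \<in> borel_measurable M" "w \<in> borel_measurable M"
  shows "(\<lambda>p. u p ** w p) \<in> borel_measurable M"
proof (rule borel_measurable_continuous_Pair [OF assms])
  show "continuous_on UNIV (\<lambda>x. fst x ** (snd x :: real^'k^'n) :: real^'k^'m)"
    unfolding matrix_matrix_mult_def by (intro continuous_intros)
qed

lemma measurable_trace [measurable (raw)]:
  fixes u :: "'a \<Rightarrow> real^'n^'n"
  assumes "u \<in> borel_measurable M"
  shows "(\<lambda>p. trace (u p)) \<in> borel_measurable M"
  by (rule measurable_compose [OF assms borel_measurable_continuous_onI])
     (unfold trace_def, intro continuous_intros)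

lemma measurable_sqrt_det [measurable (raw)]:
  fixes u :: "'a \<Rightarrow> real^'n^'n"
  assumes "u \<in> borel_measurable M"
  shows "(\<lambda>p. sqrt (det (u p))) \<in> borel_measurable M"
  using measurable_compose [OF assms borel_measurable_continuous_onI [OF continuous_on_det]] by simp

lemma measurable_dvol:
  assumes "u \<in> borel_measurable M" "m > 0" "\<And>p. u p \<in> coercive m" "w \<in> borel_measurable M"
  shows "(\<lambda>p. dvol (u p) (w p)) \<in> borel_measurable M"
  unfolding dvol_def using measurable_matrix_inv [OF assms(1-3)] assms(1,4) by measurable

lemma matrix_region_coercive: "G \<in> matrix_region m M \<Longrightarrow> G \<in> coercive m"
  by (simp add: matrix_region_def)

lemma integrable_sqrt_det:
  assumes "finite_measure \<mu>" "u \<in> borel_measurable \<mu>" "m > 0" "\<And>p. u p \<in> matrix_region m M"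
  shows "integrable \<mu> (\<lambda>p. sqrt (det (u p :: real^'n^'n)))"
proof -
  obtain B where "B > 0" "\<And>G::real^'n^'n. G \<in> cball 0 M \<Longrightarrow> \<bar>sqrt (det G)\<bar> \<le> B"
    using sqrt_det_bounded [where 'n = 'n and M = M] by metis
  then show ?thesis
    using assms by (intro finite_measure.integrable_const_bound [where B = B]) (auto simp: matrix_region_def)
qed

lemma integrable_dvol:
  assumes "finite_measure \<mu>" "u \<in> borel_measurable \<mu>" "m > 0" "\<And>p. u p \<in> matrix_region m M"
    "w \<in> borel_measurable \<mu>" "\<And>p. norm (w p) \<le> N"
  shows "integrable \<mu> (\<lambda>p. dvol (u p) (w p :: real^'n^'n))"
proof -
  obtain C where C: "C > 0" "\<And>G H::real^'n^'n. G \<in> matrix_region m M \<Longrightarrow> \<bar>dvol G H\<bar> \<le> C * norm H"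
    using dvol_bounded [where 'n = 'n and M = M, OF \<open>m > 0\<close>] by metis
  have "\<bar>dvol (u p) (w p)\<bar> \<le> C * N" for p
    using C(2) [OF assms(4) [of p], of "w p"] mult_left_mono [OF assms(6) [of p], of C] C(1) by linarith
  moreover have "(\<lambda>p. dvol (u p) (w p)) \<in> borel_measurable \<mu>"
    by (rule measurable_dvol [OF assms(2,3) matrix_region_coercive [OF assms(4)] assms(5)])
  ultimately show ?thesis
    using assms(1) by (intro finite_measure.integrable_const_bound [where B = "C * N"]) auto
qed

lemma tendsto_integral_uniform_limit:
  fixes f :: "'i \<Rightarrow> 'a \<Rightarrow> real"
  assumes \<mu>: "finite_measure \<mu>" and f: "\<forall>\<^sub>F s in F. integrable \<mu> (f s)" and l: "integrable \<mu> l"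
    and lim: "uniform_limit UNIV f l F"
  shows "((\<lambda>s. \<integral>p. f s p \<partial>\<mu>) \<longlongrightarrow> (\<integral>p. l p \<partial>\<mu>)) F"
proof (rule tendstoI)
  fix e :: real assume e: "e > 0"
  \<comment> \<open>The summand 1 keeps the denominator positive for the null measure and makes the
    final inequality strict.\<close>
  let ?d = "e / (measure \<mu> (space \<mu>) + 1)"
  have pos: "measure \<mu> (space \<mu>) + 1 > 0" by (simp add: add_nonneg_pos)
  then have d: "?d > 0" using e by simp
  from f uniform_limitD [OF lim d]
  show "\<forall>\<^sub>F s in F. dist (\<integral>p. f s p \<partial>\<mu>) (\<integral>p. l p \<partial>\<mu>) < e"
  proof eventually_elim
    case (elim s)
    have "dist (\<integral>p. f s p \<partial>\<mu>) (\<integral>p. l p \<partial>\<mu>) = \<bar>\<integral>p. f s p - l p \<partial>\<mu>\<bar>"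
      using elim l by (simp add: dist_real_def)
    also have "\<dots> \<le> (\<integral>p. \<bar>f s p - l p\<bar> \<partial>\<mu>)" by (rule integral_abs_bound)
    also have "\<dots> \<le> (\<integral>p. ?d \<partial>\<mu>)"
    proof (rule integral_mono)
      show "integrable \<mu> (\<lambda>p. \<bar>f s p - l p\<bar>)" using elim l by simp
      show "integrable \<mu> (\<lambda>p. ?d)" using \<mu> by (simp add: finite_measure.integrable_const)
      show "\<bar>f s p - l p\<bar> \<le> ?d" for p using elim by (auto simp: dist_real_def intro: less_imp_le)
    qed
    also have "\<dots> = measure \<mu> (space \<mu>) * ?d" by simp
    also have "\<dots> < e" using e pos by (simp add: field_simps)
    finally show ?case .
  qed
qed

section \<open>Uniform derivatives and differentiation under the integral\<close>

text \<open>Difference quotients converge uniformly in the point p. This is what a curve derivative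
  of tensors yields, and on a finite measure space it is enough to pass to the limit in integrals.
  The set I admits one-sided derivatives at endpoints.\<close>

definition has_uniform_derivative ::
  "(real \<Rightarrow> 'a \<Rightarrow> 'b::real_normed_vector) \<Rightarrow> ('a \<Rightarrow> 'b) \<Rightarrow> real \<Rightarrow> real set \<Rightarrow> bool" where
  "has_uniform_derivative u u' t I \<longleftrightarrow>
     uniform_limit UNIV (\<lambda>s p. (1 / (s - t)) *\<^sub>R (u s p - u t p)) u' (at t within I)"

lemma has_uniform_derivativeD:
  assumes "has_uniform_derivative u u' t I" "e > 0"
  shows "\<forall>\<^sub>F s in at t within I. \<forall>p. norm ((1 / (s - t)) *\<^sub>R (u s p - u t p) - u' p) < e"
  using uniform_limitD [OF assms(1) [unfolded has_uniform_derivative_def] assms(2)]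
  by (simp add: dist_norm)

lemma eventually_at_within_near:
  fixes t :: real
  assumes "d > 0"
  shows "\<forall>\<^sub>F s in at t within I. s \<in> I \<and> s \<noteq> t \<and> \<bar>s - t\<bar> < d"
  using assms by (auto simp: eventually_at dist_real_def)

text \<open>Near t the difference quotient is within 1 of u', hence the constant N + 1.\<close>

lemma has_uniform_derivative_lipschitz:
  assumes "has_uniform_derivative u u' t I" "\<And>p. norm (u' p) \<le> N"
  shows "\<forall>\<^sub>F s in at t within I. \<forall>p. norm (u s p - u t p) \<le> (N + 1) * \<bar>s - t\<bar>"
  using has_uniform_derivativeD [OF assms(1) zero_less_one] eventually_at_within_near [OF zero_less_one]
proof eventually_elim
  case (elim s)
  show ?case
  proof
    fix p
    let ?q = "(1 / (s - t)) *\<^sub>R (u s p - u t p)"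
    have "norm ?q \<le> norm (?q - u' p) + norm (u' p)" using norm_triangle_sub by (metis add.commute)
    also have "\<dots> \<le> N + 1" using elim(1) [THEN spec, of p] assms(2) [of p] by simp
    finally have "norm ?q \<le> N + 1" .
    then have "norm (u s p - u t p) / \<bar>s - t\<bar> \<le> N + 1" by (simp add: divide_inverse mult.commute)
    then show "norm (u s p - u t p) \<le> (N + 1) * \<bar>s - t\<bar>" using elim(2) by (simp add: field_simps)
  qed
qed

lemma has_uniform_derivative_region:
  assumes u: "has_uniform_derivative u u' t I" and u': "\<And>p. norm (u' p) \<le> N"
    and ut: "\<And>p. u t p \<in> matrix_region m M" and m: "m > 0"
  shows "\<forall>\<^sub>F s in at t within I. \<forall>p. u s p \<in> matrix_region (m / 2) (M + m)"
proof -
  have N: "N \<ge> 0" using u' norm_ge_zero order_trans by blast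
  \<comment> \<open>Within this distance of t the values move by at most m/2, which costs half of
    the coercivity constant.\<close>
  have "m / (2 * (N + 1)) > 0" using m N by simp
  from has_uniform_derivative_lipschitz [OF u u'] eventually_at_within_near [OF this]
  show ?thesis
  proof eventually_elim
    case (elim s)
    show ?case
    proof
      fix p
      have "norm (u s p - u t p) \<le> (N + 1) * \<bar>s - t\<bar>" using elim(1) by simp
      also have "\<dots> \<le> m / 2" using elim(2) N by (simp add: field_simps)
      finally have d: "norm (u s p - u t p) \<le> m / 2" .
      have "u s p \<in> coercive (m - m / 2)"
        by (rule coercive_perturb [OF matrix_region_coercive [OF ut] d])
      moreover have "norm (u s p) \<le> M + m"
        using d ut [of p] norm_triangle_sub [of "u s p" "u t p"] m by (auto simp: matrix_region_def)
      ultimately show "u s p \<in> matrix_region (m / 2) (M + m)" by (simp add: matrix_region_def)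
    qed
  qed
qed

lemma matrix_region_mono:
  assumes "G \<in> matrix_region m M" "m' \<le> m" "M \<le> M'"
  shows "G \<in> matrix_region m' M'"
proof -
  have "m' * (v \<bullet> v) \<le> v \<bullet> (G *v v)" for v
    using assms(1) mult_right_mono [OF assms(2), of "v \<bullet> v"] unfolding matrix_region_def coercive_def
    by (metis (mono_tags, lifting) IntD1 inner_ge_zero mem_Collect_eq order_trans)
  then show ?thesis using assms by (simp add: matrix_region_def coercive_def)
qed

text \<open>The second order Taylor remainder is of order (s - t)^2 uniformly in p, and
  \<open>dvol\<close> is linear in its second argument, so the difference quotients of the integrand
  converge uniformly.\<close>

lemma has_real_derivative_integral_sqrt_det:
  fixes u :: "real \<Rightarrow> 'a \<Rightarrow> real^'n^'n"
  assumes \<mu>: "finite_measure \<mu>"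
    and meas: "\<And>s. s \<in> I \<Longrightarrow> u s \<in> borel_measurable \<mu>" and t: "t \<in> I"
    and u: "has_uniform_derivative u u' t I" and u': "u' \<in> borel_measurable \<mu>" "\<And>p. norm (u' p) \<le> N"
    and ut: "\<And>p. u t p \<in> matrix_region m M" and m: "m > 0"
  shows "((\<lambda>s. \<integral>p. sqrt (det (u s p)) \<partial>\<mu>) has_real_derivative (\<integral>p. dvol (u t p) (u' p) \<partial>\<mu>) / 2) (at t within I)"
proof -
  let ?m = "m / 2" and ?M = "M + m"
  let ?f = "\<lambda>s p. (sqrt (det (u s p)) - sqrt (det (u t p))) / (s - t)"
  let ?l = "\<lambda>p. dvol (u t p) (u' p) / 2"
  have m2: "?m > 0" using m by simp
  obtain L where L: "L > 0" "\<And>G G'::real^'n^'n. G \<in> matrix_region ?m ?M \<Longrightarrow> G' \<in> matrix_region ?m ?M \<Longrightarrow>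
     \<bar>sqrt (det G') - sqrt (det G) - dvol G (G' - G) / 2\<bar> \<le> L * (norm (G' - G))\<^sup>2"
    using sqrt_det_taylor [where 'n = 'n and M = ?M, OF m2] by metis
  obtain C where C: "C > 0" "\<And>G H::real^'n^'n. G \<in> matrix_region ?m ?M \<Longrightarrow> \<bar>dvol G H\<bar> \<le> C * norm H"
    using dvol_bounded [where 'n = 'n and M = ?M, OF m2] by metis
  have N: "N \<ge> 0" using u'(2) norm_ge_zero order_trans by blast
  have ut': "u t p \<in> matrix_region ?m ?M" for p
    using matrix_region_mono [OF ut] m by simp
  note region = has_uniform_derivative_region [OF u u'(2) ut m]
  have "uniform_limit UNIV ?f ?l (at t within I)"
  proof (rule uniform_limitI)
    fix e :: real assume e: "e > 0"
    \<comment> \<open>The first threshold makes the Taylor remainder, divided by |s - t|, less than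
      e/2; the second bounds the effect of replacing the difference quotient by u', which enters
      with factor 1/2, by e/2.\<close>
    have d1: "e / (2 * (L * (N + 1)\<^sup>2)) > 0" using e L N by simp
    have d2: "e / C > 0" using e C by simp
    from region has_uniform_derivative_lipschitz [OF u u'(2)]
      eventually_at_within_near [OF d1] has_uniform_derivativeD [OF u d2]
    show "\<forall>\<^sub>F s in at t within I. \<forall>p\<in>UNIV. dist (?f s p) (?l p) < e"
    proof eventually_elim
      case (elim s)
      show ?case
      proof
        fix p
        let ?q = "(1 / (s - t)) *\<^sub>R (u s p - u t p)"
        have st: "s - t \<noteq> 0" using elim(3) by simp
        have "\<bar>sqrt (det (u s p)) - sqrt (det (u t p)) - dvol (u t p) (u s p - u t p) / 2\<bar>
            \<le> L * (norm (u s p - u t p))\<^sup>2"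
          by (rule L(2) [OF ut']) (use elim(1) in blast)
        also have "\<dots> \<le> L * ((N + 1) * \<bar>s - t\<bar>)\<^sup>2"
          using L(1) elim(2) by (intro mult_left_mono power_mono) auto
        finally have "\<bar>sqrt (det (u s p)) - sqrt (det (u t p)) - dvol (u t p) (u s p - u t p) / 2\<bar> / \<bar>s - t\<bar>
            \<le> L * ((N + 1) * \<bar>s - t\<bar>)\<^sup>2 / \<bar>s - t\<bar>"
          by (rule divide_right_mono) simp
        also have "\<dots> = L * (N + 1)\<^sup>2 * \<bar>s - t\<bar>"
          using st by (simp add: power2_eq_square field_simps)
        also have "\<dots> < e / 2"
        proof -
          have "L * (N + 1)\<^sup>2 > 0" using L(1) N by simp
          then show ?thesis using elim(3) by (simp add: field_simps)
        qed
        finally have 1: "\<bar>?f s p - dvol (u t p) ?q / 2\<bar> < e / 2"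
          unfolding abs_divide [symmetric] by (simp add: dvol_scaleR_right diff_divide_distrib mult.commute)
        have "\<bar>dvol (u t p) (?q - u' p)\<bar> \<le> C * norm (?q - u' p)"
          by (rule C(2) [OF ut'])
        also have "\<dots> < e"
          using elim(4) [THEN spec, of p] C(1) by (simp add: pos_less_divide_eq mult.commute)
        finally have 2: "\<bar>dvol (u t p) ?q - dvol (u t p) (u' p)\<bar> < e"
          by (simp add: dvol_diff_right)
        show "dist (?f s p) (?l p) < e"
          using 1 2 unfolding dist_real_def by linarith
      qed
    qed
  qed
  moreover have intt: "integrable \<mu> (\<lambda>p. sqrt (det (u t p)))"
    by (rule integrable_sqrt_det [OF \<mu> meas [OF t] m ut])
  have ints: "\<forall>\<^sub>F s in at t within I. integrable \<mu> (\<lambda>p. sqrt (det (u s p)))"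
    using region eventually_at_within_near [OF zero_less_one]
  proof eventually_elim
    case (elim s)
    show ?case
      by (rule integrable_sqrt_det [OF \<mu> meas m2]) (use elim in blast)+
  qed
  then have "\<forall>\<^sub>F s in at t within I. integrable \<mu> (?f s)"
    by eventually_elim (use intt in simp)
  moreover have "integrable \<mu> ?l"
    using integrable_dvol [OF \<mu> meas [OF t] m ut u'] by simp
  ultimately have "((\<lambda>s. \<integral>p. ?f s p \<partial>\<mu>) \<longlongrightarrow> (\<integral>p. ?l p \<partial>\<mu>)) (at t within I)"
    by (intro tendsto_integral_uniform_limit [OF \<mu>])
  moreover have "\<forall>\<^sub>F s in at t within I. (\<integral>p. ?f s p \<partial>\<mu>)
      = ((\<integral>p. sqrt (det (u s p)) \<partial>\<mu>) - (\<integral>p. sqrt (det (u t p)) \<partial>\<mu>)) / (s - t)"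
    using ints by eventually_elim (use intt in simp)
  ultimately have "((\<lambda>s. ((\<integral>p. sqrt (det (u s p)) \<partial>\<mu>) - (\<integral>p. sqrt (det (u t p)) \<partial>\<mu>)) / (s - t))
      \<longlongrightarrow> (\<integral>p. ?l p \<partial>\<mu>)) (at t within I)"
    by (rule Lim_transform_eventually)
  then show ?thesis by (simp add: has_field_derivative_iff)
qed

text \<open>The curves u and v agree at t to first order, so u s - v s is o(s - t) and a Lipschitz
  estimate in the first argument of \<open>dvol\<close> already removes its variation. In the second
  integral w is frozen at t, so what remains is the contribution of w'.\<close>

lemma has_real_derivative_integral_dvol_diff:
  fixes u v w :: "real \<Rightarrow> 'a \<Rightarrow> real^'n^'n"
  assumes \<mu>: "finite_measure \<mu>" and t: "t \<in> I"
    and meas: "\<And>s. s \<in> I \<Longrightarrow> u s \<in> borel_measurable \<mu>" "\<And>s. s \<in> I \<Longrightarrow> v s \<in> borel_measurable \<mu>"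
      "\<And>s. s \<in> I \<Longrightarrow> w s \<in> borel_measurable \<mu>"
    and u: "has_uniform_derivative u u' t I" and v: "has_uniform_derivative v u' t I"
    and w: "has_uniform_derivative w w' t I" and eq: "v t = u t"
    and w': "w' \<in> borel_measurable \<mu>"
    and bounds: "\<And>p. norm (u' p) \<le> N" "\<And>p. norm (w' p) \<le> N" "\<And>p. norm (w t p) \<le> N"
    and ut: "\<And>p. u t p \<in> matrix_region m M" and m: "m > 0"
  shows "((\<lambda>s. (\<integral>p. dvol (u s p) (w s p) \<partial>\<mu>) - (\<integral>p. dvol (v s p) (w t p) \<partial>\<mu>))
      has_real_derivative (\<integral>p. dvol (u t p) (w' p) \<partial>\<mu>)) (at t within I)"
proof -
  let ?m = "m / 2" and ?M = "M + m"
  let ?f = "\<lambda>s p. (dvol (u s p) (w s p) - dvol (v s p) (w t p)) / (s - t)"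
  let ?l = "\<lambda>p. dvol (u t p) (w' p)"
  have m2: "?m > 0" using m by simp
  obtain L where L: "L > 0" "\<And>G G' H::real^'n^'n. G \<in> matrix_region ?m ?M \<Longrightarrow> G' \<in> matrix_region ?m ?M \<Longrightarrow>
     \<bar>dvol G H - dvol G' H\<bar> \<le> L * norm (G - G') * norm H"
    using dvol_lipschitz [where 'n = 'n and M = ?M, OF m2] by metis
  obtain C where C: "C > 0" "\<And>G H::real^'n^'n. G \<in> matrix_region ?m ?M \<Longrightarrow> \<bar>dvol G H\<bar> \<le> C * norm H"
    using dvol_bounded [where 'n = 'n and M = ?M, OF m2] by metis
  have N: "N \<ge> 0" using bounds(1) norm_ge_zero order_trans by blast
  have ut': "u t p \<in> matrix_region ?m ?M" for p
    using matrix_region_mono [OF ut] m by simp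
  have vt: "v t p \<in> matrix_region m M" for p using ut eq by simp
  note regionu = has_uniform_derivative_region [OF u bounds(1) ut m]
  note regionv = has_uniform_derivative_region [OF v bounds(1) vt m]
  have "uniform_limit UNIV ?f ?l (at t within I)"
  proof (rule uniform_limitI)
    fix e :: real assume e: "e > 0"
    \<comment> \<open>Each of the three error terms gets e/4; in the third, e/8 goes to the
      difference quotient of u and e/8 to that of v.\<close>
    have d1: "e / (4 * (L * (N + 1)\<^sup>2)) > 0" using e L N by simp
    have d2: "e / (4 * C) > 0" using e C by simp
    have d3: "e / (8 * (L * (N + 1))) > 0" using e L N by simp
    from regionu regionv has_uniform_derivative_lipschitz [OF u bounds(1)]
      eventually_at_within_near [OF d1] has_uniform_derivativeD [OF w d2]
      has_uniform_derivativeD [OF u d3] has_uniform_derivativeD [OF v d3]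
    show "\<forall>\<^sub>F s in at t within I. \<forall>p\<in>UNIV. dist (?f s p) (?l p) < e"
    proof eventually_elim
      case (elim s)
      show ?case
      proof
        fix p
        let ?qu = "(1 / (s - t)) *\<^sub>R (u s p - u t p)" and ?qv = "(1 / (s - t)) *\<^sub>R (v s p - v t p)"
        let ?r = "(1 / (s - t)) *\<^sub>R (w s p - w t p)"
        have st: "s - t \<noteq> 0" using elim(4) by simp
        have us: "u s p \<in> matrix_region ?m ?M" and vs: "v s p \<in> matrix_region ?m ?M"
          using elim(1,2) by simp_all
        \<comment> \<open>The terms are the error of the difference quotient of w, the displacement
          of u from its value at t, and the separation of u and v.\<close>
        have split: "?f s p - ?l p = dvol (u s p) (?r - w' p) + (dvol (u s p) (w' p) - dvol (u t p) (w' p))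
            + (dvol (u s p) (w t p) - dvol (v s p) (w t p)) / (s - t)"
          unfolding dvol_diff_right dvol_scaleR_right by (simp add: diff_divide_distrib)
        have "\<bar>dvol (u s p) (?r - w' p)\<bar> \<le> C * norm (?r - w' p)" by (rule C(2) [OF us])
        also have "\<dots> < e / 4"
          using elim(5) [THEN spec, of p] C(1) by (simp add: field_simps)
        finally have 1: "\<bar>dvol (u s p) (?r - w' p)\<bar> < e / 4" .
        have "\<bar>dvol (u s p) (w' p) - dvol (u t p) (w' p)\<bar> \<le> L * norm (u s p - u t p) * norm (w' p)"
          by (rule L(2) [OF us ut'])
        also have "\<dots> \<le> L * ((N + 1) * \<bar>s - t\<bar>) * (N + 1)"
          using L(1) N elim(3) bounds(2) [of p] by (intro mult_mono mult_left_mono) auto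
        also have "\<dots> = L * (N + 1)\<^sup>2 * \<bar>s - t\<bar>" by (simp add: power2_eq_square)
        also have "\<dots> < e / 4"
        proof -
          have "L * (N + 1)\<^sup>2 > 0" using L(1) N by simp
          then show ?thesis using elim(4) by (simp add: field_simps)
        qed
        finally have 2: "\<bar>dvol (u s p) (w' p) - dvol (u t p) (w' p)\<bar> < e / 4" .
        have "\<bar>(dvol (u s p) (w t p) - dvol (v s p) (w t p)) / (s - t)\<bar>
            \<le> (L * norm (u s p - v s p) * norm (w t p)) / \<bar>s - t\<bar>"
          unfolding abs_divide by (intro divide_right_mono L(2) us vs) simp
        also have "\<dots> = L * norm (?qu - ?qv) * norm (w t p)"
        proof -
          have "?qu - ?qv = (1 / (s - t)) *\<^sub>R (u s p - v s p)"
            using eq by (simp add: scaleR_diff_right [symmetric])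
          then have "norm (?qu - ?qv) = norm (u s p - v s p) / \<bar>s - t\<bar>"
            by (simp only: norm_scaleR) simp
          then show ?thesis by simp
        qed
        also have "\<dots> \<le> L * (norm (?qu - u' p) + norm (?qv - u' p)) * (N + 1)"
        proof (intro mult_mono mult_left_mono)
          have "norm ((?qu - u' p) - (?qv - u' p)) \<le> norm (?qu - u' p) + norm (?qv - u' p)"
            by (rule norm_triangle_ineq4)
          then show "norm (?qu - ?qv) \<le> norm (?qu - u' p) + norm (?qv - u' p)" by (simp only: diff_diff_eq2 diff_add_cancel)
          show "norm (w t p) \<le> N + 1" using bounds(3) [of p] by simp
        qed (use L(1) N in auto)
        also have "\<dots> \<le> L * (e / (8 * (L * (N + 1))) + e / (8 * (L * (N + 1)))) * (N + 1)"
          using L(1) N elim(6,7) by (intro mult_right_mono mult_left_mono add_mono) (auto intro: less_imp_le)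
        also have "\<dots> = e / 4"
        proof -
          have double: "L * (x + x) * (N + 1) = 2 * (L * (N + 1)) * x" for x by simp
          have cancel: "2 * K * (e / (8 * K)) = e / 4" if "K > 0" for K :: real using that by simp
          show ?thesis unfolding double by (rule cancel) (use L(1) N in simp)
        qed
        finally have 3: "\<bar>(dvol (u s p) (w t p) - dvol (v s p) (w t p)) / (s - t)\<bar> \<le> e / 4" .
        show "dist (?f s p) (?l p) < e"
          unfolding dist_real_def split using 1 2 3 e by linarith
      qed
    qed
  qed
  moreover have ints: "\<forall>\<^sub>F s in at t within I. integrable \<mu> (\<lambda>p. dvol (u s p) (w s p))
      \<and> integrable \<mu> (\<lambda>p. dvol (v s p) (w t p))"
    using regionu regionv has_uniform_derivative_lipschitz [OF w bounds(2)] eventually_at_within_near [OF zero_less_one]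
  proof eventually_elim
    case (elim s)
    have "norm (w s p) \<le> N + (N + 1)" for p
    proof -
      have "norm (w s p - w t p) \<le> (N + 1) * \<bar>s - t\<bar>" using elim(3) by simp
      also have "\<dots> \<le> (N + 1) * 1" using elim(4) N by (intro mult_left_mono) auto
      finally show ?thesis using bounds(3) [of p] norm_triangle_sub [of "w s p" "w t p"] by simp
    qed
    then show ?case
      using elim integrable_dvol [OF \<mu> meas(1) m2 _ meas(3)] integrable_dvol [OF \<mu> meas(2) m2 _ meas(3) [OF t] bounds(3)]
      by blast
  qed
  then have "\<forall>\<^sub>F s in at t within I. integrable \<mu> (?f s)"
    by eventually_elim simp
  moreover have intl: "integrable \<mu> ?l"
    by (rule integrable_dvol [OF \<mu> meas(1) [OF t] m ut w' bounds(2)])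
  ultimately have "((\<lambda>s. \<integral>p. ?f s p \<partial>\<mu>) \<longlongrightarrow> (\<integral>p. ?l p \<partial>\<mu>)) (at t within I)"
    by (intro tendsto_integral_uniform_limit [OF \<mu>])
  moreover have "\<forall>\<^sub>F s in at t within I. (\<integral>p. ?f s p \<partial>\<mu>)
      = ((\<integral>p. dvol (u s p) (w s p) \<partial>\<mu>) - (\<integral>p. dvol (v s p) (w t p) \<partial>\<mu>)) / (s - t)"
    using ints by eventually_elim simp
  ultimately have "((\<lambda>s. ((\<integral>p. dvol (u s p) (w s p) \<partial>\<mu>) - (\<integral>p. dvol (v s p) (w t p) \<partial>\<mu>)) / (s - t))
      \<longlongrightarrow> (\<integral>p. ?l p \<partial>\<mu>)) (at t within I)"
    by (rule Lim_transform_eventually)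
  then show ?thesis by (simp add: has_field_derivative_iff eq)
qed

section \<open>The Ebin metric and the volume\<close>

text \<open>Equality and differentiability must go together: \<open>frechet_derivative\<close> is
  meaningful only where a derivative exists, and the next induction step needs equality on a whole
  neighbourhood, which openness of S supplies.\<close>

lemma partials_linear_combination:
  fixes f g :: "real^'n \<Rightarrow> 'b::real_normed_vector"
  assumes S: "open S" and f: "smooth_on S f" and g: "smooth_on S g"
  shows "x \<in> S \<Longrightarrow> partials is (\<lambda>x. f x + r *\<^sub>R g x) x = partials is f x + r *\<^sub>R partials is g x"
    and "x \<in> S \<Longrightarrow> partials is (\<lambda>x. f x + r *\<^sub>R g x) differentiable (at x)"
proof -
  let ?F = "\<lambda>x. f x + r *\<^sub>R g x"
  have der: "(partials is ?F has_derivative (\<lambda>v. frechet_derivative (partials is f) (at x) v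
        + r *\<^sub>R frechet_derivative (partials is g) (at x) v)) (at x)"
    if eq: "\<And>y. y \<in> S \<Longrightarrow> partials is ?F y = partials is f y + r *\<^sub>R partials is g y" and x: "x \<in> S" for x "is"
  proof -
    have "(partials is f has_derivative frechet_derivative (partials is f) (at x)) (at x)"
      "(partials is g has_derivative frechet_derivative (partials is g) (at x)) (at x)"
      using f g x unfolding smooth_on_def by (auto simp: frechet_derivative_works [symmetric])
    then have "((\<lambda>y. partials is f y + r *\<^sub>R partials is g y) has_derivative
        (\<lambda>v. frechet_derivative (partials is f) (at x) v + r *\<^sub>R frechet_derivative (partials is g) (at x) v)) (at x)"
      by (intro has_derivative_add has_derivative_scaleR_right)
    then show ?thesis
      by (rule has_derivative_transform_within_open [OF _ S x]) (simp add: eq)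
  qed
  have eq: "\<And>x. x \<in> S \<Longrightarrow> partials is ?F x = partials is f x + r *\<^sub>R partials is g x" for "is"
  proof (induction "is")
    case (Cons i "is")
    show ?case
      using frechet_derivative_at [OF der [OF Cons.IH Cons.prems]] by (simp add: fun_eq_iff)
  qed simp
  then show "x \<in> S \<Longrightarrow> partials is ?F x = partials is f x + r *\<^sub>R partials is g x" .
  show "x \<in> S \<Longrightarrow> partials is ?F differentiable (at x)"
    using der [OF eq] differentiableI by blast
qed

lemma sym_tensors_linear_combination:
  fixes A :: "('a::t2_space, 'n::finite) chart set"
  assumes A: "closed_manifold A" and h: "h \<in> sym_tensors A" and k: "k \<in> sym_tensors A"
  shows "tensor_add h (tensor_scale r k) \<in> sym_tensors A"
proof -
  have "smooth_on (coords c) (\<lambda>x. h c x + r *\<^sub>R k c x)" if "c \<in> A" for c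
    unfolding smooth_on_def
    using partials_linear_combination(2) [OF closed_manifold_chart(2) [OF A that] smooth_component [OF h that] smooth_component [OF k that]]
    by blast
  moreover have "transpose (h c x + r *\<^sub>R k c x) = h c x + r *\<^sub>R k c x" if "c \<in> A" "x \<in> coords c" for c x
  proof -
    have "transpose (h c x) = h c x" "transpose (k c x) = k c x"
      using h k that unfolding sym_tensors_def by blast+
    then show ?thesis by (simp add: transpose_def vec_eq_iff)
  qed
  moreover have "h c x + r *\<^sub>R k c x = transpose (jacobian (transition c d) (at x))
        ** (h d (transition c d x) + r *\<^sub>R k d (transition c d x)) ** jacobian (transition c d) (at x)"
    if "c \<in> A" "d \<in> A" "x \<in> overlap c d" for c d x
    unfolding component_transform [OF h that] component_transform [OF k that]
    by (simp add: matrix_add_ldistrib matrix_add_rdistrib matrix_mult_scaleR_left matrix_mult_scaleR_right)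
  moreover have "h c x + r *\<^sub>R k c x = 0" if "c \<notin> A \<or> x \<notin> coords c" for c x
  proof -
    have "h c x = 0" "k c x = 0" using h k that unfolding sym_tensors_def by blast+
    then show ?thesis by simp
  qed
  ultimately show ?thesis unfolding sym_tensors_def tensor_add_def tensor_scale_def by blast
qed

text \<open>A nonempty interior excludes one-point intervals, so every point of I is a limit point
  and limits within I are unique.\<close>

lemma interval_at_within_nontrivial:
  fixes I :: "real set"
  assumes "is_interval I" "interior I \<noteq> {}" "t \<in> I"
  shows "at t within I \<noteq> bot"
proof -
  have "I \<noteq> {a}" for a using assms(2) by auto
  then have "t islimpt I"
    using connected_imp_perfect [OF is_interval_connected [OF assms(1)] assms(3)] by blast
  then show ?thesis by (simp add: trivial_limit_within)
qed

text \<open>Inside charts the components are pointwise limits (the compact set \<open>{x}\<close>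
  and the index list \<open>[]\<close>). Where components have no meaning, the convention that they
  are 0 decides.\<close>

lemma has_curve_derivative_unique:
  assumes h: "has_curve_derivative A I \<gamma> h t" and h': "has_curve_derivative A I \<gamma> h' t"
    and nt: "at t within I \<noteq> bot"
  shows "h = h'"
proof (intro ext)
  fix c x
  let ?q = "\<lambda>s. tensor_scale (1 / (s - t)) (tensor_add (\<gamma> s) (tensor_scale (- 1) (\<gamma> t)))"
  have lim: "((\<lambda>s. ?q s c x) \<longlongrightarrow> k c x) (at t within I)"
    if "has_curve_derivative A I \<gamma> k t" "c \<in> A" "x \<in> coords c" for k
  proof -
    have "tensor_tendsto A ?q k (at t within I)"
      using that(1) unfolding has_curve_derivative_def by simp
    then have all: "\<forall>K. compact K \<and> K \<subseteq> coords c \<longrightarrow>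
        (\<forall>is. uniform_limit K (\<lambda>s. partials is (?q s c)) (partials is (k c)) (at t within I))"
      unfolding tensor_tendsto_def using that(2) by (rule bspec)
    have cond: "compact {x} \<and> {x} \<subseteq> coords c" using that(3) by simp
    from mp [OF spec [OF all, of "{x}"] cond, THEN spec, of "[]"] show ?thesis
      by (intro tendsto_uniform_limitI [where S = "{x}"]) simp_all
  qed
  show "h c x = h' c x"
  proof (cases "c \<in> A \<and> x \<in> coords c")
    case True
    then show ?thesis using tendsto_unique [OF nt lim [OF h] lim [OF h']] by simp
  next
    case False
    then have "h c x = 0" "h' c x = 0"
      using h h' unfolding has_curve_derivative_def sym_tensors_def by blast+
    then show ?thesis by simp
  qed
qed

lemma smooth_metric_curve_derivative:
  assumes \<gamma>: "smooth_metric_curve A I \<gamma>" and t: "t \<in> I"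
  shows "has_curve_derivative A I ((curve_deriv A I ^^ m) \<gamma>) ((curve_deriv A I ^^ Suc m) \<gamma> t) t"
proof -
  have nt: "at t within I \<noteq> bot"
    using \<gamma> t unfolding smooth_metric_curve_def by (intro interval_at_within_nontrivial) auto
  obtain h where h: "has_curve_derivative A I ((curve_deriv A I ^^ m) \<gamma>) h t"
    using \<gamma> t unfolding smooth_metric_curve_def by blast
  let ?\<gamma>' = "(curve_deriv A I ^^ m) \<gamma>"
  have "(THE k. has_curve_derivative A I ?\<gamma>' k t) = h"
    by (rule the_equality [where P = "\<lambda>k. has_curve_derivative A I ?\<gamma>' k t", OF h])
       (rule has_curve_derivative_unique [OF _ h nt])
  then have "curve_deriv A I ?\<gamma>' t = h"
    by (simp only: curve_deriv_def [of A I ?\<gamma>' t])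
  then show ?thesis using h by simp
qed

section \<open>Volume, first variation and Ebin metric as integrals against the reference
  measure\<close>

context chart_selection
begin

lemma at_point_add [simp]: "at_point (tensor_add h k) p = at_point h p + at_point k p"
  by (simp add: at_point_def tensor_add_def)

lemma at_point_scale [simp]: "at_point (tensor_scale r h) p = r *\<^sub>R at_point h p"
  by (simp add: at_point_def tensor_scale_def)

lemma measurable_at_point_reference:
  "h \<in> sym_tensors A \<Longrightarrow> at_point h \<in> borel_measurable reference_measure"
  using measurable_at_point by simp

definition vol :: "('a, 'n) tensor \<Rightarrow> real" where
  "vol g = (\<integral>p. sqrt (det (at_point g p)) \<partial>reference_measure)"

text \<open>Twice the derivative of the volume at g in direction h; for metrics it is also the Ebin
  pairing of g with h.\<close>

definition first_variation :: "('a, 'n) tensor \<Rightarrow> ('a, 'n) tensor \<Rightarrow> real" where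
  "first_variation g h = (\<integral>p. dvol (at_point g p) (at_point h p) \<partial>reference_measure)"

text \<open>Positivity with its constant, tested in the selected charts only, so that it passes
  directly from g to nearby tensors g + s h.\<close>

definition uniformly_positive :: "real \<Rightarrow> ('a, 'n) tensor \<Rightarrow> bool" where
  "uniformly_positive m g \<longleftrightarrow> m > 0 \<and> g \<in> sym_tensors A \<and> (\<forall>p. at_point g p \<in> coercive m)"

lemma metrics_sym_tensors: "g \<in> metrics A \<Longrightarrow> g \<in> sym_tensors A"
  by (simp add: metrics_def)

lemma metrics_uniformly_positive:
  assumes "g \<in> metrics A"
  obtains m where "uniformly_positive m g"
  using coercive_at_point [OF assms] metrics_sym_tensors [OF assms] unfolding uniformly_positive_def by metis

lemma uniformly_positive_region:
  assumes "uniformly_positive m g"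
  obtains M where "\<And>p. at_point g p \<in> matrix_region m M"
proof -
  obtain M where "\<And>p. norm (at_point g p) \<le> M"
    using bounded_at_point [of g] assms unfolding uniformly_positive_def by metis
  then show thesis using assms by (intro that [of M]) (auto simp: matrix_region_def uniformly_positive_def)
qed

lemma integrable_sqrt_det_at_point:
  assumes "uniformly_positive m g"
  shows "integrable reference_measure (\<lambda>p. sqrt (det (at_point g p)))"
proof -
  obtain M where "\<And>p. at_point g p \<in> matrix_region m M" using uniformly_positive_region [OF assms] by metis
  then show ?thesis
    using assms measurable_at_point_reference unfolding uniformly_positive_def
    by (intro integrable_sqrt_det [OF finite_measure_reference_measure]) auto
qed

lemma det_at_point_pos: "uniformly_positive m g \<Longrightarrow> det (at_point g p) > 0"
  unfolding uniformly_positive_def using coercive_det_pos by blast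

lemma total_volume_eq_vol:
  assumes g: "uniformly_positive m g"
  shows "total_volume A g = vol g"
proof -
  have gs: "g \<in> sym_tensors A" using g by (simp add: uniformly_positive_def)
  have "emeasure (riemannian_measure A g) UNIV = (\<integral>\<^sup>+p. ennreal (sqrt (det (at_point g p))) \<partial>reference_measure)"
    unfolding riemannian_measure_eq_density [OF gs]
    using measurable_at_point_reference [OF gs] by (subst emeasure_density) (auto intro!: measurable_sqrt_det)
  also have "\<dots> = ennreal (vol g)"
    unfolding vol_def using det_at_point_pos [OF g]
    by (intro nn_integral_eq_integral integrable_sqrt_det_at_point [OF g]) (simp add: less_imp_le)
  finally have "emeasure (riemannian_measure A g) UNIV = ennreal (vol g)" .
  moreover have "vol g \<ge> 0"
    unfolding vol_def using det_at_point_pos [OF g] by (intro integral_nonneg_AE) (simp add: less_imp_le)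
  ultimately show ?thesis by (simp add: total_volume_def measure_def)
qed

text \<open>The density of g is positive everywhere, so zero volume forces the reference measure to
  be null. Read backwards, one tensor of nonzero volume makes all uniformly positive tensors have
  nonzero volume, which justifies the later divisions.\<close>

lemma vol_eq_0_imp:
  assumes g: "uniformly_positive m g" and "vol g = 0" and h: "h \<in> sym_tensors A"
  shows "vol h = 0"
proof -
  have "AE p in reference_measure. sqrt (det (at_point g p)) = 0"
    using assms(2) det_at_point_pos [OF g] integrable_sqrt_det_at_point [OF g] unfolding vol_def
    by (subst (asm) integral_nonneg_eq_0_iff_AE) (simp_all add: less_imp_le)
  then have "AE p in reference_measure. False"
    by eventually_elim (use det_at_point_pos [OF g] in \<open>metis less_irrefl real_sqrt_eq_zero_cancel_iff\<close>)
  then have "AE p in reference_measure. sqrt (det (at_point h p)) = 0" by eventually_elim simp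
  then have "vol h = (\<integral>p. 0 \<partial>reference_measure)"
    unfolding vol_def using measurable_at_point_reference [OF h]
    by (intro integral_cong_AE) (auto intro!: measurable_sqrt_det)
  then show ?thesis by simp
qed

text \<open>Replaces the chart picked by \<open>SOME\<close> by the selected one: the components
  differ by congruence with the Jacobian of the transition map, which does not change the
  trace.\<close>

lemma trace_pairing_at_point:
  assumes g: "g \<in> sym_tensors A" and inv: "invertible (at_point g p)"
    and h: "h \<in> sym_tensors A" and k: "k \<in> sym_tensors A"
  shows "trace_pairing A g h k p
       = trace (matrix_inv (at_point g p) ** at_point h p ** matrix_inv (at_point g p) ** at_point k p)"
proof -
  define c where "c = (SOME c. c \<in> A \<and> p \<in> fst c)"
  have "\<kappa> p \<in> A \<and> p \<in> fst (\<kappa> p)" using chart_in_atlas in_chart by simp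
  then have "c \<in> A \<and> p \<in> fst c" unfolding c_def by (rule someI)
  then have c: "c \<in> A" "p \<in> fst c" by simp_all
  let ?x = "snd c p" and ?d = "\<kappa> p"
  have ov: "?x \<in> overlap c ?d" using c in_chart by (simp add: overlap_def)
  have T: "transition c ?d ?x = snd ?d p"
    by (rule transition_apply [OF closed_manifold_chart(3) [OF closed_manifold c(1)] c(2)])
  note J = invertible_jacobian_transition [OF closed_manifold c(1) chart_in_atlas ov]
  have comp: "l c ?x = transpose (jacobian (transition c ?d) (at ?x)) ** at_point l p ** jacobian (transition c ?d) (at ?x)"
    if "l \<in> sym_tensors A" for l
    using component_transform [OF that c(1) chart_in_atlas ov] by (simp add: T at_point_def)
  have "trace_pairing A g h k p = trace (matrix_inv (g c ?x) ** h c ?x ** matrix_inv (g c ?x) ** k c ?x)"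
    by (simp add: trace_pairing_def c_def Let_def)
  also have "\<dots> = trace (matrix_inv (at_point g p) ** at_point h p ** matrix_inv (at_point g p) ** at_point k p)"
    unfolding comp [OF g] comp [OF h] comp [OF k] by (rule trace_congruence [OF J inv])
  finally show ?thesis .
qed

text \<open>The integrand tr(g^-1 h g^-1 k) sqrt(det g) has the form \<open>dvol\<close> g H with H
  = h g^-1 k, so the bound for \<open>dvol\<close> also gives integrability.\<close>

lemma
  assumes g: "uniformly_positive m g" and h: "h \<in> sym_tensors A" and k: "k \<in> sym_tensors A"
  shows ebin_metric_eq: "ebin_metric A g h k =
      (\<integral>p. dvol (at_point g p) (at_point h p ** matrix_inv (at_point g p) ** at_point k p) \<partial>reference_measure)"
    and integrable_ebin_metric: "integrable reference_measure
      (\<lambda>p. dvol (at_point g p) (at_point h p ** matrix_inv (at_point g p) ** at_point k p))"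
proof -
  have gs: "g \<in> sym_tensors A" and m: "m > 0" and co: "\<And>p. at_point g p \<in> coercive m"
    using g by (simp_all add: uniformly_positive_def)
  let ?i = "\<lambda>p. matrix_inv (at_point g p)"
  have mi: "?i \<in> borel_measurable reference_measure"
    by (rule measurable_matrix_inv [OF measurable_at_point_reference [OF gs] m co])
  note meas = measurable_at_point_reference [OF gs] measurable_at_point_reference [OF h] measurable_at_point_reference [OF k]
  have tp: "trace_pairing A g h k = (\<lambda>p. trace (?i p ** at_point h p ** ?i p ** at_point k p))"
    by (rule ext) (rule trace_pairing_at_point [OF gs coercive_invertible [OF co m] h k])
  have "ebin_metric A g h k = (\<integral>p. sqrt (det (at_point g p)) *\<^sub>R trace_pairing A g h k p \<partial>reference_measure)"
    unfolding ebin_metric_def riemannian_measure_eq_density [OF gs]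
  proof (rule integral_density)
    show "trace_pairing A g h k \<in> borel_measurable reference_measure"
      unfolding tp by (intro measurable_trace measurable_matrix_mult mi meas)
    show "(\<lambda>p. sqrt (det (at_point g p))) \<in> borel_measurable reference_measure"
      by (intro measurable_sqrt_det meas)
    show "AE p in reference_measure. 0 \<le> sqrt (det (at_point g p))"
      using det_at_point_pos [OF g] by (simp add: less_imp_le)
  qed
  then show "ebin_metric A g h k =
      (\<integral>p. dvol (at_point g p) (at_point h p ** ?i p ** at_point k p) \<partial>reference_measure)"
    by (simp add: tp dvol_def matrix_mul_assoc mult.commute)
  obtain M where M: "\<And>p. at_point g p \<in> matrix_region m M" using uniformly_positive_region [OF g] by metis
  obtain B where B: "\<And>p. norm (at_point h p) \<le> B" using bounded_at_point [OF h] by metis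
  obtain C where C: "\<And>p. norm (at_point k p) \<le> C" using bounded_at_point [OF k] by metis
  let ?b = "real CARD('n) * real CARD('n) / m"
  have "norm (at_point h p ** ?i p ** at_point k p) \<le> B * ?b * C" for p
  proof -
    have "norm (at_point h p ** ?i p ** at_point k p) \<le> norm (at_point h p) * norm (?i p) * norm (at_point k p)"
      by (meson norm_matrix_mult_le mult_right_mono norm_ge_zero order_trans)
    also have "\<dots> \<le> B * ?b * C"
      using B [of p] C [of p] norm_matrix_inv_le [OF co m, of p] m order_trans [OF norm_ge_zero B]
      by (intro mult_mono) auto
    finally show ?thesis .
  qed
  then show "integrable reference_measure (\<lambda>p. dvol (at_point g p) (at_point h p ** ?i p ** at_point k p))"
    by (intro integrable_dvol [OF finite_measure_reference_measure _ m M] meas measurable_matrix_mult mi)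
qed

lemma ebin_metric_linear_left:
  assumes g: "uniformly_positive m g" and h: "h \<in> sym_tensors A" "h' \<in> sym_tensors A" and k: "k \<in> sym_tensors A"
  shows "ebin_metric A g (tensor_add h (tensor_scale r h')) k = ebin_metric A g h k + r * ebin_metric A g h' k"
proof -
  let ?F = "\<lambda>h p. dvol (at_point g p) (at_point h p ** matrix_inv (at_point g p) ** at_point k p)"
  have "?F (tensor_add h (tensor_scale r h')) p = ?F h p + r * ?F h' p" for p
    using linear_dvol [of "at_point g p"]
    by (simp add: matrix_add_rdistrib matrix_mult_scaleR_left linear_add linear_cmul)
  then show ?thesis
    using integrable_ebin_metric [OF g _ k] h sym_tensors_linear_combination [OF closed_manifold h]
    by (simp add: ebin_metric_eq [OF g _ k])
qed

lemma ebin_metric_commute: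
  assumes g: "uniformly_positive m g" and h: "h \<in> sym_tensors A" and k: "k \<in> sym_tensors A"
  shows "ebin_metric A g h k = ebin_metric A g k h"
proof -
  have "trace (X ** (H ** X ** K)) = trace (X ** (K ** X ** H))" for X H K :: "real^'n^'n"
    using trace_mul_sym [of "X ** H" "X ** K"] by (simp add: matrix_mul_assoc)
  then show ?thesis
    unfolding ebin_metric_eq [OF g h k] ebin_metric_eq [OF g k h] dvol_def by simp
qed

text \<open>One factor g^-1 g cancels. This is what makes the position field, up to the factor 1/2,
  the gradient of the volume.\<close>

lemma ebin_metric_self:
  assumes g: "uniformly_positive m g" and h: "h \<in> sym_tensors A"
  shows "ebin_metric A g g h = first_variation g h"
proof -
  have gs: "g \<in> sym_tensors A" and inv: "\<And>p. invertible (at_point g p)"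
    using g coercive_invertible unfolding uniformly_positive_def by auto
  show ?thesis
    unfolding ebin_metric_eq [OF g gs h] first_variation_def by (simp add: matrix_inv_right [OF inv])
qed

text \<open>The two inverses contribute (1 + r)^(-2); the density contributes (1 + r)^(n/2), which
  the total volume cancels. The scaled metric is written g + r g because \<open>levi_civita\<close>
  differentiates along such lines.\<close>

lemma normalized_ebin_metric_homothety:
  assumes g: "uniformly_positive m g" and h: "h \<in> sym_tensors A" and k: "k \<in> sym_tensors A" and r: "1 + r > 0"
  shows "normalized_ebin_metric A (tensor_add g (tensor_scale r g)) h k = normalized_ebin_metric A g h k / (1 + r)\<^sup>2"
proof -
  let ?g = "tensor_add g (tensor_scale r g)"
  have gs: "g \<in> sym_tensors A" and m: "m > 0" and co: "\<And>p. at_point g p \<in> coercive m"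
    using g by (simp_all add: uniformly_positive_def)
  have at: "at_point ?g p = (1 + r) *\<^sub>R at_point g p" for p by (simp add: scaleR_add_left)
  have "at_point ?g p \<in> coercive ((1 + r) * m)" for p
  proof -
    have "(1 + r) * m * (v \<bullet> v) \<le> v \<bullet> (((1 + r) *\<^sub>R at_point g p) *v v)" for v
      using co [of p] r mult_left_mono [of "m * (v \<bullet> v)" "v \<bullet> (at_point g p *v v)" "1 + r"]
      by (simp add: coercive_def scaleR_matrix_vector_assoc [symmetric] mult.assoc)
    then show ?thesis unfolding at coercive_def by simp
  qed
  then have g': "uniformly_positive ((1 + r) * m) ?g"
    using r m sym_tensors_linear_combination [OF closed_manifold gs gs] by (simp add: uniformly_positive_def)
  let ?c = "sqrt ((1 + r) ^ CARD('n))"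
  have c: "?c > 0" using r by simp
  have inv: "matrix_inv ((1 + r) *\<^sub>R at_point g p) = (1 / (1 + r)) *\<^sub>R matrix_inv (at_point g p)" for p
    using r matrix_inv_right [OF coercive_invertible [OF co m]]
    by (intro matrix_inv_unique) (simp add: matrix_mult_scaleR_left matrix_mult_scaleR_right)
  have "ebin_metric A ?g h k = ?c / (1 + r)\<^sup>2 * ebin_metric A g h k"
    unfolding ebin_metric_eq [OF g' h k] ebin_metric_eq [OF g h k] at dvol_def inv
    by (simp add: det_scaleR real_sqrt_mult matrix_mult_scaleR_left matrix_mult_scaleR_right trace_scaleR
        power2_eq_square mult_ac integral_mult_right_zero [symmetric])
  moreover have "total_volume A ?g = ?c * total_volume A g"
    unfolding total_volume_eq_vol [OF g] total_volume_eq_vol [OF g'] vol_def at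
    by (simp add: det_scaleR real_sqrt_mult)
  ultimately show ?thesis
    using c by (simp add: normalized_ebin_metric_def)
qed

lemma uniformly_positive_perturb:
  assumes g: "uniformly_positive m g" and h: "h \<in> sym_tensors A"
  obtains d where "d > 0" "\<And>s. \<bar>s\<bar> < d \<Longrightarrow> uniformly_positive (m / 2) (tensor_add g (tensor_scale s h))"
proof -
  have gs: "g \<in> sym_tensors A" and m: "m > 0" and co: "\<And>p. at_point g p \<in> coercive m"
    using g by (simp_all add: uniformly_positive_def)
  obtain B where B: "B > 0" "\<And>p. norm (at_point h p) \<le> B" using bounded_at_point [OF h] by metis
  show thesis
  proof (rule that [of "m / (2 * B)"])
    show "m / (2 * B) > 0" using m B by simp
    fix s assume s: "\<bar>s\<bar> < m / (2 * B)"
    have "at_point (tensor_add g (tensor_scale s h)) p \<in> coercive (m - m / 2)" for p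
    proof (rule coercive_perturb [OF co])
      have "\<bar>s\<bar> * norm (at_point h p) \<le> m / (2 * B) * B"
        using s B m by (intro mult_mono) (auto intro: less_imp_le)
      then show "norm (at_point (tensor_add g (tensor_scale s h)) p - at_point g p) \<le> m / 2"
        using B by simp
    qed
    then show "uniformly_positive (m / 2) (tensor_add g (tensor_scale s h))"
      using m sym_tensors_linear_combination [OF closed_manifold gs h] by (simp add: uniformly_positive_def)
  qed
qed

end

section \<open>Geodesics\<close>

context chart_selection
begin

section \<open>Volume and first variation along curves\<close>

lemma has_uniform_derivative_at_point:
  assumes "has_curve_derivative A I \<gamma> h t"
  shows "has_uniform_derivative (\<lambda>s. at_point (\<gamma> s)) (at_point h) t I"
proof -
  have "tensor_tendsto A (\<lambda>s. tensor_scale (1 / (s - t)) (tensor_add (\<gamma> s) (tensor_scale (- 1) (\<gamma> t)))) h (at t within I)"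
    using assms by (simp add: has_curve_derivative_def)
  from uniform_limit_at_point [OF this] show ?thesis
    unfolding has_uniform_derivative_def
    by (rule uniform_limit_cong' [THEN iffD1, rotated 2]) simp_all
qed

lemma has_uniform_derivative_affine:
  "has_uniform_derivative (\<lambda>s. at_point (tensor_add g (tensor_scale (s - t) h))) (at_point h) t I"
  unfolding has_uniform_derivative_def
proof (rule uniform_limitI)
  fix e :: real assume "e > 0"
  show "\<forall>\<^sub>F s in at t within I. \<forall>p\<in>UNIV. dist ((1 / (s - t)) *\<^sub>R
      (at_point (tensor_add g (tensor_scale (s - t) h)) p - at_point (tensor_add g (tensor_scale (t - t) h)) p)) (at_point h p) < e"
    using eventually_at_within_near [OF zero_less_one] by eventually_elim (use \<open>e > 0\<close> in simp)
qed

lemma vol_has_real_derivative: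
  assumes sym: "\<And>s. s \<in> I \<Longrightarrow> \<gamma> s \<in> sym_tensors A" and t: "t \<in> I"
    and \<gamma>: "has_uniform_derivative (\<lambda>s. at_point (\<gamma> s)) (at_point h) t I" and h: "h \<in> sym_tensors A"
    and pos: "uniformly_positive m (\<gamma> t)"
  shows "((\<lambda>s. vol (\<gamma> s)) has_real_derivative first_variation (\<gamma> t) h / 2) (at t within I)"
proof -
  obtain M where M: "\<And>p. at_point (\<gamma> t) p \<in> matrix_region m M" using uniformly_positive_region [OF pos] by metis
  obtain N where N: "\<And>p. norm (at_point h p) \<le> N" using bounded_at_point [OF h] by metis
  have m: "m > 0" using pos by (simp add: uniformly_positive_def)
  show ?thesis
    unfolding vol_def first_variation_def
    by (rule has_real_derivative_integral_sqrt_det [OF finite_measure_reference_measure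
          measurable_at_point_reference [OF sym] t \<gamma> measurable_at_point_reference [OF h] N M m])
qed

lemma first_variation_diff_has_real_derivative:
  assumes sym: "\<And>s. s \<in> I \<Longrightarrow> \<gamma> s \<in> sym_tensors A" "\<And>s. s \<in> I \<Longrightarrow> \<sigma> s \<in> sym_tensors A"
      "\<And>s. s \<in> I \<Longrightarrow> \<eta> s \<in> sym_tensors A"
    and t: "t \<in> I"
    and \<gamma>: "has_uniform_derivative (\<lambda>s. at_point (\<gamma> s)) (at_point h) t I"
    and \<sigma>: "has_uniform_derivative (\<lambda>s. at_point (\<sigma> s)) (at_point h) t I"
    and \<eta>: "has_uniform_derivative (\<lambda>s. at_point (\<eta> s)) (at_point k) t I"
    and eq: "at_point (\<sigma> t) = at_point (\<gamma> t)"
    and h: "h \<in> sym_tensors A" and k: "k \<in> sym_tensors A"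
    and pos: "uniformly_positive m (\<gamma> t)"
  shows "((\<lambda>s. first_variation (\<gamma> s) (\<eta> s) - first_variation (\<sigma> s) (\<eta> t))
      has_real_derivative first_variation (\<gamma> t) k) (at t within I)"
proof -
  obtain M where M: "\<And>p. at_point (\<gamma> t) p \<in> matrix_region m M" using uniformly_positive_region [OF pos] by metis
  obtain N1 where N1: "\<And>p. norm (at_point h p) \<le> N1" using bounded_at_point [OF h] by metis
  obtain N2 where N2: "\<And>p. norm (at_point k p) \<le> N2" using bounded_at_point [OF k] by metis
  obtain N3 where N3: "\<And>p. norm (at_point (\<eta> t) p) \<le> N3" using bounded_at_point [OF sym(3) [OF t]] by metis
  let ?N = "max N1 (max N2 N3)"
  have N: "norm (at_point h p) \<le> ?N" "norm (at_point k p) \<le> ?N" "norm (at_point (\<eta> t) p) \<le> ?N" for p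
    using N1 [of p] N2 [of p] N3 [of p] by simp_all
  have m: "m > 0" using pos by (simp add: uniformly_positive_def)
  show ?thesis
    unfolding first_variation_def
    by (rule has_real_derivative_integral_dvol_diff [OF finite_measure_reference_measure t
          measurable_at_point_reference [OF sym(1)] measurable_at_point_reference [OF sym(2)]
          measurable_at_point_reference [OF sym(3)] \<gamma> \<sigma> \<eta> eq measurable_at_point_reference [OF k] N M m])
qed

text \<open>Scaling is an isometry, so the position field \<open>g \<mapsto> g\<close> is a Killing field.\<close>

lemma levi_civita_position:
  assumes lc: "levi_civita A (normalized_ebin_metric A) \<Gamma>"
    and g: "g \<in> metrics A" and h: "h \<in> sym_tensors A"
  shows "normalized_ebin_metric A g (\<Gamma> g g h) h = - normalized_ebin_metric A g h h"
proof -
  let ?N = "normalized_ebin_metric A"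
  obtain m where m: "uniformly_positive m g" using metrics_uniformly_positive [OF g] by metis
  have gs: "g \<in> sym_tensors A" using g by (rule metrics_sym_tensors)
  have \<Gamma>: "\<Gamma> g g h \<in> sym_tensors A"
    using lc g gs h unfolding levi_civita_def by blast
  have 1: "((\<lambda>s. ?N (tensor_add g (tensor_scale s g)) h h)
      has_real_derivative ?N g (\<Gamma> g g h) h + ?N g h (\<Gamma> g g h)) (at 0)"
    using lc g gs h unfolding levi_civita_def by blast
  have "((\<lambda>s. ?N g h h / (1 + s)\<^sup>2) has_real_derivative - 2 * ?N g h h) (at 0)"
    by (auto intro!: derivative_eq_intros)
  then have 2: "((\<lambda>s. ?N (tensor_add g (tensor_scale s g)) h h) has_real_derivative - 2 * ?N g h h) (at 0)"
  proof (rule has_field_derivative_transform_within [where d = 1])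
    show "?N g h h / (1 + s)\<^sup>2 = ?N (tensor_add g (tensor_scale s g)) h h" if "dist s 0 < 1" for s
      using that by (intro normalized_ebin_metric_homothety [OF m h h, symmetric]) auto
  qed simp_all
  have "?N g h (\<Gamma> g g h) = ?N g (\<Gamma> g g h) h"
    unfolding normalized_ebin_metric_def using ebin_metric_commute [OF m h \<Gamma>] by simp
  then show ?thesis using DERIV_unique [OF 1 2] by simp
qed

text \<open>On the line \<sigma> = g + s h the quotient is N(\<sigma>, h) = N(g, h) + s N(h, h),
  with N taken at \<sigma>; both pairings have constant arguments, as \<open>levi_civita\<close>
  requires. At s = 0 the derivative is N(\<open>\<Gamma> g h g\<close>, h) + N(g,
  \<open>\<Gamma> g h h\<close>) + N(h, h), and by symmetry of \<Gamma> and the Killing equation the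
  outer terms cancel.\<close>

lemma logarithmic_derivative_affine:
  assumes lc: "levi_civita A (normalized_ebin_metric A) \<Gamma>"
    and g: "g \<in> metrics A" and h: "h \<in> sym_tensors A"
  shows "((\<lambda>s. first_variation (tensor_add g (tensor_scale s h)) h / vol (tensor_add g (tensor_scale s h)))
      has_real_derivative first_variation g (\<Gamma> g h h) / vol g) (at 0)"
proof -
  let ?N = "normalized_ebin_metric A"
  let ?\<sigma> = "\<lambda>s. tensor_add g (tensor_scale s h)"
  obtain m where m: "uniformly_positive m g" using metrics_uniformly_positive [OF g] by metis
  have gs: "g \<in> sym_tensors A" using g by (rule metrics_sym_tensors)
  have \<Gamma>: "\<Gamma> g h h \<in> sym_tensors A" "\<Gamma> g h g = \<Gamma> g g h"
    using lc g gs h unfolding levi_civita_def by blast+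
  have \<sigma>0: "?\<sigma> 0 = g" by (simp add: tensor_add_def tensor_scale_def fun_eq_iff)
  have d1: "((\<lambda>s. ?N (?\<sigma> s) g h) has_real_derivative ?N g (\<Gamma> g h g) h + ?N g g (\<Gamma> g h h)) (at 0)"
    using lc g gs h unfolding levi_civita_def by blast
  have d2: "((\<lambda>s. ?N (?\<sigma> s) h h) has_real_derivative ?N g (\<Gamma> g h h) h + ?N g h (\<Gamma> g h h)) (at 0)"
    using lc g h unfolding levi_civita_def by blast
  have "((\<lambda>s. ?N (?\<sigma> s) g h + s * ?N (?\<sigma> s) h h) has_real_derivative
      (?N g (\<Gamma> g h g) h + ?N g g (\<Gamma> g h h)) + (1 * ?N (?\<sigma> 0) h h
        + (?N g (\<Gamma> g h h) h + ?N g h (\<Gamma> g h h)) * 0)) (at 0)"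
    by (intro DERIV_add d1 DERIV_mult DERIV_ident d2)
  then have *: "((\<lambda>s. ?N (?\<sigma> s) g h + s * ?N (?\<sigma> s) h h) has_real_derivative ?N g g (\<Gamma> g h h)) (at 0)"
    using levi_civita_position [OF lc g h] by (simp add: \<Gamma>(2) \<sigma>0)
  obtain d where d: "d > 0" "\<And>s. \<bar>s\<bar> < d \<Longrightarrow> uniformly_positive (m / 2) (?\<sigma> s)"
    using uniformly_positive_perturb [OF m h] by metis
  from * have "((\<lambda>s. first_variation (?\<sigma> s) h / vol (?\<sigma> s)) has_real_derivative ?N g g (\<Gamma> g h h)) (at 0)"
  proof (rule has_field_derivative_transform_within [where d = d])
    fix s :: real assume "dist s 0 < d"
    then have s: "uniformly_positive (m / 2) (?\<sigma> s)" using d(2) by simp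
    show "?N (?\<sigma> s) g h + s * ?N (?\<sigma> s) h h = first_variation (?\<sigma> s) h / vol (?\<sigma> s)"
      unfolding normalized_ebin_metric_def total_volume_eq_vol [OF s] ebin_metric_self [OF s h, symmetric]
        ebin_metric_linear_left [OF s gs h h]
      by (simp add: add_divide_distrib)
  qed (use d(1) in simp_all)
  then show ?thesis
    by (simp add: normalized_ebin_metric_def ebin_metric_self [OF m \<Gamma>(1)] total_volume_eq_vol [OF m])
qed

text \<open>Write F for the first variation and V for the volume. The derivative of F(\<gamma>,
  \<gamma>') is split into that of F(\<gamma>, \<gamma>') - F(\<sigma>, h), which is F(\<gamma>, k)
  by the comparison lemma, and that of F(\<sigma>, h), recovered from the quotient F/V along the
  line \<sigma>.\<close>

lemma geodesic_logarithmic_derivative: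
  assumes lc: "levi_civita A (normalized_ebin_metric A) \<Gamma>"
    and \<gamma>: "geodesic A \<Gamma> I \<gamma>" and t: "t \<in> I" and vol: "vol (\<gamma> t) \<noteq> 0"
  shows "((\<lambda>s. first_variation (\<gamma> s) (curve_deriv A I \<gamma> s) / vol (\<gamma> s)) has_real_derivative 0) (at t within I)"
proof -
  let ?\<gamma>' = "curve_deriv A I \<gamma>"
  define g h k where "g = \<gamma> t" and "h = ?\<gamma>' t" and "k = curve_deriv A I ?\<gamma>' t"
  let ?\<sigma> = "\<lambda>s. tensor_add g (tensor_scale (s - t) h)"
  have sm: "smooth_metric_curve A I \<gamma>" using \<gamma> by (simp add: geodesic_def)
  have g: "\<gamma> s \<in> metrics A" if "s \<in> I" for s using sm that by (simp add: smooth_metric_curve_def)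
  note sym = metrics_sym_tensors [OF g]
  obtain m where m: "uniformly_positive m (\<gamma> t)" using metrics_uniformly_positive [OF g [OF t]] by metis
  have d1: "has_curve_derivative A I \<gamma> (?\<gamma>' s) s" if "s \<in> I" for s
    using smooth_metric_curve_derivative [OF sm that, of 0] by simp
  have d2: "has_curve_derivative A I ?\<gamma>' k t"
    using smooth_metric_curve_derivative [OF sm t, of 1] by (simp add: k_def)
  have \<gamma>'s: "?\<gamma>' s \<in> sym_tensors A" if "s \<in> I" for s
    using d1 [OF that] by (simp add: has_curve_derivative_def)
  have hs: "h \<in> sym_tensors A" using \<gamma>'s [OF t] by (simp add: h_def)
  have ks: "k \<in> sym_tensors A" using d2 by (simp add: has_curve_derivative_def)
  have \<sigma>s: "?\<sigma> s \<in> sym_tensors A" for s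
    unfolding g_def by (rule sym_tensors_linear_combination [OF closed_manifold sym [OF t] hs])
  have u\<gamma>: "has_uniform_derivative (\<lambda>s. at_point (\<gamma> s)) (at_point h) t I"
    unfolding h_def by (rule has_uniform_derivative_at_point [OF d1 [OF t]])
  have u\<sigma>: "has_uniform_derivative (\<lambda>s. at_point (?\<sigma> s)) (at_point h) t I"
    by (rule has_uniform_derivative_affine)
  have u\<gamma>': "has_uniform_derivative (\<lambda>s. at_point (?\<gamma>' s)) (at_point k) t I"
    by (rule has_uniform_derivative_at_point [OF d2])
  have \<sigma>t: "?\<sigma> t = \<gamma> t" by (simp add: g_def tensor_add_def tensor_scale_def fun_eq_iff)
  have \<Gamma>: "first_variation (\<gamma> t) (\<Gamma> (\<gamma> t) h h) = - first_variation (\<gamma> t) k"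
  proof -
    have "tensor_add k (\<Gamma> (\<gamma> t) h h) = tensor_zero"
      using \<gamma> t unfolding geodesic_def h_def k_def by blast
    then have "at_point (tensor_add k (\<Gamma> (\<gamma> t) h h)) p = 0" for p
      by (simp add: at_point_def tensor_zero_def)
    then have "at_point (\<Gamma> (\<gamma> t) h h) p = - at_point k p" for p
      by (simp add: add_eq_0_iff)
    then show ?thesis
      by (simp add: first_variation_def linear_neg [OF linear_dvol])
  qed
  have V\<gamma>: "((\<lambda>s. vol (\<gamma> s)) has_real_derivative first_variation (\<gamma> t) h / 2) (at t within I)"
    by (rule vol_has_real_derivative [OF sym t u\<gamma> hs m])
  have V\<sigma>: "((\<lambda>s. vol (?\<sigma> s)) has_real_derivative first_variation (\<gamma> t) h / 2) (at t within I)"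
    using vol_has_real_derivative [of I ?\<sigma>, OF \<sigma>s t u\<sigma> hs, unfolded \<sigma>t, OF m] .
  have E: "((\<lambda>s. first_variation (\<gamma> s) (?\<gamma>' s) - first_variation (?\<sigma> s) h)
      has_real_derivative first_variation (\<gamma> t) k) (at t within I)"
    using first_variation_diff_has_real_derivative [OF sym \<sigma>s \<gamma>'s t u\<gamma> u\<sigma> u\<gamma>' _ hs ks m] \<sigma>t
    by (simp add: h_def)
  have "((\<lambda>s. s - t) has_real_derivative 1) (at t)"
    by (auto intro!: derivative_eq_intros)
  from DERIV_chain2 [OF _ this, of "\<lambda>s. first_variation (tensor_add g (tensor_scale s h)) h / vol (tensor_add g (tensor_scale s h))"]
  have "((\<lambda>s. first_variation (?\<sigma> s) h / vol (?\<sigma> s)) has_real_derivative first_variation g (\<Gamma> g h h) / vol g) (at t)"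
    using logarithmic_derivative_affine [OF lc g [OF t] hs] by (simp add: g_def)
  \<comment> \<open>The geodesic equation replaces the Christoffel term by minus the acceleration
    k.\<close>
  then have P: "((\<lambda>s. first_variation (?\<sigma> s) h / vol (?\<sigma> s)) has_real_derivative
      - first_variation (\<gamma> t) k / vol (\<gamma> t)) (at t within I)"
    unfolding g_def \<Gamma> by (rule has_field_derivative_at_within)
  let ?F = "first_variation (\<gamma> t)" and ?V = "vol (\<gamma> t)"
  \<comment> \<open>Multiplying the quotient by the volume of \<sigma> gives back F(\<sigma>, h),
    because nearby tensors on the line have nonzero volume.\<close>
  have *: "((\<lambda>s. first_variation (?\<sigma> s) h / vol (?\<sigma> s) * vol (?\<sigma> s)) has_real_derivative
      (- ?F k / ?V) * vol (?\<sigma> t) + ?F h / 2 * (first_variation (?\<sigma> t) h / vol (?\<sigma> t))) (at t within I)"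
    by (rule DERIV_mult [OF P V\<sigma>])
  obtain d where d: "d > 0" "\<And>s. \<bar>s\<bar> < d \<Longrightarrow> uniformly_positive (m / 2) (tensor_add g (tensor_scale s h))"
    using uniformly_positive_perturb [OF m hs] unfolding g_def by metis
  from * have "((\<lambda>s. first_variation (?\<sigma> s) h) has_real_derivative
      (- ?F k / ?V) * vol (?\<sigma> t) + ?F h / 2 * (first_variation (?\<sigma> t) h / vol (?\<sigma> t))) (at t within I)"
  proof (rule has_field_derivative_transform_within [where d = d])
    fix s assume "s \<in> I" "dist s t < d"
    then have "uniformly_positive (m / 2) (?\<sigma> s)" using d(2) by (simp add: dist_real_def)
    then have "vol (?\<sigma> s) \<noteq> 0" using vol_eq_0_imp sym [OF t] vol by blast
    then show "first_variation (?\<sigma> s) h / vol (?\<sigma> s) * vol (?\<sigma> s) = first_variation (?\<sigma> s) h" by simp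
  qed (use t d(1) in simp_all)
  then have S: "((\<lambda>s. first_variation (?\<sigma> s) h) has_real_derivative - ?F k + ?F h * ?F h / (2 * ?V)) (at t within I)"
    unfolding \<sigma>t using vol by simp
  \<comment> \<open>The terms with k cancel. The remaining derivative F^2 / (2 V), together with V'
    = F/2, makes the numerator of the quotient rule vanish.\<close>
  have "((\<lambda>s. first_variation (\<gamma> s) (?\<gamma>' s)) has_real_derivative ?F h * ?F h / (2 * ?V)) (at t within I)"
    using DERIV_add [OF E S] by simp
  from DERIV_divide [OF this V\<gamma> vol] show ?thesis
    using vol by (simp add: h_def)
qed

text \<open>A curve inside the level set has constant volume, and half of the first variation is the
  derivative of that constant at an interior point of the interval.\<close>

lemma tangent_fixed_volume:
  assumes h: "h \<in> tangent_vectors A (fixed_volume_metrics A v) g"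
  shows "first_variation g h = 0"
proof -
  obtain e \<alpha> where e: "e > 0" and \<alpha>: "smooth_metric_curve A {-e<..<e} \<alpha>"
    and S: "\<And>t. t \<in> {-e<..<e} \<Longrightarrow> \<alpha> t \<in> fixed_volume_metrics A v"
    and \<alpha>0: "\<alpha> 0 = g" and d: "curve_deriv A {-e<..<e} \<alpha> 0 = h"
    using h unfolding tangent_vectors_def by blast
  let ?I = "{-e<..<e}"
  have 0: "0 \<in> ?I" using e by simp
  have met: "\<alpha> s \<in> metrics A" "total_volume A (\<alpha> s) = v" if "s \<in> ?I" for s
    using S [OF that] by (simp_all add: fixed_volume_metrics_def)
  have hc: "has_curve_derivative A ?I \<alpha> h 0"
    using smooth_metric_curve_derivative [OF \<alpha> 0, of 0] d by simp
  then have hs: "h \<in> sym_tensors A" by (simp add: has_curve_derivative_def)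
  obtain m where m: "uniformly_positive m (\<alpha> 0)" using metrics_uniformly_positive [OF met(1) [OF 0]] by metis
  have 1: "((\<lambda>s. vol (\<alpha> s)) has_real_derivative first_variation (\<alpha> 0) h / 2) (at 0 within ?I)"
    by (rule vol_has_real_derivative [OF metrics_sym_tensors [OF met(1)] 0 has_uniform_derivative_at_point [OF hc] hs m])
  have const: "vol (\<alpha> s) = v" if s: "s \<in> ?I" for s
  proof -
    obtain m where "uniformly_positive m (\<alpha> s)" using metrics_uniformly_positive [OF met(1) [OF s]] by metis
    then show ?thesis using total_volume_eq_vol met(2) [OF s] by simp
  qed
  have "((\<lambda>s. v) has_real_derivative 0) (at 0 within ?I)" by simp
  then have 2: "((\<lambda>s. vol (\<alpha> s)) has_real_derivative 0) (at 0 within ?I)"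
    by (rule has_field_derivative_transform_within [OF _ e 0]) (simp add: const)
  have "at 0 within ?I = at 0" using 0 by (intro at_within_open) auto
  with 1 2 have "first_variation (\<alpha> 0) h / 2 = 0" by (metis DERIV_unique)
  then show ?thesis using \<alpha>0 by simp
qed

text \<open>The conserved quotient F/V vanishes at time 0 by tangency, hence on all of I. Thus V' =
  F/2 = 0 on a convex set and V stays at v.\<close>

lemma geodesic_volume_constant:
  assumes lc: "levi_civita A (normalized_ebin_metric A) \<Gamma>"
    and \<gamma>: "geodesic A \<Gamma> I \<gamma>" and 0: "0 \<in> I" and start: "\<gamma> 0 \<in> fixed_volume_metrics A v" and v: "v > 0"
    and tangent: "curve_deriv A I \<gamma> 0 \<in> tangent_vectors A (fixed_volume_metrics A v) (\<gamma> 0)"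
    and t: "t \<in> I"
  shows "\<gamma> t \<in> fixed_volume_metrics A v"
proof -
  let ?\<gamma>' = "curve_deriv A I \<gamma>"
  have sm: "smooth_metric_curve A I \<gamma>" using \<gamma> by (simp add: geodesic_def)
  have conv: "convex I" using sm by (simp add: smooth_metric_curve_def is_interval_convex)
  have met: "\<gamma> s \<in> metrics A" if "s \<in> I" for s using sm that by (simp add: smooth_metric_curve_def)
  have tv: "total_volume A (\<gamma> s) = vol (\<gamma> s)" if "s \<in> I" for s
    using metrics_uniformly_positive [OF met [OF that]] total_volume_eq_vol by metis
  have vol0: "vol (\<gamma> 0) = v" using start tv [OF 0] by (simp add: fixed_volume_metrics_def)
  \<comment> \<open>The positive volume v at time 0 carries over to every time, since a zero volume
    anywhere would make the reference measure null.\<close>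
  have vol: "vol (\<gamma> s) \<noteq> 0" if s: "s \<in> I" for s
  proof
    assume "vol (\<gamma> s) = 0"
    moreover obtain m where "uniformly_positive m (\<gamma> s)" using metrics_uniformly_positive [OF met [OF s]] by metis
    ultimately have "vol (\<gamma> 0) = 0" using vol_eq_0_imp metrics_sym_tensors [OF met [OF 0]] by blast
    then show False using vol0 v by simp
  qed
  obtain c where "\<forall>s\<in>I. first_variation (\<gamma> s) (?\<gamma>' s) / vol (\<gamma> s) = c"
    using has_field_derivative_zero_constant [OF conv geodesic_logarithmic_derivative [OF lc \<gamma> _ vol]] by blast
  moreover have "first_variation (\<gamma> 0) (?\<gamma>' 0) = 0" by (rule tangent_fixed_volume [OF tangent])
  ultimately have zero: "first_variation (\<gamma> s) (?\<gamma>' s) = 0" if "s \<in> I" for s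
    using 0 that vol [OF that] by (metis divide_eq_0_iff)
  have "((\<lambda>s. vol (\<gamma> s)) has_real_derivative 0) (at s within I)" if s: "s \<in> I" for s
  proof -
    have hc: "has_curve_derivative A I \<gamma> (?\<gamma>' s) s"
      using smooth_metric_curve_derivative [OF sm s, of 0] by simp
    then have hs: "?\<gamma>' s \<in> sym_tensors A" by (simp add: has_curve_derivative_def)
    obtain m where m: "uniformly_positive m (\<gamma> s)" using metrics_uniformly_positive [OF met [OF s]] by metis
    show ?thesis
      using vol_has_real_derivative [OF metrics_sym_tensors [OF met] s has_uniform_derivative_at_point [OF hc] hs m]
      by (simp add: zero [OF s])
  qed
  then obtain c where "\<forall>s\<in>I. vol (\<gamma> s) = c"
    using has_field_derivative_zero_constant [OF conv] by blast
  then have "vol (\<gamma> t) = v" using vol0 0 t by metis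
  then show ?thesis using tv [OF t] met [OF t] by (simp add: fixed_volume_metrics_def)
qed

end

theorem corollary3p3:
  fixes A :: "('a::t2_space, 'n::finite) chart set"
    and \<Gamma> :: "('a, 'n) tensor \<Rightarrow> ('a, 'n) tensor \<Rightarrow> ('a, 'n) tensor \<Rightarrow> ('a, 'n) tensor"
    and v :: real
  assumes "closed_manifold A"
    and "levi_civita A (normalized_ebin_metric A) \<Gamma>"
    and "v > 0"
  shows "totally_geodesic A \<Gamma> (fixed_volume_metrics A v)"
proof -
  obtain \<kappa> where "chart_selection A \<kappa>"
    using ex_chart_selection [OF assms(1)] by (rule exE)
  then interpret chart_selection A \<kappa> .
  show ?thesis
    unfolding totally_geodesic_def
    by (intro allI impI ballI, elim conjE) (rule geodesic_volume_constant [OF assms(2) _ _ _ assms(3)])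
qed

end
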